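(* Let $k$ be an algebraically closed field of characteristic $p>0$, let $X$ be a variety over $k$, and let $e\ge 0$ be an integer. Let $Z\in\mathrm{FB}_{e+1}(X)$ be a closed point, which is identified with a fat point (a $0$-dimensional closed subscheme) of $X_{e+1}$. Suppose that the scheme-theoretic image $\bar Z\subset X_e$ of $Z$ by the natural morphism $X_{e+1}\to X_e$ belongs to $\mathrm{FB}_e(X)$. Then the natural birational map $\rho_e:\mathrm{FB}_{e+1}(X)\dashrightarrow\mathrm{FB}_e(X)$ is defined at $Z$ and $\rho_e(Z)=\bar Z$.
   Context: A variety over $k$ is a separated integral scheme of finite type over $k$; points of varieties are closed points. For $e\ge 0$, let $F_e:X_e\to X$ be the $e$-times iterated $k$-linear Frobenius: concretely $X_e=\mathcal{S}pec_X\,\mathcal{O}_X^{1/p^e}$, where $\mathcal{O}_X^{1/p^e}$ is the sheaf of $p^e$-th roots of local sections of $\mathcal{O}_X$ (in an algebraic closure of the function field of $X$), $F_e$ corresponds to the inclusion $\mathcal{O}_X\hookrightarrow\mathcal{O}_X^{1/p^e}$, and $X_e$ is a $k$-scheme via $F_e$ and $X\to\operatorname{Spec}k$. The natural morphism $X_{e+1}\to X_e$ is the one corresponding to the inclusion $\mathcal{O}_X^{1/p^e}\hookrightarrow\mathcal{O}_X^{1/p^{e+1}}$. F-blowup: let $d=\dim X$. For each smooth closed point $x\in X$, the scheme-theoretic fiber $F_e^{-1}(x)$ is a closed subscheme of $X_e$ of length $p^{ed}$ supported at one point (a fat point), hence a closed point of the Hilbert scheme $\mathrm{Hilb}_{p^{ed}}(X_e)$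 of $0$-dimensional subschemes of $X_e$ of length $p^{ed}$. The $e$-th F-blowup $\mathrm{FB}_e(X)$ is the closure (with reduced structure) in $\mathrm{Hilb}_{p^{ed}}(X_e)$ of the set $\{F_e^{-1}(x)\mid x\in X(k)\text{ smooth}\}$. It is a variety, and is projective and birational over $X$ via $\pi_e:\mathrm{FB}_e(X)\to X$, $Z\mapsto F_e(Z)$ (scheme-theoretic image, a reduced point), which is an isomorphism over the smooth locus of $X$. A closed subscheme of $X_e$ "belongs to $\mathrm{FB}_e(X)$" if it has length $p^{ed}$ and the corresponding point of $\mathrm{Hilb}_{p^{ed}}(X_e)$ lies in $\mathrm{FB}_e(X)$. The natural birational map $\rho_e:\mathrm{FB}_{e+1}(X)\dashrightarrow\mathrm{FB}_e(X)$ is the birational map over $X$ given by $\pi_e^{-1}\circ\pi_{e+1}$ over the smooth locus. *)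

theory Defs
  imports "HOL-Analysis.Analysis"
begin

text \<open>
  The ground field \<open>k\<close> is a type \<open>'k\<close> of class \<^class>\<open>alg_closed_field\<close>. Since "point" means closed
  point and everything in sight is reduced over an algebraically closed field, a variety over \<open>k\<close>
  is given by the topological space of its closed points together with its sheaf of regular
  functions with values in \<open>k\<close>; this is the usual equivalence between integral separated schemes
  of finite type over \<open>k\<close> and classical varieties. Possibly non-reduced closed subschemes are given
  by their quasi-coherent ideal sheaves.

  Encoding of sections: \<open>regular X U\<close> consists of the total functions whose restriction to the open
  set \<open>U\<close> is regular. Values outside \<open>U\<close> are irrelevant, so sections over \<open>U\<close> are such functions
  modulo equality on \<open>U\<close>, and restriction maps are inclusions. The values of \<open>regular X\<close> on sets
  that are not open play no role.
\<close>

section \<open>Spaces with functions\<close>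

record ('a, 'k) fspace =
  zariski :: "'a topology"
  regular :: "'a set \<Rightarrow> ('a \<Rightarrow> 'k) set"

abbreviation points :: "('a, 'k, 'r) fspace_scheme \<Rightarrow> 'a set"
  where "points X \<equiv> topspace (zariski X)"

definition space_with_functions :: "('a, 'k::field) fspace \<Rightarrow> bool" where
  "space_with_functions X \<longleftrightarrow>
     (\<forall>U f g. openin (zariski X) U \<longrightarrow> f \<in> regular X U \<longrightarrow> (\<forall>x\<in>U. g x = f x) \<longrightarrow> g \<in> regular X U) \<and>
     (\<forall>U c. openin (zariski X) U \<longrightarrow> (\<lambda>_. c) \<in> regular X U) \<and>
     (\<forall>U f g. openin (zariski X) U \<longrightarrow> f \<in> regular X U \<longrightarrow> g \<in> regular X U \<longrightarrow>
        (\<lambda>x. f x + g x) \<in> regular X U \<and> (\<lambda>x. f x * g x) \<in> regular X U) \<and>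
     (\<forall>\<U> f. (\<forall>U\<in>\<U>. openin (zariski X) U) \<longrightarrow>
        (f \<in> regular X (\<Union>\<U>) \<longleftrightarrow> (\<forall>U\<in>\<U>. f \<in> regular X U))) \<and>
     (\<forall>U f. openin (zariski X) U \<longrightarrow> f \<in> regular X U \<longrightarrow>
        openin (zariski X) {x \<in> U. f x \<noteq> 0} \<and>
        (\<lambda>x. inverse (f x)) \<in> regular X {x \<in> U. f x \<noteq> 0})"

definition open_subspace :: "('a, 'k) fspace \<Rightarrow> 'a set \<Rightarrow> ('a, 'k) fspace" where
  "open_subspace X U = \<lparr>zariski = subtopology (zariski X) U, regular = regular X\<rparr>"

definition is_morphism :: "('a, 'k) fspace \<Rightarrow> ('b, 'k) fspace \<Rightarrow> ('a \<Rightarrow> 'b) \<Rightarrow> bool" where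
  "is_morphism X Y \<phi> \<longleftrightarrow>
     continuous_map (zariski X) (zariski Y) \<phi> \<and>
     (\<forall>V h. openin (zariski Y) V \<longrightarrow> h \<in> regular Y V \<longrightarrow>
        (\<lambda>x. h (\<phi> x)) \<in> regular X {x \<in> points X. \<phi> x \<in> V})"

section \<open>Varieties\<close>

inductive_set alg_gen :: "('a \<Rightarrow> 'k::field) set \<Rightarrow> ('a \<Rightarrow> 'k) set" for G where
  const: "(\<lambda>_. c) \<in> alg_gen G"
| gen: "g \<in> G \<Longrightarrow> g \<in> alg_gen G"
| add: "f \<in> alg_gen G \<Longrightarrow> g \<in> alg_gen G \<Longrightarrow> (\<lambda>x. f x + g x) \<in> alg_gen G"
| mult: "f \<in> alg_gen G \<Longrightarrow> g \<in> alg_gen G \<Longrightarrow> (\<lambda>x. f x * g x) \<in> alg_gen G"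

text \<open>The first conjunct makes \<open>\<psi>\<close> factor through the actual ring of sections over \<open>U\<close>.\<close>

definition section_character :: "('a, 'k::field) fspace \<Rightarrow> 'a set \<Rightarrow> (('a \<Rightarrow> 'k) \<Rightarrow> 'k) \<Rightarrow> bool" where
  "section_character X U \<psi> \<longleftrightarrow>
     (\<forall>f\<in>regular X U. \<forall>g\<in>regular X U. (\<forall>x\<in>U. f x = g x) \<longrightarrow> \<psi> f = \<psi> g) \<and>
     (\<forall>c. \<psi> (\<lambda>_. c) = c) \<and>
     (\<forall>f\<in>regular X U. \<forall>g\<in>regular X U.
        \<psi> (\<lambda>x. f x + g x) = \<psi> f + \<psi> g \<and> \<psi> (\<lambda>x. f x * g x) = \<psi> f * \<psi> g)"

text \<open>
  \<open>U\<close> is an affine variety: its ring of sections \<open>A\<close> is a finitely generated \<open>k\<close>-algebra, the points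
  of \<open>U\<close> are the \<open>k\<close>-algebra homomorphisms from \<open>A\<close> to \<open>k\<close> (equivalently the maximal ideals of \<open>A\<close>),
  the sets \<open>D(h)\<close> with \<open>h\<close> in \<open>A\<close> form a basis of the topology, and regular functions are locally
  fractions of elements of \<open>A\<close>.
\<close>

definition affine_open :: "('a, 'k::field) fspace \<Rightarrow> 'a set \<Rightarrow> bool" where
  "affine_open X U \<longleftrightarrow>
     openin (zariski X) U \<and>
     (\<exists>G. finite G \<and> G \<subseteq> regular X U \<and> (\<forall>f\<in>regular X U. \<exists>g\<in>alg_gen G. \<forall>x\<in>U. f x = g x)) \<and>
     (\<forall>\<psi>. section_character X U \<psi> \<longrightarrow> (\<exists>!x. x \<in> U \<and> (\<forall>f\<in>regular X U. \<psi> f = f x))) \<and>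
     (\<forall>x V. openin (zariski X) V \<longrightarrow> x \<in> V \<longrightarrow> V \<subseteq> U \<longrightarrow>
        (\<exists>h\<in>regular X U. h x \<noteq> 0 \<and> {y \<in> U. h y \<noteq> 0} \<subseteq> V)) \<and>
     (\<forall>x V f. openin (zariski X) V \<longrightarrow> x \<in> V \<longrightarrow> V \<subseteq> U \<longrightarrow> f \<in> regular X V \<longrightarrow>
        (\<exists>g\<in>regular X U. \<exists>h\<in>regular X U.
           h x \<noteq> 0 \<and> {y \<in> U. h y \<noteq> 0} \<subseteq> V \<and> (\<forall>y\<in>U. h y \<noteq> 0 \<longrightarrow> f y = g y / h y)))"

definition irreducible_in :: "'a topology \<Rightarrow> 'a set \<Rightarrow> bool" where
  "irreducible_in T C \<longleftrightarrow> C \<noteq> {} \<and> C \<subseteq> topspace T \<and>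
     (\<forall>A B. closedin T A \<longrightarrow> closedin T B \<longrightarrow> C \<subseteq> A \<union> B \<longrightarrow> C \<subseteq> A \<or> C \<subseteq> B)"

text \<open>
  The Zariski topology of the product \<open>X \<times> X\<close>: regular functions on \<open>U \<times> V\<close> are locally fractions of
  finite sums of functions \<open>f(x) g(y)\<close>, so the non-vanishing loci of such sums form a basis. It is
  finer than the product topology.
\<close>

definition zariski_square :: "('a, 'k::field) fspace \<Rightarrow> ('a \<times> 'a) topology" where
  "zariski_square X = topology_generated_by
     {{(x, y). x \<in> U \<and> y \<in> V \<and> (\<Sum>i<m. f i x * g i y) \<noteq> 0} | U V (m::nat) f g.
        openin (zariski X) U \<and> openin (zariski X) V \<and>
        (\<forall>i<m. f i \<in> regular X U \<and> g i \<in> regular X V)}"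

definition separated :: "('a, 'k::field) fspace \<Rightarrow> bool" where
  "separated X \<longleftrightarrow> closedin (zariski_square X) {(x, x) | x. x \<in> points X}"

definition variety :: "('a, 'k::field) fspace \<Rightarrow> bool" where
  "variety X \<longleftrightarrow>
     space_with_functions X \<and>
     irreducible_in (zariski X) (points X) \<and>
     (\<exists>\<U>. finite \<U> \<and> (\<forall>U\<in>\<U>. affine_open X U) \<and> \<Union>\<U> = points X) \<and>
     separated X"

text \<open>Krull dimension; the supremum is over a bounded set if \<open>X\<close> is a variety.\<close>

definition dimension :: "('a, 'k) fspace \<Rightarrow> nat" where
  "dimension X = Sup {n. \<exists>C :: nat \<Rightarrow> 'a set.
     (\<forall>i\<le>n. closedin (zariski X) (C i) \<and> irreducible_in (zariski X) (C i)) \<and>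
     (\<forall>i<n. C i \<subset> C (Suc i))}"

section \<open>Finite-dimensional quotients and smooth points\<close>

text \<open>The classes of \<open>b\<^sub>0, \<dots>, b\<^sub>n\<^sub>-\<^sub>1\<close> form a basis of the \<open>k\<close>-vector space \<open>V / W\<close>.\<close>

definition basis_mod :: "('a \<Rightarrow> 'k::field) set \<Rightarrow> ('a \<Rightarrow> 'k) set \<Rightarrow> nat \<Rightarrow> (nat \<Rightarrow> 'a \<Rightarrow> 'k) \<Rightarrow> bool" where
  "basis_mod V W n b \<longleftrightarrow>
     (\<forall>i<n. b i \<in> V) \<and>
     (\<forall>v\<in>V. \<exists>!c. (\<forall>i\<ge>n. c i = 0) \<and> (\<lambda>x. v x - (\<Sum>i<n. c i * b i x)) \<in> W)"

definition coord_mod :: "('a \<Rightarrow> 'k::field) set \<Rightarrow> nat \<Rightarrow> (nat \<Rightarrow> 'a \<Rightarrow> 'k) \<Rightarrow> ('a \<Rightarrow> 'k) \<Rightarrow> nat \<Rightarrow> 'k" where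
  "coord_mod W n b v = (THE c. (\<forall>i\<ge>n. c i = 0) \<and> (\<lambda>x. v x - (\<Sum>i<n. c i * b i x)) \<in> W)"

text \<open>
  The maximal ideal of the local ring at \<open>x\<close> and its square; germs are represented by functions that
  are regular near \<open>x\<close>, and two functions define the same germ if they agree near \<open>x\<close>.
\<close>

definition max_ideal_at :: "('a, 'k::field) fspace \<Rightarrow> 'a \<Rightarrow> ('a \<Rightarrow> 'k) set" where
  "max_ideal_at X x = {f. f x = 0 \<and> (\<exists>U. openin (zariski X) U \<and> x \<in> U \<and> f \<in> regular X U)}"

definition max_ideal_sq_at :: "('a, 'k::field) fspace \<Rightarrow> 'a \<Rightarrow> ('a \<Rightarrow> 'k) set" where
  "max_ideal_sq_at X x = {f. \<exists>U (m::nat) a b. openin (zariski X) U \<and> x \<in> U \<and>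
     (\<forall>i<m. a i \<in> max_ideal_at X x \<and> b i \<in> max_ideal_at X x) \<and>
     (\<forall>y\<in>U. f y = (\<Sum>i<m. a i y * b i y))}"

text \<open>The cotangent space at \<open>x\<close> has dimension \<open>dim X\<close>, i.e. the local ring at \<open>x\<close> is regular.\<close>

definition smooth_at :: "('a, 'k::field) fspace \<Rightarrow> 'a \<Rightarrow> bool" where
  "smooth_at X x \<longleftrightarrow> x \<in> points X \<and>
     (\<exists>b. basis_mod (max_ideal_at X x) (max_ideal_sq_at X x) (dimension X) b)"

section \<open>Closed subschemes\<close>

type_synonym ('a, 'k) ideal_sheaf = "'a set \<Rightarrow> ('a \<Rightarrow> 'k) set"

text \<open>
  A closed subscheme is a quasi-coherent sheaf of ideals \<open>I\<close>. The value \<open>{}\<close> on sets that are not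
  open makes \<open>I\<close> determined by the subscheme.
\<close>

definition closed_subscheme :: "('a, 'k::field) fspace \<Rightarrow> ('a, 'k) ideal_sheaf \<Rightarrow> bool" where
  "closed_subscheme Y I \<longleftrightarrow>
     (\<forall>U. \<not> openin (zariski Y) U \<longrightarrow> I U = {}) \<and>
     (\<forall>U. openin (zariski Y) U \<longrightarrow> I U \<subseteq> regular Y U) \<and>
     (\<forall>U f. openin (zariski Y) U \<longrightarrow> (\<forall>x\<in>U. f x = 0) \<longrightarrow> f \<in> I U) \<and>
     (\<forall>U f g. openin (zariski Y) U \<longrightarrow> f \<in> I U \<longrightarrow> g \<in> I U \<longrightarrow> (\<lambda>x. f x + g x) \<in> I U) \<and>
     (\<forall>U f g. openin (zariski Y) U \<longrightarrow> f \<in> regular Y U \<longrightarrow> g \<in> I U \<longrightarrow> (\<lambda>x. f x * g x) \<in> I U) \<and>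
     (\<forall>\<U> f. (\<forall>U\<in>\<U>. openin (zariski Y) U) \<longrightarrow> (f \<in> I (\<Union>\<U>) \<longleftrightarrow> (\<forall>U\<in>\<U>. f \<in> I U))) \<and>
     (\<forall>U h f. affine_open Y U \<longrightarrow> h \<in> regular Y U \<longrightarrow> f \<in> I {x \<in> U. h x \<noteq> 0} \<longrightarrow>
        (\<exists>g\<in>I U. \<exists>N::nat. \<forall>x\<in>U. h x \<noteq> 0 \<longrightarrow> g x = h x ^ N * f x))"

definition support :: "('a, 'k::field) fspace \<Rightarrow> ('a, 'k) ideal_sheaf \<Rightarrow> 'a set" where
  "support Y I = {x \<in> points Y. \<not> (\<exists>U. openin (zariski Y) U \<and> x \<in> U \<and> (\<lambda>_. 1) \<in> I U)}"

definition point_ideal :: "('a, 'k::field) fspace \<Rightarrow> 'a \<Rightarrow> ('a, 'k) ideal_sheaf" where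
  "point_ideal X x = (\<lambda>U. if openin (zariski X) U
     then {f \<in> regular X U. x \<in> U \<longrightarrow> f x = 0} else {})"

text \<open>
  The next two notions are for a morphism \<open>Y \<rightarrow> X\<close> that is a homeomorphism with underlying map the
  identity and with comorphism the inclusion of \<open>regular X U\<close> into \<open>regular Y U\<close>, as is the case for
  the Frobenius morphisms below. The scheme-theoretic image of the closed subscheme of \<open>Y\<close> with ideal
  \<open>I\<close> is given by the kernel of the map from the structure sheaf of \<open>X\<close> to the structure sheaf of the
  subscheme. The scheme-theoretic preimage of the closed subscheme of \<open>X\<close> with ideal \<open>J\<close> is given by
  the ideal sheaf generated by \<open>J\<close>.
\<close>

definition scheme_image :: "('a, 'k::field) fspace \<Rightarrow> ('a, 'k) ideal_sheaf \<Rightarrow> ('a, 'k) ideal_sheaf" where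
  "scheme_image X I = (\<lambda>U. if openin (zariski X) U then I U \<inter> regular X U else {})"

definition scheme_preimage :: "('a, 'k::field) fspace \<Rightarrow> ('a, 'k) ideal_sheaf \<Rightarrow> ('a, 'k) ideal_sheaf" where
  "scheme_preimage Y J = (\<lambda>U. if openin (zariski Y) U
     then {g \<in> regular Y U. \<forall>x\<in>U. \<exists>V (m::nat) a f.
             openin (zariski Y) V \<and> x \<in> V \<and> V \<subseteq> U \<and>
             (\<forall>i<m. a i \<in> regular Y V \<and> f i \<in> J V) \<and>
             (\<forall>y\<in>V. g y = (\<Sum>i<m. a i y * f i y))}
     else {})"

section \<open>The Hilbert scheme of points\<close>

text \<open>
  The closed points of the Hilbert scheme of \<open>0\<close>-dimensional subschemes of length \<open>n\<close> of \<open>Y\<close>, with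
  its Zariski topology and the regular functions of its reduced locally closed subschemes. The
  Hilbert scheme is glued from the affine charts formed, for \<open>U\<close> affine open in \<open>Y\<close> with ring of
  sections \<open>B\<close> and \<open>b\<^sub>0, \<dots>, b\<^sub>n\<^sub>-\<^sub>1\<close> in \<open>B\<close>, by the ideals \<open>J\<close> of \<open>B\<close> for which the \<open>b\<^sub>i\<close> are a basis
  of \<open>B / J\<close>; the coordinate ring of a chart is generated by the coordinates of the elements of \<open>B\<close>
  modulo \<open>J\<close> in this basis.

  Only subschemes contained in some affine open subset occur. This is no restriction for
  quasi-projective \<open>Y\<close>. In general they form the open part of the Hilbert functor that is glued from
  the Hilbert schemes of the affine open subsets, and this open part contains all subschemes
  supported at a single point. Since these form a closed subset of the whole Hilbert functor, the
  closure of a set of them does not depend on the choice.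
\<close>

definition hilb_chart ::
  "('a, 'k::field) fspace \<Rightarrow> nat \<Rightarrow> 'a set \<Rightarrow> (nat \<Rightarrow> 'a \<Rightarrow> 'k) \<Rightarrow> ('a, 'k) ideal_sheaf set" where
  "hilb_chart Y n U b = {I. affine_open Y U \<and> closed_subscheme Y I \<and> support Y I \<subseteq> U \<and>
     basis_mod (regular Y U) (I U) n b}"

definition hilb_coords ::
  "('a, 'k::field) fspace \<Rightarrow> nat \<Rightarrow> 'a set \<Rightarrow> (nat \<Rightarrow> 'a \<Rightarrow> 'k) \<Rightarrow> (('a, 'k) ideal_sheaf \<Rightarrow> 'k) set" where
  "hilb_coords Y n U b =
     alg_gen {(\<lambda>I. coord_mod (I U) n b v i) | v i. v \<in> regular Y U \<and> i < n}"

definition hilb_topology :: "('a, 'k::field) fspace \<Rightarrow> nat \<Rightarrow> ('a, 'k) ideal_sheaf topology" where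
  "hilb_topology Y n = topology_generated_by
     {{I \<in> hilb_chart Y n U b. P I \<noteq> 0} | U b P. P \<in> hilb_coords Y n U b}"

definition hilb_subvariety ::
  "('a, 'k::field) fspace \<Rightarrow> nat \<Rightarrow> ('a, 'k) ideal_sheaf set \<Rightarrow> (('a, 'k) ideal_sheaf, 'k) fspace" where
  "hilb_subvariety Y n S = \<lparr>
     zariski = subtopology (hilb_topology Y n) S,
     regular = (\<lambda>W. {h. \<forall>I\<in>W. \<exists>V U b. \<exists>P\<in>hilb_coords Y n U b. \<exists>Q\<in>hilb_coords Y n U b.
        openin (subtopology (hilb_topology Y n) S) V \<and> I \<in> V \<and> V \<subseteq> W \<inter> hilb_chart Y n U b \<and>
        (\<forall>J\<in>V. Q J \<noteq> 0 \<and> h J = P J / Q J)})\<rparr>"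

lemma topspace_hilb: "topspace (hilb_topology Y n) = (\<Union>U b. hilb_chart Y n U b)"
proof -
  have "(\<lambda>_. 1) \<in> hilb_coords Y n U b" for U b
    unfolding hilb_coords_def by (rule alg_gen.const)
  then have "I \<in> hilb_chart Y n U b \<Longrightarrow> I \<in> topspace (hilb_topology Y n)" for I U b
    unfolding hilb_topology_def topology_generated_by_topspace
    by (auto intro!: exI[of _ U] exI[of _ b] exI[of _ "\<lambda>_. 1"]
             exI[of _ "{I \<in> hilb_chart Y n U b. (\<lambda>_. 1) I \<noteq> (0::'b)}"])
  then show ?thesis
    by (auto simp: hilb_topology_def topology_generated_by_topspace)
qed

section \<open>F-blowups\<close>

text \<open>
  \<open>frob_root X e\<close> is \<open>X\<^sub>e\<close>. As \<open>k\<close> is perfect, a \<open>p\<^sup>e\<close>-th root of a section \<open>f\<close> of the structure sheaf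
  is identified with the function \<open>x \<mapsto> f(x)\<close> to the power \<open>1/p\<^sup>e\<close> with values in \<open>k\<close>; it is unique. With
  this identification the structure sheaf of \<open>X\<close> and those of the \<open>X\<^sub>e\<close> are increasing
  subsheaves of the sheaf of all \<open>k\<close>-valued functions on the same space, and the morphisms from
  \<open>X\<^sub>e\<close> to \<open>X\<close> and from \<open>X\<^sub>e\<^sub>+\<^sub>1\<close> to \<open>X\<^sub>e\<close> are the identity on points.
\<close>

definition frob_root :: "('a, 'k::field) fspace \<Rightarrow> nat \<Rightarrow> ('a, 'k) fspace" where
  "frob_root X e = \<lparr>zariski = zariski X,
     regular = (\<lambda>U. {g. (\<lambda>x. g x ^ (CHAR('k) ^ e)) \<in> regular X U})\<rparr>"

definition frob_fibre :: "('a, 'k::field) fspace \<Rightarrow> nat \<Rightarrow> 'a \<Rightarrow> ('a, 'k) ideal_sheaf" where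
  "frob_fibre X e x = scheme_preimage (frob_root X e) (point_ideal X x)"

definition fibre_length :: "('a, 'k::field) fspace \<Rightarrow> nat \<Rightarrow> nat" where
  "fibre_length X e = CHAR('k) ^ (e * dimension X)"

definition FB_points :: "('a, 'k::field) fspace \<Rightarrow> nat \<Rightarrow> ('a, 'k) ideal_sheaf set" where
  "FB_points X e =
     hilb_topology (frob_root X e) (fibre_length X e) closure_of {frob_fibre X e x | x. smooth_at X x}"

definition FB :: "('a, 'k::field) fspace \<Rightarrow> nat \<Rightarrow> (('a, 'k) ideal_sheaf, 'k) fspace" where
  "FB X e = hilb_subvariety (frob_root X e) (fibre_length X e) (FB_points X e)"

definition FB_proj :: "('a, 'k::field) fspace \<Rightarrow> ('a, 'k) ideal_sheaf \<Rightarrow> 'a" where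
  "FB_proj X Z = (THE x. x \<in> points X \<and> scheme_image X Z = point_ideal X x)"

definition FB_smooth_part :: "('a, 'k::field) fspace \<Rightarrow> nat \<Rightarrow> ('a, 'k) ideal_sheaf set" where
  "FB_smooth_part X e = {Z \<in> points (FB X e). smooth_at X (FB_proj X Z)}"

definition FB_rho ::
  "('a, 'k::field) fspace \<Rightarrow> nat \<Rightarrow> ('a, 'k) ideal_sheaf \<Rightarrow> ('a, 'k) ideal_sheaf" where
  "FB_rho X e Z = the_inv_into (FB_smooth_part X e) (FB_proj X) (FB_proj X Z)"

text \<open>
  The rational map from \<open>Y\<close> to \<open>Y'\<close> represented by \<open>\<phi>\<close> on the dense open set \<open>D\<close> is defined at \<open>z\<close>,
  with value \<open>w\<close> there.
\<close>

definition rational_map_defined_with_value ::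
  "('a, 'k) fspace \<Rightarrow> ('b, 'k) fspace \<Rightarrow> 'a set \<Rightarrow> ('a \<Rightarrow> 'b) \<Rightarrow> 'a \<Rightarrow> 'b \<Rightarrow> bool" where
  "rational_map_defined_with_value Y Y' D \<phi> z w \<longleftrightarrow>
     (\<exists>W f. openin (zariski Y) W \<and> z \<in> W \<and> is_morphism (open_subspace Y W) Y' f \<and>
        (\<forall>y \<in> W \<inter> D. f y = \<phi> y) \<and> f z = w)"

end

theory Submission
  imports Defs
begin

text \<open>
  The map \<open>\<rho>\<^sub>e\<close> is given by \<open>Z \<mapsto> Z \<inter> \<O>(X\<^sub>e)\<close> wherever the result has the right length. If sections
  \<open>b\<^sub>0, \<dots>, b\<^sub>n\<^sub>-\<^sub>1\<close> of \<open>X\<^sub>e\<close> form a basis modulo the image of \<open>Z\<close>, they stay independent modulo \<open>Z\<close> and extend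
  to a basis there, which defines a chart of the Hilbert scheme around \<open>Z\<close>. On the part of the F-blowup
  in this chart the coordinates of sections of \<open>X\<^sub>e\<close> with index at least \<open>n\<close> vanish: this is a closed
  condition, and on the dense set of fibres over smooth points it holds because at such a point the fibre
  of \<open>X\<^sub>e\<close> is spanned by \<open>p\<^sup>e\<^sup>d = n\<close> monomials in (roots of) generators of the maximal ideal. So taking
  images maps this chart to the chart of the \<open>b\<^sub>i\<close> and is given by coordinate functions. Only this upper
  bound on the length of fibres is needed, hence neither dimension theory nor Kunz's flatness theorem.
\<close>

section \<open>Linear algebra modulo a subspace\<close>

text \<open>Charts of the Hilbert scheme use sections over affine opens, while the ideals to be
  compared differ at one point only. So different charts are compared in the stalk at that point.
  That a point of an F-blowup is supported at a single point is itself a closed condition: modulo a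
  smooth fibre each function of \<open>X\<close> is a constant, hence has coordinates proportional
  to those of 1. Two counts meet. A chart records \<open>p^(ed)\<close> independent sections, and
  the monomials bound the quotient by the Frobenius fibre by the same number. Hence a subscheme of
  this length whose image in \<open>X\<close> is a reduced smooth point can only be the Frobenius
  fibre. This identifies the image map with \<open>FB_rho\<close> there and makes the projection
  injective over the smooth locus. The obstacle is quasi-coherence of the image ideal on the lower
  level, which requires extending sections from \<open>D(h)\<close> after multiplication by a power
  of \<open>h\<close>. Here the hypothesis on the image is used a second time: as a point of the
  F-blowup it is a quasi-coherent fat point, and the extension property is deduced from it.\<close>

definition linear_subset :: "('a \<Rightarrow> 'k::field) set \<Rightarrow> bool" where
  "linear_subset W \<longleftrightarrow> (\<lambda>_. 0) \<in> W \<and> (\<forall>f\<in>W. \<forall>g\<in>W. (\<lambda>x. f x + g x) \<in> W) \<and>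
     (\<forall>c. \<forall>f\<in>W. (\<lambda>x. c * f x) \<in> W)"

text \<open>\<open>basis_mod\<close> is split in two because the halves move in opposite directions:
  spanning passes to a larger subspace \<open>W\<close>, independence to a smaller one. Coefficients
  from index \<open>n\<close> on are left free here, while \<open>basis_mod\<close> forces them to
  be 0.\<close>

definition in_span_mod :: "('a \<Rightarrow> 'k::field) set \<Rightarrow> nat \<Rightarrow> (nat \<Rightarrow> 'a \<Rightarrow> 'k) \<Rightarrow> ('a \<Rightarrow> 'k) \<Rightarrow> bool" where
  "in_span_mod W n b v \<longleftrightarrow> (\<exists>c. (\<lambda>x. v x - (\<Sum>i<n. c i * b i x)) \<in> W)"

definition independent_mod :: "('a \<Rightarrow> 'k::field) set \<Rightarrow> nat \<Rightarrow> (nat \<Rightarrow> 'a \<Rightarrow> 'k) \<Rightarrow> bool" where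
  "independent_mod W n b \<longleftrightarrow> (\<forall>c. (\<lambda>x. \<Sum>i<n. c i * b i x) \<in> W \<longrightarrow> (\<forall>i<n. c i = 0))"

lemma in_span_modI: "(\<lambda>x. v x - (\<Sum>i<n. c i * b i x)) \<in> W \<Longrightarrow> in_span_mod W n b v"
  unfolding in_span_mod_def by (rule exI[of _ c])

lemma independent_modD:
  "independent_mod W n b \<Longrightarrow> (\<lambda>x. \<Sum>i<n. c i * b i x) \<in> W \<Longrightarrow> i < n \<Longrightarrow> c i = 0"
  unfolding independent_mod_def by (drule spec[of _ c]) simp

lemma linear_subset_zero: "linear_subset W \<Longrightarrow> (\<lambda>_. 0) \<in> W"
  and linear_subset_add: "linear_subset W \<Longrightarrow> f \<in> W \<Longrightarrow> g \<in> W \<Longrightarrow> (\<lambda>x. f x + g x) \<in> W"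
  and linear_subset_scale: "linear_subset W \<Longrightarrow> f \<in> W \<Longrightarrow> (\<lambda>x. c * f x) \<in> W"
  unfolding linear_subset_def by simp_all

lemma linear_subset_diff:
  assumes "linear_subset W" "f \<in> W" "g \<in> W" shows "(\<lambda>x. f x - g x) \<in> W"
proof -
  have "(\<lambda>x. f x + (-1) * g x) \<in> W"
    by (rule linear_subset_add[OF assms(1,2) linear_subset_scale[OF assms(1,3)]])
  then show ?thesis by simp
qed

lemma linear_subset_sum:
  assumes "linear_subset W" "\<And>i. i \<in> A \<Longrightarrow> f i \<in> W"
  shows "(\<lambda>x. \<Sum>i\<in>A. c i * f i x) \<in> W"
  using assms(2)
proof (induction A rule: infinite_finite_induct)
  case (insert a A)
  have "f a \<in> W" "(\<lambda>x. \<Sum>i\<in>A. c i * f i x) \<in> W" using insert by auto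
  then have "(\<lambda>x. c a * f a x + (\<Sum>i\<in>A. c i * f i x)) \<in> W"
    by (intro linear_subset_add[OF assms(1)] linear_subset_scale[OF assms(1)])
  then show ?case using insert by simp
qed (use assms(1) in \<open>auto simp: linear_subset_def\<close>)

text \<open>Gaussian elimination by induction on the equations: an unknown \<open>j0\<close>
  occurring in equation \<open>i\<close> is solved for and substituted into the others, which
  removes one equation and one unknown.\<close>

lemma homogeneous_system_nontrivial_solution:
  fixes C :: "'j \<Rightarrow> 'i \<Rightarrow> 'k::field"
  assumes "finite I" "finite J" "card I < card J"
  shows "\<exists>c. (\<exists>j\<in>J. c j \<noteq> 0) \<and> (\<forall>i\<in>I. (\<Sum>j\<in>J. c j * C j i) = 0)"
  using assms
proof (induction I arbitrary: J C rule: finite_induct)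
  case empty
  then obtain j where "j \<in> J" by fastforce
  then show ?case by (intro exI[of _ "\<lambda>_. 1"]) auto
next
  case (insert i I)
  show ?case
  proof (cases "\<forall>j\<in>J. C j i = 0")
    case True
    have "card I < card J" using insert by auto
    from insert.IH[OF insert.prems(1) this, of C] show ?thesis using True by auto
  next
    case False
    then obtain j0 where j0: "j0 \<in> J" "C j0 i \<noteq> 0" by auto
    define r where "r = (\<lambda>j. C j i / C j0 i)"
    have "card I < card (J - {j0})" using insert j0 by (simp add: card_Diff_singleton)
    from insert.IH[OF _ this, of "\<lambda>j k. C j k - r j * C j0 k"] insert.prems obtain c where
      c: "\<exists>j\<in>J - {j0}. c j \<noteq> 0" "\<And>k. k \<in> I \<Longrightarrow> (\<Sum>j\<in>J - {j0}. c j * (C j k - r j * C j0 k)) = 0"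
      by auto
    \<comment> \<open>The value at \<open>j0\<close> is the one that equation \<open>i\<close>
      dictates; with it every sum over \<open>J\<close> becomes the corresponding reduced sum over
      \<open>J - {j0}\<close>.\<close>
    define c' where "c' = c(j0 := - (\<Sum>j\<in>J - {j0}. c j * r j))"
    have sum': "(\<Sum>j\<in>J. c' j * C j k) = (\<Sum>j\<in>J - {j0}. c j * (C j k - r j * C j0 k))" for k
    proof -
      have "(\<Sum>j\<in>J. c' j * C j k) = c' j0 * C j0 k + (\<Sum>j\<in>J - {j0}. c j * C j k)"
        using insert.prems j0 by (subst sum.remove[of J j0]) (auto simp: c'_def intro!: sum.cong)
      also have "\<dots> = (\<Sum>j\<in>J - {j0}. c j * (C j k - r j * C j0 k))"
        by (simp add: c'_def sum_distrib_right sum_subtractf right_diff_distrib mult.assoc)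
      finally show ?thesis .
    qed
    have "(\<Sum>j\<in>J. c' j * C j i) = 0" unfolding sum' using j0 by (simp add: r_def)
    moreover have "\<exists>j\<in>J. c' j \<noteq> 0" using c(1) by (auto simp: c'_def)
    ultimately show ?thesis using c(2) by (intro exI[of _ c']) (auto simp: sum')
  qed
qed

lemma more_than_spanning_dependent:
  assumes W: "linear_subset W" and sp: "\<And>j. j < m \<Longrightarrow> in_span_mod W n w (v j)" and "n < m"
  shows "\<not> independent_mod W m v"
proof -
  obtain C where C: "\<And>j. j < m \<Longrightarrow> (\<lambda>x. v j x - (\<Sum>i<n. C j i * w i x)) \<in> W"
    using sp unfolding in_span_mod_def by metis
  obtain c where c: "\<exists>j\<in>{..<m}. c j \<noteq> 0" "\<And>i. i < n \<Longrightarrow> (\<Sum>j<m. c j * C j i) = 0"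
    using homogeneous_system_nontrivial_solution[of "{..<n}" "{..<m}" C] \<open>n < m\<close> by auto
  have "(\<lambda>x. \<Sum>j<m. c j * (v j x - (\<Sum>i<n. C j i * w i x))) \<in> W"
    using linear_subset_sum[OF W, of "{..<m}" "\<lambda>j x. v j x - (\<Sum>i<n. C j i * w i x)" c] C by auto
  also have "(\<lambda>x. \<Sum>j<m. c j * (v j x - (\<Sum>i<n. C j i * w i x))) = (\<lambda>x. \<Sum>j<m. c j * v j x)"
  proof
    fix x
    have "(\<Sum>j<m. c j * (\<Sum>i<n. C j i * w i x)) = (\<Sum>j<m. \<Sum>i<n. c j * C j i * w i x)"
      by (simp add: sum_distrib_left mult.assoc)
    also have "\<dots> = (\<Sum>i<n. (\<Sum>j<m. c j * C j i) * w i x)"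
      by (subst sum.swap) (simp add: sum_distrib_right)
    also have "\<dots> = 0" using c(2) by simp
    finally show "(\<Sum>j<m. c j * (v j x - (\<Sum>i<n. C j i * w i x))) = (\<Sum>j<m. c j * v j x)"
      by (simp add: algebra_simps sum_subtractf)
  qed
  finally show ?thesis using c(1) unfolding independent_mod_def by auto
qed

lemma independent_mod_Suc:
  assumes W: "linear_subset W" and b: "independent_mod W n b" and v: "\<not> in_span_mod W n b v"
  shows "independent_mod W (Suc n) (b(n := v))"
  unfolding independent_mod_def
proof (intro allI impI)
  fix c i assume "(\<lambda>x. \<Sum>i<Suc n. c i * (b(n := v)) i x) \<in> W" and i: "i < Suc n"
  then have c: "(\<lambda>x. (\<Sum>i<n. c i * b i x) + c n * v x) \<in> W" by (simp add: sum.lessThan_Suc)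
  have "c n = 0"
  proof (rule ccontr)
    assume nz: "c n \<noteq> 0"
    have "(\<lambda>x. inverse (c n) * ((\<Sum>i<n. c i * b i x) + c n * v x)) \<in> W"
      by (rule linear_subset_scale[OF W c])
    also have "(\<lambda>x. inverse (c n) * ((\<Sum>i<n. c i * b i x) + c n * v x))
        = (\<lambda>x. v x - (\<Sum>i<n. - (inverse (c n) * c i) * b i x))"
      using nz by (auto simp: fun_eq_iff algebra_simps sum_distrib_left sum_negf)
    finally have "in_span_mod W n b v" by (rule in_span_modI)
    with v show False by simp
  qed
  with c b have "\<forall>i<n. c i = 0" unfolding independent_mod_def by auto
  with \<open>c n = 0\<close> i show "c i = 0" by (cases "i = n") auto
qed

text \<open>The dimension count in its usable form: \<open>n\<close> independent elements inside the
  span of \<open>n\<close> elements leave no room, since one more outside their span would give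
  \<open>n + 1\<close> independent ones.\<close>

lemma independent_mod_spans:
  assumes W: "linear_subset W" and b: "independent_mod W n b"
    and sp: "\<And>j. j < n \<Longrightarrow> in_span_mod W n w (b j)" "in_span_mod W n w v"
  shows "in_span_mod W n b v"
proof (rule ccontr)
  assume "\<not> in_span_mod W n b v"
  then have "independent_mod W (Suc n) (b(n := v))" by (rule independent_mod_Suc[OF W b])
  moreover have "\<not> independent_mod W (Suc n) (b(n := v))"
    by (rule more_than_spanning_dependent[OF W, where n = n and w = w]) (use sp in auto)
  ultimately show False by blast
qed

lemma in_span_mod_mono: "in_span_mod W n b v \<Longrightarrow> W \<subseteq> W' \<Longrightarrow> in_span_mod W' n b v"
  unfolding in_span_mod_def by blast

lemma independent_mod_mono: "independent_mod W' n b \<Longrightarrow> W \<subseteq> W' \<Longrightarrow> independent_mod W n b"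
  unfolding independent_mod_def by blast

lemma independent_mod_le:
  assumes "independent_mod W n b" "m \<le> n" shows "independent_mod W m b"
  unfolding independent_mod_def
proof (intro allI impI)
  fix c i assume c: "(\<lambda>x. \<Sum>i<m. c i * b i x) \<in> W" and i: "i < m"
  have "(\<Sum>i<n. (if i < m then c i else 0) * b i x) = (\<Sum>i<m. c i * b i x)" for x
    using assms(2) by (intro sum.mono_neutral_cong_right) auto
  then have "(\<lambda>x. \<Sum>i<n. (if i < m then c i else 0) * b i x) \<in> W" using c by simp
  from independent_modD[OF assms(1) this, of i] show "c i = 0" using i assms(2) by simp
qed

lemma independent_mod_cong:
  assumes "\<And>i. i < n \<Longrightarrow> b i = b' i" shows "independent_mod W n b = independent_mod W n b'"
proof -
  have "(\<Sum>i<n. c i * b i x) = (\<Sum>i<n. c i * b' i x)" for c x using assms by (intro sum.cong) auto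
  then show ?thesis unfolding independent_mod_def by simp
qed

text \<open>Steinitz exchange: as long as \<open>m < n\<close>, the \<open>n\<close> independent
  elements \<open>w j\<close> cannot all lie in the span of the \<open>m\<close> given ones, so one
  of them can be appended.\<close>

lemma extend_independent_mod:
  assumes W: "linear_subset W" and w: "\<And>i. i < n \<Longrightarrow> w i \<in> V" "independent_mod W n w"
    and b: "independent_mod W m b" "\<And>i. i < m \<Longrightarrow> b i \<in> V" and "m \<le> n"
  shows "\<exists>b'. (\<forall>i<m. b' i = b i) \<and> (\<forall>i<n. b' i \<in> V) \<and> independent_mod W n b'"
  using b \<open>m \<le> n\<close>
proof (induction "n - m" arbitrary: m b)
  case 0
  then show ?case by (metis diff_is_0_eq le_antisym)
next
  case (Suc k)
  then have "m < n" by simp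
  then obtain j where j: "j < n" "\<not> in_span_mod W m b (w j)"
    using more_than_spanning_dependent[OF W, of n m b w] w(2) by blast
  define b1 where "b1 = b(m := w j)"
  have "independent_mod W (Suc m) b1"
    unfolding b1_def using independent_mod_Suc[OF W Suc.prems(1) j(2)] .
  moreover have "\<And>i. i < Suc m \<Longrightarrow> b1 i \<in> V" using Suc.prems w j by (auto simp: b1_def less_Suc_eq)
  ultimately obtain b' where "(\<forall>i<Suc m. b' i = b1 i) \<and> (\<forall>i<n. b' i \<in> V) \<and> independent_mod W n b'"
    using Suc.hyps(1)[of "Suc m" b1] Suc.hyps(2) \<open>m < n\<close> by (metis Suc_diff_Suc Suc_leI nat.inject)
  then show ?case by (intro exI[of _ b']) (auto simp: b1_def)
qed

lemma coefficients_unique: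
  assumes W: "linear_subset W" and b: "independent_mod W n b"
    and c: "(\<lambda>x. v x - (\<Sum>i<n. c i * b i x)) \<in> W" "(\<lambda>x. v x - (\<Sum>i<n. c' i * b i x)) \<in> W" and i: "i < n"
  shows "c i = c' i"
proof -
  have "(\<lambda>x. (v x - (\<Sum>i<n. c i * b i x)) - (v x - (\<Sum>i<n. c' i * b i x))) \<in> W"
    using linear_subset_diff[OF W c] .
  also have "(\<lambda>x. (v x - (\<Sum>i<n. c i * b i x)) - (v x - (\<Sum>i<n. c' i * b i x)))
      = (\<lambda>x. \<Sum>i<n. (c' i - c i) * b i x)"
    by (simp add: sum_subtractf algebra_simps fun_eq_iff)
  finally show ?thesis using independent_modD[OF b _ i, of "\<lambda>i. c' i - c i"] by simp
qed

lemma basis_mod_iff: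
  assumes W: "linear_subset W" and V: "(\<lambda>_. 0) \<in> V"
  shows "basis_mod V W n b \<longleftrightarrow>
    (\<forall>i<n. b i \<in> V) \<and> (\<forall>v\<in>V. in_span_mod W n b v) \<and> independent_mod W n b"
proof (intro iffI conjI)
  assume B: "basis_mod V W n b"
  then show "\<forall>i<n. b i \<in> V" "\<forall>v\<in>V. in_span_mod W n b v"
    unfolding basis_mod_def in_span_mod_def by blast+
  show "independent_mod W n b"
    unfolding independent_mod_def
  proof (intro allI impI)
    fix c i assume c: "(\<lambda>x. \<Sum>i<n. c i * b i x) \<in> W" and i: "i < n"
    \<comment> \<open>\<open>basis_mod\<close> speaks of \<open>0\<close> minus a sum and of
      coefficients vanishing from \<open>n\<close> on, hence the sign and the truncation. Uniqueness
      of the expansion of 0 then gives independence.\<close>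
    define c' where "c' = (\<lambda>i. if i < n then - c i else 0)"
    have neg: "(\<Sum>i<n. c' i * b i x) = - (\<Sum>i<n. c i * b i x)" for x
      by (simp add: c'_def sum_negf)
    define P where "P = (\<lambda>c. (\<forall>i\<ge>n. c i = 0) \<and> (\<lambda>x. 0 - (\<Sum>i<n. c i * b i x)) \<in> W)"
    have "P c'" using c neg by (simp add: P_def c'_def)
    moreover have "P (\<lambda>_. 0)" using W by (simp add: linear_subset_def P_def)
    moreover have "\<exists>!c. P c"
      using B V unfolding basis_mod_def P_def by (elim conjE) (erule bspec)
    ultimately have "c' = (\<lambda>_. 0)" by (metis (no_types))
    then show "c i = 0" using i by (auto simp: c'_def fun_eq_iff split: if_splits)
  qed
next
  assume B: "(\<forall>i<n. b i \<in> V) \<and> (\<forall>v\<in>V. in_span_mod W n b v) \<and> independent_mod W n b"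
  show "basis_mod V W n b"
    unfolding basis_mod_def
  proof (intro conjI ballI)
    fix v assume "v \<in> V"
    then obtain c where c: "(\<lambda>x. v x - (\<Sum>i<n. c i * b i x)) \<in> W" using B unfolding in_span_mod_def by blast
    show "\<exists>!c. (\<forall>i\<ge>n. c i = 0) \<and> (\<lambda>x. v x - (\<Sum>i<n. c i * b i x)) \<in> W"
    proof (rule ex1I[of _ "\<lambda>i. if i < n then c i else 0"])
      show "(\<forall>i\<ge>n. (if i < n then c i else 0) = 0) \<and>
          (\<lambda>x. v x - (\<Sum>i<n. (if i < n then c i else 0) * b i x)) \<in> W" using c by simp
      fix d assume d: "(\<forall>i\<ge>n. d i = 0) \<and> (\<lambda>x. v x - (\<Sum>i<n. d i * b i x)) \<in> W"
      then have "d i = c i" if "i < n" for i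
        using coefficients_unique[OF W _ _ c that, of d] B by blast
      then show "d = (\<lambda>i. if i < n then c i else 0)" using d by (auto simp: fun_eq_iff)
    qed
  qed (use B in auto)
qed

lemma coord_mod_eqI:
  assumes W: "linear_subset W" and b: "independent_mod W n b"
    and c: "(\<lambda>x. v x - (\<Sum>i<n. c i * b i x)) \<in> W" and i: "i < n"
  shows "coord_mod W n b v i = c i"
proof -
  have "coord_mod W n b v = (\<lambda>i. if i < n then c i else 0)"
    unfolding coord_mod_def
  proof (rule the_equality)
    show "(\<forall>i\<ge>n. (if i < n then c i else 0) = 0) \<and>
        (\<lambda>x. v x - (\<Sum>i<n. (if i < n then c i else 0) * b i x)) \<in> W" using c by simp
    fix d assume d: "(\<forall>i\<ge>n. d i = 0) \<and> (\<lambda>x. v x - (\<Sum>i<n. d i * b i x)) \<in> W"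
    then have "d i = c i" if "i < n" for i
      using coefficients_unique[OF W b _ c that, of d] by blast
    then show "d = (\<lambda>i. if i < n then c i else 0)" using d by (auto simp: fun_eq_iff)
  qed
  then show ?thesis using i by simp
qed

lemma basis_modD:
  assumes "linear_subset W" "(\<lambda>_. 0) \<in> V" "basis_mod V W n b"
  shows "\<And>i. i < n \<Longrightarrow> b i \<in> V" "\<And>v. v \<in> V \<Longrightarrow> in_span_mod W n b v" "independent_mod W n b"
  using assms by (simp_all add: basis_mod_iff)

lemma coord_mod_in:
  assumes "linear_subset W" "independent_mod W n b" "in_span_mod W n b v"
  shows "(\<lambda>x. v x - (\<Sum>i<n. coord_mod W n b v i * b i x)) \<in> W"
proof -
  obtain c where c: "(\<lambda>x. v x - (\<Sum>i<n. c i * b i x)) \<in> W" using assms(3) unfolding in_span_mod_def by blast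
  have "(\<Sum>i<n. coord_mod W n b v i * b i x) = (\<Sum>i<n. c i * b i x)" for x
    using coord_mod_eqI[OF assms(1,2) c] by simp
  then show ?thesis using c by simp
qed

section \<open>Spaces with functions and field automorphisms\<close>

lemma swf_cong:
  assumes "space_with_functions X" "openin (zariski X) U" "f \<in> regular X U" "\<And>x. x \<in> U \<Longrightarrow> g x = f x"
  shows "g \<in> regular X U"
proof -
  have "\<forall>U f g. openin (zariski X) U \<longrightarrow> f \<in> regular X U \<longrightarrow> (\<forall>x\<in>U. g x = f x) \<longrightarrow> g \<in> regular X U"
    using assms(1) unfolding space_with_functions_def by (elim conjE)
  from this[rule_format, OF assms(2-4)] show ?thesis .
qed

lemma regular_const: "space_with_functions X \<Longrightarrow> openin (zariski X) U \<Longrightarrow> (\<lambda>_. c) \<in> regular X U"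
  and regular_add: "space_with_functions X \<Longrightarrow> openin (zariski X) U \<Longrightarrow> f \<in> regular X U \<Longrightarrow>
      g \<in> regular X U \<Longrightarrow> (\<lambda>x. f x + g x) \<in> regular X U"
  and regular_mult: "space_with_functions X \<Longrightarrow> openin (zariski X) U \<Longrightarrow> f \<in> regular X U \<Longrightarrow>
      g \<in> regular X U \<Longrightarrow> (\<lambda>x. f x * g x) \<in> regular X U"
  and regular_nonzero_open: "space_with_functions X \<Longrightarrow> openin (zariski X) U \<Longrightarrow> f \<in> regular X U \<Longrightarrow>
      openin (zariski X) {x \<in> U. f x \<noteq> 0}"
  and regular_inverse: "space_with_functions X \<Longrightarrow> openin (zariski X) U \<Longrightarrow> f \<in> regular X U \<Longrightarrow>
      (\<lambda>x. inverse (f x)) \<in> regular X {x \<in> U. f x \<noteq> 0}"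
  unfolding space_with_functions_def by simp_all

lemma regular_restrict:
  assumes "space_with_functions X" "openin (zariski X) U" "openin (zariski X) V" "V \<subseteq> U" "f \<in> regular X U"
  shows "f \<in> regular X V"
proof -
  have "\<forall>\<U> f. (\<forall>U\<in>\<U>. openin (zariski X) U) \<longrightarrow>
        (f \<in> regular X (\<Union>\<U>) \<longleftrightarrow> (\<forall>U\<in>\<U>. f \<in> regular X U))"
    using assms(1) unfolding space_with_functions_def by (elim conjE)
  from spec[OF spec[OF this, of "{U, V}"], of f] show ?thesis
    using assms by (simp add: Un_absorb2)
qed

lemma regular_local:
  assumes X: "space_with_functions X" "openin (zariski X) U"
    and loc: "\<And>y. y \<in> U \<Longrightarrow> \<exists>V. openin (zariski X) V \<and> y \<in> V \<and> f \<in> regular X V"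
  shows "f \<in> regular X U"
proof -
  define \<U> where "\<U> = {V. openin (zariski X) V \<and> V \<subseteq> U \<and> f \<in> regular X V}"
  have "\<forall>\<U> f. (\<forall>U\<in>\<U>. openin (zariski X) U) \<longrightarrow>
        (f \<in> regular X (\<Union>\<U>) \<longleftrightarrow> (\<forall>U\<in>\<U>. f \<in> regular X U))"
    using X unfolding space_with_functions_def by (elim conjE)
  from spec[OF spec[OF this, of \<U>], of f] have "f \<in> regular X (\<Union>\<U>)" by (auto simp: \<U>_def)
  moreover have "\<Union>\<U> = U"
  proof
    show "U \<subseteq> \<Union>\<U>"
    proof
      fix y assume "y \<in> U"
      with loc obtain V where V: "openin (zariski X) V" "y \<in> V" "f \<in> regular X V" by blast
      then have "V \<inter> U \<in> \<U>"
        using regular_restrict[OF X(1) V(1), of "V \<inter> U" f] X(2) by (auto simp: \<U>_def)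
      then show "y \<in> \<Union>\<U>" using \<open>y \<in> U\<close> V by blast
    qed
  qed (auto simp: \<U>_def)
  ultimately show ?thesis by simp
qed

lemma linear_subset_regular:
  assumes "space_with_functions X" "openin (zariski X) U"
  shows "linear_subset (regular X U)"
  using regular_const[OF assms] regular_add[OF assms] regular_mult[OF assms]
  unfolding linear_subset_def by blast

lemma regular_power:
  assumes "space_with_functions X" "openin (zariski X) U" "f \<in> regular X U"
  shows "(\<lambda>x. f x ^ n) \<in> regular X U"
  by (induction n) (use assms in \<open>simp_all add: regular_const regular_mult\<close>)

lemma regular_sum:
  assumes "space_with_functions X" "openin (zariski X) U" "\<And>i. i \<in> A \<Longrightarrow> f i \<in> regular X U"
  shows "(\<lambda>x. \<Sum>i\<in>A. f i x) \<in> regular X U"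
  using assms(3)
  by (induction A rule: infinite_finite_induct) (use assms(1,2) in \<open>simp_all add: regular_const regular_add\<close>)

section \<open>Transport of structure along field automorphisms\<close>

definition field_automorphism :: "('k::field \<Rightarrow> 'k) \<Rightarrow> bool" where
  "field_automorphism \<phi> \<longleftrightarrow> bij \<phi> \<and> (\<forall>a b. \<phi> (a + b) = \<phi> a + \<phi> b \<and> \<phi> (a * b) = \<phi> a * \<phi> b)"

text \<open>For \<open>\<phi>\<close> the power map with exponent \<open>p^e\<close> this is
  \<open>frob_root X e\<close>. Allowing every automorphism makes the inverse construction a twist
  as well, so affineness transfers in both directions.\<close>

definition twist :: "('k \<Rightarrow> 'k) \<Rightarrow> ('a, 'k::field) fspace \<Rightarrow> ('a, 'k) fspace" where
  "twist \<phi> X = \<lparr>zariski = zariski X, regular = (\<lambda>U. {g. (\<lambda>x. \<phi> (g x)) \<in> regular X U})\<rparr>"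

lemma zariski_twist [simp]: "zariski (twist \<phi> X) = zariski X"
  by (simp add: twist_def)

lemma regular_twist: "g \<in> regular (twist \<phi> X) U \<longleftrightarrow> (\<lambda>x. \<phi> (g x)) \<in> regular X U"
  by (simp add: twist_def)

lemma twist_twist: "twist \<phi> (twist \<psi> X) = twist (\<lambda>c. \<psi> (\<phi> c)) X"
  by (simp add: twist_def)

lemma twist_id: "twist (\<lambda>c. c) X = X"
  by (simp add: twist_def)

lemma field_automorphismD:
  assumes "field_automorphism \<phi>"
  shows "bij \<phi>" "\<phi> (a + b) = \<phi> a + \<phi> b" "\<phi> (a * b) = \<phi> a * \<phi> b"
    "\<phi> 0 = 0" "\<phi> 1 = 1" "\<phi> a = 0 \<longleftrightarrow> a = 0" "\<phi> (inverse a) = inverse (\<phi> a)"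
    "\<phi> (- a) = - \<phi> a" "\<phi> (a - b) = \<phi> a - \<phi> b" "\<phi> (sum f A) = sum (\<lambda>i. \<phi> (f i)) A"
    "\<phi> (a ^ m) = \<phi> a ^ m" "\<phi> (a / b) = \<phi> a / \<phi> b"
proof -
  show b: "bij \<phi>" and add: "\<And>a b. \<phi> (a + b) = \<phi> a + \<phi> b" and mult: "\<And>a b. \<phi> (a * b) = \<phi> a * \<phi> b"
    using assms unfolding field_automorphism_def by auto
  show z: "\<phi> 0 = 0" using add[of 0 0] by (metis add_cancel_right_right)
  show nz: "\<phi> a = 0 \<longleftrightarrow> a = 0" for a
    using b z by (metis bij_pointE)
  show o: "\<phi> 1 = 1" using mult[of 1 1] nz[of 1] by simp
  show inv: "\<phi> (inverse a) = inverse (\<phi> a)" for a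
  proof (cases "a = 0")
    case False
    then have "\<phi> a * \<phi> (inverse a) = 1" using mult[of a "inverse a"] o by simp
    then show ?thesis by (simp add: inverse_unique)
  qed (simp add: z)
  show m: "\<phi> (- a) = - \<phi> a" for a using add[of a "- a"] z by (simp add: eq_neg_iff_add_eq_0 add.commute)
  show "\<phi> (a - b) = \<phi> a - \<phi> b" using add[of a "- b"] m by simp
  show "\<phi> (sum f A) = sum (\<lambda>i. \<phi> (f i)) A"
    by (induction A rule: infinite_finite_induct) (auto simp: z add)
  show "\<phi> (a ^ m) = \<phi> a ^ m" by (induction m) (auto simp: o mult)
  show "\<phi> (a / b) = \<phi> a / \<phi> b" by (simp add: divide_inverse mult inv)
qed

lemma field_automorphism_inv:
  assumes "field_automorphism \<phi>" shows "field_automorphism (inv \<phi>)"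
proof -
  note \<phi> = field_automorphismD[OF assms]
  have "inv \<phi> (a + b) = inv \<phi> a + inv \<phi> b" "inv \<phi> (a * b) = inv \<phi> a * inv \<phi> b" for a b
    using \<phi>(1-3) by (metis bij_inv_eq_iff)+
  then show ?thesis using \<phi>(1) unfolding field_automorphism_def by (simp add: bij_imp_bij_inv)
qed

lemma space_with_functions_twist:
  assumes \<phi>: "field_automorphism \<phi>" and X: "space_with_functions X"
  shows "space_with_functions (twist \<phi> X)"
proof -
  note \<phi> = field_automorphismD[OF \<phi>]
  have "\<forall>\<U> f. (\<forall>U\<in>\<U>. openin (zariski X) U) \<longrightarrow>
        (f \<in> regular X (\<Union>\<U>) \<longleftrightarrow> (\<forall>U\<in>\<U>. f \<in> regular X U))"
    using X unfolding space_with_functions_def by (elim conjE)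
  then show ?thesis
    unfolding space_with_functions_def zariski_twist regular_twist \<phi>
  proof (intro conjI allI impI)
    fix U f g
    assume "openin (zariski X) U" "(\<lambda>x. \<phi> (f x)) \<in> regular X U" "\<forall>x\<in>U. g x = f x"
    then show "(\<lambda>x. \<phi> (g x)) \<in> regular X U"
      using swf_cong[OF X, of U "\<lambda>x. \<phi> (f x)" "\<lambda>x. \<phi> (g x)"] by simp
  next
    fix U f assume f: "openin (zariski X) U" "(\<lambda>x. \<phi> (f x)) \<in> regular X U"
    have "{x \<in> U. f x \<noteq> 0} = {x \<in> U. \<phi> (f x) \<noteq> 0}" using \<phi>(6) by auto
    then show "openin (zariski X) {x \<in> U. f x \<noteq> 0}"
        "(\<lambda>x. inverse (\<phi> (f x))) \<in> regular X {x \<in> U. f x \<noteq> 0}"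
      using regular_nonzero_open[OF X f] regular_inverse[OF X f] by simp_all
  qed (auto intro: regular_const[OF X] regular_add[OF X] regular_mult[OF X])
qed

lemma alg_gen_image:
  assumes \<psi>: "field_automorphism \<psi>" and g: "g \<in> alg_gen G"
  shows "(\<lambda>x. \<psi> (g x)) \<in> alg_gen ((\<lambda>g x. \<psi> (g x)) ` G)"
  using g
proof induction
  case (const c) show ?case by (rule alg_gen.const)
next
  case (gen g) then show ?case by (intro alg_gen.gen) auto
qed (auto simp: field_automorphismD[OF \<psi>] intro: alg_gen.intros)

text \<open>A character must fix constants. Composing \<open>\<psi>\<close> with the inverse of
  \<open>\<phi>\<close> alone would send \<open>c\<close> to \<open>inv \<phi> c\<close>, so the
  value is corrected by \<open>\<phi>\<close>.\<close>

lemma section_character_twist: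
  assumes \<phi>: "field_automorphism \<phi>" and \<psi>: "section_character (twist \<phi> X) U \<psi>"
  shows "section_character X U (\<lambda>f. \<phi> (\<psi> (\<lambda>x. inv \<phi> (f x))))"
proof -
  note \<phi>' = field_automorphismD[OF \<phi>]
  note i = field_automorphismD[OF field_automorphism_inv[OF \<phi>]]
  have s [simp]: "\<phi> (inv \<phi> c) = c" for c using \<phi>'(1) by (simp add: bij_is_surj surj_f_inv_f)
  have mem: "(\<lambda>x. inv \<phi> (f x)) \<in> regular (twist \<phi> X) U \<longleftrightarrow> f \<in> regular X U" for f
    by (simp add: regular_twist)
  have 1: "\<psi> f = \<psi> g" if "f \<in> regular (twist \<phi> X) U" "g \<in> regular (twist \<phi> X) U" "\<forall>x\<in>U. f x = g x" for f g
  proof -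
    have "\<forall>f\<in>regular (twist \<phi> X) U. \<forall>g\<in>regular (twist \<phi> X) U. (\<forall>x\<in>U. f x = g x) \<longrightarrow> \<psi> f = \<psi> g"
      using \<psi> unfolding section_character_def by (elim conjE)
    from this[rule_format, OF that(1,2)] show ?thesis using that(3) by blast
  qed
  have 2: "\<psi> (\<lambda>_. c) = c" for c
    using \<psi> unfolding section_character_def by (elim conjE allE)
  have 3: "\<psi> (\<lambda>x. f x + g x) = \<psi> f + \<psi> g" "\<psi> (\<lambda>x. f x * g x) = \<psi> f * \<psi> g"
    if "f \<in> regular (twist \<phi> X) U" "g \<in> regular (twist \<phi> X) U" for f g
  proof -
    have "\<forall>f\<in>regular (twist \<phi> X) U. \<forall>g\<in>regular (twist \<phi> X) U.
        \<psi> (\<lambda>x. f x + g x) = \<psi> f + \<psi> g \<and> \<psi> (\<lambda>x. f x * g x) = \<psi> f * \<psi> g"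
      using \<psi> unfolding section_character_def by (elim conjE)
    from this[rule_format, OF that] show "\<psi> (\<lambda>x. f x + g x) = \<psi> f + \<psi> g" "\<psi> (\<lambda>x. f x * g x) = \<psi> f * \<psi> g"
      by simp_all
  qed
  show ?thesis
    unfolding section_character_def
  proof (intro conjI ballI allI impI)
    fix f g assume fg: "f \<in> regular X U" "g \<in> regular X U"
    show "\<phi> (\<psi> (\<lambda>x. inv \<phi> (f x))) = \<phi> (\<psi> (\<lambda>x. inv \<phi> (g x)))" if "\<forall>x\<in>U. f x = g x"
      by (rule arg_cong[OF 1]) (use fg mem that in auto)
    show "\<phi> (\<psi> (\<lambda>x. inv \<phi> (f x + g x))) = \<phi> (\<psi> (\<lambda>x. inv \<phi> (f x))) + \<phi> (\<psi> (\<lambda>x. inv \<phi> (g x)))"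
      using 3(1)[of "\<lambda>x. inv \<phi> (f x)" "\<lambda>x. inv \<phi> (g x)"] fg mem by (simp add: i \<phi>')
    show "\<phi> (\<psi> (\<lambda>x. inv \<phi> (f x * g x))) = \<phi> (\<psi> (\<lambda>x. inv \<phi> (f x))) * \<phi> (\<psi> (\<lambda>x. inv \<phi> (g x)))"
      using 3(2)[of "\<lambda>x. inv \<phi> (f x)" "\<lambda>x. inv \<phi> (g x)"] fg mem by (simp add: i \<phi>')
  qed (simp add: 2)
qed

lemma affine_openD:
  assumes "affine_open X U"
  shows "openin (zariski X) U"
    "\<exists>G. finite G \<and> G \<subseteq> regular X U \<and> (\<forall>f\<in>regular X U. \<exists>g\<in>alg_gen G. \<forall>x\<in>U. f x = g x)"
    "\<And>\<psi>. section_character X U \<psi> \<Longrightarrow> \<exists>!x. x \<in> U \<and> (\<forall>f\<in>regular X U. \<psi> f = f x)"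
    "\<And>x V. openin (zariski X) V \<Longrightarrow> x \<in> V \<Longrightarrow> V \<subseteq> U \<Longrightarrow>
        \<exists>h\<in>regular X U. h x \<noteq> 0 \<and> {y \<in> U. h y \<noteq> 0} \<subseteq> V"
    "\<And>x V f. openin (zariski X) V \<Longrightarrow> x \<in> V \<Longrightarrow> V \<subseteq> U \<Longrightarrow> f \<in> regular X V \<Longrightarrow>
        \<exists>g\<in>regular X U. \<exists>h\<in>regular X U.
           h x \<noteq> 0 \<and> {y \<in> U. h y \<noteq> 0} \<subseteq> V \<and> (\<forall>y\<in>U. h y \<noteq> 0 \<longrightarrow> f y = g y / h y)"
  using assms unfolding affine_open_def by simp_all

lemma affine_open_twist:
  assumes \<phi>: "field_automorphism \<phi>" and U: "affine_open X U"
  shows "affine_open (twist \<phi> X) U"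
proof -
  note \<phi>' = field_automorphismD[OF \<phi>]
  note i = field_automorphismD[OF field_automorphism_inv[OF \<phi>]]
  have s [simp]: "\<phi> (inv \<phi> c) = c" "inv \<phi> (\<phi> c) = c" for c
    using \<phi>'(1) by (simp_all add: bij_is_surj surj_f_inv_f bij_is_inj)
  show ?thesis
    unfolding affine_open_def
  proof (intro conjI allI impI)
    show "openin (zariski (twist \<phi> X)) U" using affine_openD(1)[OF U] by simp
    obtain G where G: "finite G" "G \<subseteq> regular X U"
      "\<And>f. f \<in> regular X U \<Longrightarrow> \<exists>g\<in>alg_gen G. \<forall>x\<in>U. f x = g x"
      using affine_openD(2)[OF U] by blast
    show "\<exists>G. finite G \<and> G \<subseteq> regular (twist \<phi> X) U \<and>
      (\<forall>f\<in>regular (twist \<phi> X) U. \<exists>g\<in>alg_gen G. \<forall>x\<in>U. f x = g x)"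
    proof (intro exI[of _ "(\<lambda>g x. inv \<phi> (g x)) ` G"] conjI ballI)
      show "(\<lambda>g x. inv \<phi> (g x)) ` G \<subseteq> regular (twist \<phi> X) U" using G(2) by (auto simp: regular_twist)
      fix f assume "f \<in> regular (twist \<phi> X) U"
      then obtain g where g: "g \<in> alg_gen G" "\<And>x. x \<in> U \<Longrightarrow> \<phi> (f x) = g x"
        using G(3)[of "\<lambda>x. \<phi> (f x)"] by (auto simp: regular_twist)
      have "\<forall>x\<in>U. f x = inv \<phi> (g x)" using g(2) by (metis s(2))
      then show "\<exists>g\<in>alg_gen ((\<lambda>g x. inv \<phi> (g x)) ` G). \<forall>x\<in>U. f x = g x"
        by (intro bexI[of _ "\<lambda>x. inv \<phi> (g x)"] alg_gen_image[OF field_automorphism_inv[OF \<phi>] g(1)])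
    qed (use G in auto)
  next
    fix \<psi> assume \<psi>: "section_character (twist \<phi> X) U \<psi>"
    have "(\<forall>f\<in>regular X U. \<phi> (\<psi> (\<lambda>y. inv \<phi> (f y))) = f x) \<longleftrightarrow>
        (\<forall>f\<in>regular (twist \<phi> X) U. \<psi> f = f x)" for x
    proof (intro iffI ballI)
      fix f assume "f \<in> regular (twist \<phi> X) U" "\<forall>f\<in>regular X U. \<phi> (\<psi> (\<lambda>y. inv \<phi> (f y))) = f x"
      then have "\<phi> (\<psi> f) = \<phi> (f x)" by (fastforce simp: regular_twist)
      then show "\<psi> f = f x" by (metis s(2))
    next
      fix f assume "f \<in> regular X U" "\<forall>f\<in>regular (twist \<phi> X) U. \<psi> f = f x"
      then have "\<psi> (\<lambda>y. inv \<phi> (f y)) = inv \<phi> (f x)" by (simp add: regular_twist)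
      then show "\<phi> (\<psi> (\<lambda>y. inv \<phi> (f y))) = f x" by simp
    qed
    then show "\<exists>!x. x \<in> U \<and> (\<forall>f\<in>regular (twist \<phi> X) U. \<psi> f = f x)"
      using affine_openD(3)[OF U section_character_twist[OF \<phi> \<psi>]] by simp
  next
    fix x V assume "openin (zariski (twist \<phi> X)) V" "x \<in> V" "V \<subseteq> U"
    then obtain h where "h \<in> regular X U" "h x \<noteq> 0" "{y \<in> U. h y \<noteq> 0} \<subseteq> V"
      using affine_openD(4)[OF U, of V x] by auto
    then show "\<exists>h\<in>regular (twist \<phi> X) U. h x \<noteq> 0 \<and> {y \<in> U. h y \<noteq> 0} \<subseteq> V"
      by (intro bexI[of _ "\<lambda>y. inv \<phi> (h y)"]) (auto simp: regular_twist i)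
  next
    fix x V f assume "openin (zariski (twist \<phi> X)) V" "x \<in> V" "V \<subseteq> U" "f \<in> regular (twist \<phi> X) V"
    then obtain g h where gh: "g \<in> regular X U" "h \<in> regular X U"
      "h x \<noteq> 0" "{y \<in> U. h y \<noteq> 0} \<subseteq> V" "\<And>y. y \<in> U \<Longrightarrow> h y \<noteq> 0 \<Longrightarrow> \<phi> (f y) = g y / h y"
      using affine_openD(5)[OF U, of V x "\<lambda>y. \<phi> (f y)"] by (auto simp: regular_twist)
    have "f y = inv \<phi> (g y) / inv \<phi> (h y)" if "y \<in> U" "h y \<noteq> 0" for y
      using gh(5)[OF that] by (metis i(12) s(2))
    then show "\<exists>g\<in>regular (twist \<phi> X) U. \<exists>h\<in>regular (twist \<phi> X) U.
           h x \<noteq> 0 \<and> {y \<in> U. h y \<noteq> 0} \<subseteq> V \<and> (\<forall>y\<in>U. h y \<noteq> 0 \<longrightarrow> f y = g y / h y)"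
      using gh
      by (intro bexI[of _ "\<lambda>y. inv \<phi> (g y)"] bexI[of _ "\<lambda>y. inv \<phi> (h y)"]) (auto simp: regular_twist i)
  qed
qed

lemma affine_open_twist_iff:
  assumes \<phi>: "field_automorphism \<phi>"
  shows "affine_open (twist \<phi> X) U \<longleftrightarrow> affine_open X U"
proof
  assume "affine_open (twist \<phi> X) U"
  from affine_open_twist[OF field_automorphism_inv[OF \<phi>] this]
  show "affine_open X U"
    using field_automorphismD(1)[OF \<phi>] by (simp add: twist_twist twist_id bij_is_surj surj_f_inv_f)
qed (rule affine_open_twist[OF \<phi>])

text \<open>Additivity is the freshman's dream in characteristic \<open>p\<close>; injectivity
  follows by applying it to a difference, surjectivity is the existence of roots in an algebraically
  closed field.\<close>

lemma field_automorphism_frobenius: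
  assumes "CHAR('k::alg_closed_field) > 0"
  shows "field_automorphism (\<lambda>c::'k. c ^ (CHAR('k) ^ e))"
proof -
  have p: "prime CHAR('k)" using assms by (rule prime_CHAR_semidom)
  have add: "(a + b :: 'k) ^ (CHAR('k) ^ e) = a ^ (CHAR('k) ^ e) + b ^ (CHAR('k) ^ e)" for a b
    by (rule freshmans_dream'[OF p refl])
  have q: "CHAR('k) ^ e > 0" using assms by simp
  have "bij (\<lambda>c::'k. c ^ (CHAR('k) ^ e))"
  proof (rule bijI)
    show "inj (\<lambda>c::'k. c ^ (CHAR('k) ^ e))"
    proof (rule injI)
      fix a b :: 'k assume "a ^ (CHAR('k) ^ e) = b ^ (CHAR('k) ^ e)"
      then have "(a - b) ^ (CHAR('k) ^ e) = 0" using add[of "a - b" b] by simp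
      then show "a = b" by simp
    qed
    show "surj (\<lambda>c::'k. c ^ (CHAR('k) ^ e))"
      using nth_root_exists[OF q] by (metis surjI)
  qed
  then show ?thesis by (simp add: field_automorphism_def add power_mult_distrib)
qed

lemma frob_root_twist: "frob_root X e = twist (\<lambda>c::'k. c ^ (CHAR('k) ^ e)) (X :: ('a, 'k::alg_closed_field) fspace)"
  by (simp add: frob_root_def twist_def)

lemma zariski_frob_root [simp]: "zariski (frob_root X e) = zariski X"
  by (simp add: frob_root_def)

lemma regular_frob_root:
  "g \<in> regular (frob_root X e) U \<longleftrightarrow> (\<lambda>x. g x ^ (CHAR('k) ^ e)) \<in> regular (X :: ('a, 'k::field) fspace) U"
  by (simp add: frob_root_def)

lemma space_with_functions_frob_root:
  "CHAR('k::alg_closed_field) > 0 \<Longrightarrow> space_with_functions X \<Longrightarrow>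
    space_with_functions (frob_root (X :: ('a, 'k) fspace) e)"
  by (simp add: frob_root_twist space_with_functions_twist field_automorphism_frobenius)

lemma affine_open_frob_root:
  "CHAR('k::alg_closed_field) > 0 \<Longrightarrow>
    affine_open (frob_root (X :: ('a, 'k) fspace) e) U \<longleftrightarrow> affine_open X U"
  by (simp add: frob_root_twist affine_open_twist_iff field_automorphism_frobenius)

lemma regular_frob_root_mono:
  fixes X :: "('a, 'k::alg_closed_field) fspace"
  assumes "space_with_functions X" "openin (zariski X) U"
  shows "regular X U \<subseteq> regular (frob_root X e) U"
    and "regular (frob_root X e) U \<subseteq> regular (frob_root X (Suc e)) U"
proof -
  show "regular X U \<subseteq> regular (frob_root X e) U"
    using regular_power[OF assms] by (auto simp: regular_frob_root)
  show "regular (frob_root X e) U \<subseteq> regular (frob_root X (Suc e)) U"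
  proof
    fix f assume "f \<in> regular (frob_root X e) U"
    then have "(\<lambda>x. (f x ^ CHAR('k) ^ e) ^ CHAR('k)) \<in> regular X U"
      using regular_power[OF assms] by (simp add: regular_frob_root)
    then show "f \<in> regular (frob_root X (Suc e)) U"
      by (simp add: regular_frob_root power_mult[symmetric] mult.commute)
  qed
qed

section \<open>Germs of closed subschemes\<close>

lemma closed_subschemeD:
  assumes "closed_subscheme Y I"
  shows "\<And>U f. f \<in> I U \<Longrightarrow> openin (zariski Y) U"
    and "\<And>U f. f \<in> I U \<Longrightarrow> f \<in> regular Y U"
    and "\<And>U f. openin (zariski Y) U \<Longrightarrow> (\<And>x. x \<in> U \<Longrightarrow> f x = 0) \<Longrightarrow> f \<in> I U"
    and "\<And>U f g. f \<in> I U \<Longrightarrow> g \<in> I U \<Longrightarrow> (\<lambda>x. f x + g x) \<in> I U"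
    and "\<And>U f g. f \<in> regular Y U \<Longrightarrow> g \<in> I U \<Longrightarrow> (\<lambda>x. f x * g x) \<in> I U"
    and "\<And>\<U> f. (\<And>U. U \<in> \<U> \<Longrightarrow> openin (zariski Y) U) \<Longrightarrow> f \<in> I (\<Union>\<U>) \<longleftrightarrow> (\<forall>U\<in>\<U>. f \<in> I U)"
    and "\<And>U h f. affine_open Y U \<Longrightarrow> h \<in> regular Y U \<Longrightarrow> f \<in> I {x \<in> U. h x \<noteq> 0} \<Longrightarrow>
        \<exists>g\<in>I U. \<exists>N::nat. \<forall>x\<in>U. h x \<noteq> 0 \<longrightarrow> g x = h x ^ N * f x"
proof -
  note I = assms[unfolded closed_subscheme_def]
  show o: "\<And>U f. f \<in> I U \<Longrightarrow> openin (zariski Y) U" using conjunct1[OF I] by fastforce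
  have 1: "\<forall>U. openin (zariski Y) U \<longrightarrow> I U \<subseteq> regular Y U" using I by (elim conjE)
  then show "\<And>U f. f \<in> I U \<Longrightarrow> f \<in> regular Y U" using o by blast
  have "\<forall>U f. openin (zariski Y) U \<longrightarrow> (\<forall>x\<in>U. f x = 0) \<longrightarrow> f \<in> I U" using I by (elim conjE)
  from this[rule_format] show "\<And>U f. openin (zariski Y) U \<Longrightarrow> (\<And>x. x \<in> U \<Longrightarrow> f x = 0) \<Longrightarrow> f \<in> I U" .
  have "\<forall>U f g. openin (zariski Y) U \<longrightarrow> f \<in> I U \<longrightarrow> g \<in> I U \<longrightarrow> (\<lambda>x. f x + g x) \<in> I U"
    using I by (elim conjE)
  from this[rule_format, OF o] show "\<And>U f g. f \<in> I U \<Longrightarrow> g \<in> I U \<Longrightarrow> (\<lambda>x. f x + g x) \<in> I U" .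
  have "\<forall>U f g. openin (zariski Y) U \<longrightarrow> f \<in> regular Y U \<longrightarrow> g \<in> I U \<longrightarrow> (\<lambda>x. f x * g x) \<in> I U"
    using I by (elim conjE)
  from this[rule_format, OF o] show "\<And>U f g. f \<in> regular Y U \<Longrightarrow> g \<in> I U \<Longrightarrow> (\<lambda>x. f x * g x) \<in> I U" .
  have "\<forall>\<U> f. (\<forall>U\<in>\<U>. openin (zariski Y) U) \<longrightarrow> (f \<in> I (\<Union>\<U>) \<longleftrightarrow> (\<forall>U\<in>\<U>. f \<in> I U))"
    using I by (elim conjE)
  from this[rule_format] show "\<And>\<U> f. (\<And>U. U \<in> \<U> \<Longrightarrow> openin (zariski Y) U) \<Longrightarrow> f \<in> I (\<Union>\<U>) \<longleftrightarrow> (\<forall>U\<in>\<U>. f \<in> I U)" .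
  have "\<forall>U h f. affine_open Y U \<longrightarrow> h \<in> regular Y U \<longrightarrow> f \<in> I {x \<in> U. h x \<noteq> 0} \<longrightarrow>
        (\<exists>g\<in>I U. \<exists>N::nat. \<forall>x\<in>U. h x \<noteq> 0 \<longrightarrow> g x = h x ^ N * f x)"
    using I by (elim conjE)
  from this[rule_format] show "\<And>U h f. affine_open Y U \<Longrightarrow> h \<in> regular Y U \<Longrightarrow> f \<in> I {x \<in> U. h x \<noteq> 0} \<Longrightarrow>
        \<exists>g\<in>I U. \<exists>N::nat. \<forall>x\<in>U. h x \<noteq> 0 \<longrightarrow> g x = h x ^ N * f x" .
qed

lemma ideal_cong:
  assumes I: "closed_subscheme Y I" "f \<in> I U" and g: "\<And>x. x \<in> U \<Longrightarrow> g x = f x"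
  shows "g \<in> I U"
proof -
  have "(\<lambda>x. g x - f x) \<in> I U"
    using closed_subschemeD(3)[OF I(1) closed_subschemeD(1)[OF I]] g by simp
  from closed_subschemeD(4)[OF I(1) I(2) this] show ?thesis by simp
qed

lemma ideal_restrict:
  assumes I: "closed_subscheme Y I" "f \<in> I U" and V: "openin (zariski Y) V" "V \<subseteq> U"
  shows "f \<in> I V"
  using closed_subschemeD(6)[OF I(1), of "{U, V}" f] closed_subschemeD(1)[OF I] I(2) V
  by (auto simp: Un_absorb2)

lemma ideal_local:
  assumes I: "closed_subscheme Y I" and U: "openin (zariski Y) U"
    and loc: "\<And>y. y \<in> U \<Longrightarrow> \<exists>V. y \<in> V \<and> f \<in> I V"
  shows "f \<in> I U"
proof -
  define \<U> where "\<U> = {V. openin (zariski Y) V \<and> V \<subseteq> U \<and> f \<in> I V}"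
  have "f \<in> I (\<Union>\<U>)" using closed_subschemeD(6)[OF I, of \<U> f] by (auto simp: \<U>_def)
  moreover have "\<Union>\<U> = U"
  proof
    show "U \<subseteq> \<Union>\<U>"
    proof
      fix y assume "y \<in> U"
      with loc obtain V where V: "y \<in> V" "f \<in> I V" by blast
      then have "V \<inter> U \<in> \<U>"
        using ideal_restrict[OF I V(2), of "V \<inter> U"] closed_subschemeD(1)[OF I V(2)] U
        by (auto simp: \<U>_def)
      then show "y \<in> \<Union>\<U>" using \<open>y \<in> U\<close> V by blast
    qed
  qed (auto simp: \<U>_def)
  ultimately show ?thesis by simp
qed

lemma linear_subset_ideal:
  assumes Y: "space_with_functions Y" and I: "closed_subscheme Y I" and U: "openin (zariski Y) U"
  shows "linear_subset (I U)"
  using closed_subschemeD(3,4)[OF I] closed_subschemeD(5)[OF I regular_const[OF Y U]] U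
  unfolding linear_subset_def by simp

section \<open>Stalks as sets of representatives\<close>

lemma openin_points: "openin (zariski Y) U \<Longrightarrow> x \<in> U \<Longrightarrow> x \<in> points Y"
  using openin_subset by fastforce

text \<open>Representatives, not classes: two functions agreeing near \<open>x\<close> stay distinct
  elements. Hence the congruence lemma for ideals below and, later, the separate set
  \<open>zero_germs\<close>.\<close>

definition germs :: "('a, 'k) fspace \<Rightarrow> ('a set \<Rightarrow> ('a \<Rightarrow> 'k) set) \<Rightarrow> 'a \<Rightarrow> ('a \<Rightarrow> 'k) set" where
  "germs Y F x = {f. \<exists>U. openin (zariski Y) U \<and> x \<in> U \<and> f \<in> F U}"

lemma germsI: "openin (zariski Y) U \<Longrightarrow> x \<in> U \<Longrightarrow> f \<in> F U \<Longrightarrow> f \<in> germs Y F x"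
  unfolding germs_def by blast

lemma germsE:
  assumes "f \<in> germs Y F x"
  obtains U where "openin (zariski Y) U" "x \<in> U" "f \<in> F U"
  using assms unfolding germs_def by blast

lemma linear_subset_germs:
  assumes F: "\<And>U. openin (zariski Y) U \<Longrightarrow> linear_subset (F U)"
    and r: "\<And>U V f. openin (zariski Y) U \<Longrightarrow> openin (zariski Y) V \<Longrightarrow> V \<subseteq> U \<Longrightarrow> f \<in> F U \<Longrightarrow> f \<in> F V"
    and x: "x \<in> points Y"
  shows "linear_subset (germs Y F x)"
  unfolding linear_subset_def
proof (intro conjI ballI allI)
  show "(\<lambda>_. 0) \<in> germs Y F x" using x linear_subset_zero[OF F[OF openin_topspace]] by (auto intro: germsI)
  fix f g assume "f \<in> germs Y F x" "g \<in> germs Y F x"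
  then obtain U V where U: "openin (zariski Y) U" "x \<in> U" "f \<in> F U"
    and V: "openin (zariski Y) V" "x \<in> V" "g \<in> F V" by (elim germsE)
  have "f \<in> F (U \<inter> V)" "g \<in> F (U \<inter> V)" "openin (zariski Y) (U \<inter> V)"
    using r[OF U(1) _ _ U(3)] r[OF V(1) _ _ V(3)] U V by auto
  then show "(\<lambda>x. f x + g x) \<in> germs Y F x"
    using linear_subset_add[OF F] U V by (intro germsI[of Y "U \<inter> V"]) auto
next
  fix c f assume "f \<in> germs Y F x"
  then show "(\<lambda>x. c * f x) \<in> germs Y F x"
    by (elim germsE) (intro germsI, auto intro: linear_subset_scale[OF F])
qed

lemma linear_subset_stalk:
  "space_with_functions Y \<Longrightarrow> x \<in> points Y \<Longrightarrow> linear_subset (germs Y (regular Y) x)"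
  by (rule linear_subset_germs) (auto intro: linear_subset_regular regular_restrict)

lemma linear_subset_germs_ideal:
  "space_with_functions Y \<Longrightarrow> closed_subscheme Y I \<Longrightarrow> x \<in> points Y \<Longrightarrow> linear_subset (germs Y I x)"
  by (rule linear_subset_germs) (auto intro: linear_subset_ideal ideal_restrict)

lemma germs_ideal_mult:
  assumes Y: "space_with_functions Y" and I: "closed_subscheme Y I"
    and "f \<in> germs Y (regular Y) x" "g \<in> germs Y I x"
  shows "(\<lambda>y. f y * g y) \<in> germs Y I x"
proof -
  obtain U V where U: "openin (zariski Y) U" "x \<in> U" "f \<in> regular Y U"
    and V: "openin (zariski Y) V" "x \<in> V" "g \<in> I V" using assms(3,4) by (elim germsE)
  have "f \<in> regular Y (U \<inter> V)" "g \<in> I (U \<inter> V)"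
    using regular_restrict[OF Y U(1) _ _ U(3)] ideal_restrict[OF I V(3)] U V by auto
  then show ?thesis
    using closed_subschemeD(5)[OF I] U V by (intro germsI[of Y "U \<inter> V"]) auto
qed

lemma germs_ideal_cong:
  assumes I: "closed_subscheme Y I" and f: "f \<in> germs Y I x"
    and V: "openin (zariski Y) V" "x \<in> V" "\<And>y. y \<in> V \<Longrightarrow> g y = f y"
  shows "g \<in> germs Y I x"
proof -
  obtain U where U: "openin (zariski Y) U" "x \<in> U" "f \<in> I U" using f by (elim germsE)
  have "f \<in> I (U \<inter> V)" using ideal_restrict[OF I U(3)] U V by auto
  then have "g \<in> I (U \<inter> V)" using ideal_cong[OF I] V by (metis IntD2)
  then show ?thesis using U V by (intro germsI[of Y "U \<inter> V"]) auto
qed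

lemma stalk_mult:
  assumes Y: "space_with_functions Y" and "f \<in> germs Y (regular Y) x" "g \<in> germs Y (regular Y) x"
  shows "(\<lambda>y. f y * g y) \<in> germs Y (regular Y) x"
proof -
  obtain U V where U: "openin (zariski Y) U" "x \<in> U" "f \<in> regular Y U"
    and V: "openin (zariski Y) V" "x \<in> V" "g \<in> regular Y V" using assms(2,3) by (elim germsE)
  have "f \<in> regular Y (U \<inter> V)" "g \<in> regular Y (U \<inter> V)"
    using regular_restrict[OF Y U(1) _ _ U(3)] regular_restrict[OF Y V(1) _ _ V(3)] U V by auto
  then show ?thesis using U V by (intro germsI[of Y "U \<inter> V"] regular_mult[OF Y]) auto
qed

lemma stalk_const: "space_with_functions Y \<Longrightarrow> x \<in> points Y \<Longrightarrow> (\<lambda>_. c) \<in> germs Y (regular Y) x"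
  by (rule germsI[of _ "points Y"]) (auto intro: regular_const)

lemma stalk_power:
  assumes "space_with_functions Y" "f \<in> germs Y (regular Y) x"
  shows "(\<lambda>y. f y ^ n) \<in> germs Y (regular Y) x"
  using assms by (auto elim!: germsE intro: germsI regular_power)

lemma stalk_inverse:
  assumes "space_with_functions Y" "f \<in> germs Y (regular Y) x" "f x \<noteq> 0"
  shows "(\<lambda>y. inverse (f y)) \<in> germs Y (regular Y) x"
proof -
  obtain U where U: "openin (zariski Y) U" "x \<in> U" "f \<in> regular Y U" using assms(2) by (elim germsE)
  show ?thesis
    using regular_nonzero_open[OF assms(1) U(1,3)] regular_inverse[OF assms(1) U(1,3)] U assms(3)
    by (intro germsI[of Y "{y \<in> U. f y \<noteq> 0}"]) auto
qed

lemma stalk_fraction: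
  assumes Y: "space_with_functions Y" and U: "affine_open Y U" "x \<in> U"
    and f: "f \<in> germs Y (regular Y) x"
  obtains g h where "g \<in> regular Y U" "h \<in> regular Y U" "h x \<noteq> 0" "openin (zariski Y) {y \<in> U. h y \<noteq> 0}"
    "\<And>y. y \<in> U \<Longrightarrow> h y \<noteq> 0 \<Longrightarrow> f y = g y / h y"
proof -
  note U' = affine_openD(1)[OF U(1)]
  obtain V where V: "openin (zariski Y) V" "x \<in> V" "f \<in> regular Y V" using f by (elim germsE)
  then have "f \<in> regular Y (V \<inter> U)" using regular_restrict[OF Y V(1) _ _ V(3)] U' by auto
  then obtain g h where gh: "g \<in> regular Y U" "h \<in> regular Y U"
       "h x \<noteq> 0" "{y \<in> U. h y \<noteq> 0} \<subseteq> V \<inter> U" "\<forall>y\<in>U. h y \<noteq> 0 \<longrightarrow> f y = g y / h y"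
    using affine_openD(5)[OF U(1), of "V \<inter> U" x f] V U U' by auto
  show ?thesis by (rule that[OF gh(1-3) regular_nonzero_open[OF Y U' gh(2)]]) (use gh in auto)
qed

text \<open>Away from \<open>x\<close> the constant 1 is locally in the ideal, so the only condition
  that an ideal supported at \<open>x\<close> puts on a section is on its germ at
  \<open>x\<close>.\<close>

lemma ideal_iff_germs:
  assumes Y: "space_with_functions Y" and I: "closed_subscheme Y I" and s: "support Y I \<subseteq> {x}"
    and U: "openin (zariski Y) U"
  shows "f \<in> I U \<longleftrightarrow> f \<in> regular Y U \<and> (x \<in> U \<longrightarrow> f \<in> germs Y I x)"
proof (intro iffI conjI impI)
  assume "f \<in> I U"
  then show "f \<in> regular Y U" using closed_subschemeD(2)[OF I] by blast
  show "x \<in> U \<Longrightarrow> f \<in> germs Y I x" using U \<open>f \<in> I U\<close> by (auto intro: germsI)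
next
  assume f: "f \<in> regular Y U \<and> (x \<in> U \<longrightarrow> f \<in> germs Y I x)"
  show "f \<in> I U"
  proof (rule ideal_local[OF I U])
    fix y assume y: "y \<in> U"
    show "\<exists>V. y \<in> V \<and> f \<in> I V"
    proof (cases "y = x")
      case True then show ?thesis using f y by (auto elim: germsE)
    next
      case False
      then have "y \<notin> support Y I" using s by auto
      then obtain W where W: "y \<in> W" "(\<lambda>_. 1) \<in> I W"
        using y openin_points[OF U] unfolding support_def by auto
      have o: "openin (zariski Y) (W \<inter> U)" using closed_subschemeD(1)[OF I W(2)] U by blast
      have "(\<lambda>x. f x * 1) \<in> I (W \<inter> U)"
        by (rule closed_subschemeD(5)[OF I])
          (use regular_restrict[OF Y U o _ conjunct1[OF f]] ideal_restrict[OF I W(2) o] in auto)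
      then show ?thesis using y W by auto
    qed
  qed
qed

text \<open>A section that does not vanish at \<open>x\<close> is invertible modulo an ideal of finite colength
  supported at \<open>x\<close>: some polynomial in it with non-zero constant term lies in the ideal.\<close>

lemma stalk_section_mod_ideal:
  assumes Y: "space_with_functions Y" and I: "closed_subscheme Y I"
    and U: "affine_open Y U" "x \<in> U"
    and sp: "\<And>v. v \<in> regular Y U \<Longrightarrow> in_span_mod (germs Y I x) n w v"
    and f: "f \<in> germs Y (regular Y) x"
  shows "\<exists>g\<in>regular Y U. (\<lambda>y. f y - g y) \<in> germs Y I x"
proof -
  note U' = affine_openD(1)[OF U(1)]
  note x = openin_points[OF U' U(2)]
  obtain g h where gh: "g \<in> regular Y U" "h \<in> regular Y U" "h x \<noteq> 0" "openin (zariski Y) {y \<in> U. h y \<noteq> 0}"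
    "\<And>y. y \<in> U \<Longrightarrow> h y \<noteq> 0 \<Longrightarrow> f y = g y / h y"
    using stalk_fraction[OF Y U f] by blast
  note W = linear_subset_germs_ideal[OF Y I x]
  \<comment> \<open>The \<open>n + 1\<close> powers of \<open>h\<close> live in a quotient spanned
    by \<open>n\<close> elements, so they satisfy a polynomial relation.\<close>
  have "\<not> independent_mod (germs Y I x) (Suc n) (\<lambda>i y. h y ^ i)"
    by (rule more_than_spanning_dependent[OF W, of _ n w]) (use sp regular_power[OF Y U' gh(2)] in auto)
  then obtain c i0 where c: "(\<lambda>y. \<Sum>i<Suc n. c i * h y ^ i) \<in> germs Y I x" "i0 < Suc n" "c i0 \<noteq> 0"
    unfolding independent_mod_def by blast
  \<comment> \<open>Splitting off the lowest power \<open>h ^ m\<close>, a unit at \<open>x\<close>,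
    leaves a factor \<open>c m + h * s\<close> with \<open>c m\<close> nonzero.\<close>
  define m where "m = (LEAST i. c i \<noteq> 0)"
  have m: "c m \<noteq> 0" "\<And>i. i < m \<Longrightarrow> c i = 0"
    unfolding m_def using c(3) by (metis (mono_tags, lifting) LeastI, auto dest: not_less_Least)
  have "m \<le> i0" unfolding m_def using c(3) by (rule Least_le)
  then have m_less: "m < Suc n" using c(2) by simp
  define s where "s = (\<lambda>y. \<Sum>i\<in>{Suc m..<Suc n}. c i * h y ^ (i - Suc m))"
  have s: "s \<in> regular Y U"
    unfolding s_def using Y U' gh(2)
    by (intro regular_sum regular_mult regular_const regular_power)
  have eq: "(\<Sum>i<Suc n. c i * h y ^ i) = h y ^ m * (c m + h y * s y)" for y
  proof -
    have "(\<Sum>i<Suc n. c i * h y ^ i) = (\<Sum>i\<in>{m..<Suc n}. c i * h y ^ i)"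
      using m m_less by (intro sum.mono_neutral_right) auto
    also have "\<dots> = c m * h y ^ m + (\<Sum>i\<in>{Suc m..<Suc n}. c i * h y ^ i)"
      using m_less by (rule sum.atLeast_Suc_lessThan)
    also have "(\<Sum>i\<in>{Suc m..<Suc n}. c i * h y ^ i) = h y ^ Suc m * s y"
      unfolding s_def sum_distrib_left
    proof (intro sum.cong refl)
      fix i assume "i \<in> {Suc m..<Suc n}"
      then have "h y ^ i = h y ^ Suc m * h y ^ (i - Suc m)" by (subst power_add[symmetric]) simp
      then show "c i * h y ^ i = h y ^ Suc m * (c i * h y ^ (i - Suc m))" by simp
    qed
    finally show ?thesis by (simp add: algebra_simps)
  qed
  have hst: "h \<in> germs Y (regular Y) x" using U' U(2) gh(2) by (rule germsI)
  \<comment> \<open>Multiplying the relation by \<open>f / (c m * h ^ m)\<close> and using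
    \<open>f * h = g\<close> puts \<open>f + g * s / c m\<close> into the ideal, so \<open>f\<close>
    is congruent to a section over \<open>U\<close>.\<close>
  have "(\<lambda>y. (inverse (c m) * f y * inverse (h y ^ m)) * (\<Sum>i<Suc n. c i * h y ^ i)) \<in> germs Y I x"
    using stalk_power[OF Y hst, of m] gh(3) f c(1)
    by (intro germs_ideal_mult[OF Y I] stalk_mult[OF Y] stalk_const[OF Y x] stalk_inverse[OF Y]) auto
  then have "(\<lambda>y. f y - (- inverse (c m)) * (g y * s y)) \<in> germs Y I x"
  proof (rule germs_ideal_cong[OF I _ gh(4)])
    show "x \<in> {y \<in> U. h y \<noteq> 0}" using U gh by simp
    fix y assume "y \<in> {y \<in> U. h y \<noteq> 0}"
    then have y: "h y \<noteq> 0" "f y = g y / h y" using gh by auto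
    show "f y - (- inverse (c m)) * (g y * s y) =
        inverse (c m) * f y * inverse (h y ^ m) * (\<Sum>i<Suc n. c i * h y ^ i)"
      unfolding eq using y m(1) by (simp add: field_simps)
  qed
  moreover have "(\<lambda>y. (- inverse (c m)) * (g y * s y)) \<in> regular Y U"
    using Y U' gh(1) s by (intro regular_mult regular_const)
  ultimately show ?thesis by (intro bexI[of _ "\<lambda>y. (- inverse (c m)) * (g y * s y)"])
qed

text \<open>For a fat point, the sections over \<open>U\<close> modulo the ideal and the stalk at
  \<open>x\<close> modulo the germs of the ideal are the same space: injectivity is
  \<open>ideal_iff_germs\<close>, surjectivity is \<open>stalk_section_mod_ideal\<close>. This frees
  the basis condition from the choice of \<open>U\<close>.\<close>

lemma hilb_chart_iff_stalk:
  assumes Y: "space_with_functions Y" and I: "closed_subscheme Y I" and s: "support Y I = {x}"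
  shows "I \<in> hilb_chart Y n U b \<longleftrightarrow> affine_open Y U \<and> x \<in> U \<and> (\<forall>i<n. b i \<in> regular Y U) \<and>
    independent_mod (germs Y I x) n b \<and> (\<forall>f\<in>germs Y (regular Y) x. in_span_mod (germs Y I x) n b f)"
    (is "?L \<longleftrightarrow> ?R")
proof
  assume L: ?L
  then have U: "affine_open Y U" "x \<in> U" and B: "basis_mod (regular Y U) (I U) n b"
    using s unfolding hilb_chart_def by auto
  note U' = affine_openD(1)[OF U(1)]
  note x = openin_points[OF U' U(2)]
  note W = linear_subset_germs_ideal[OF Y I x]
  note B = basis_modD[OF linear_subset_ideal[OF Y I U'] regular_const[OF Y U'] B]
  have sub: "I U \<subseteq> germs Y I x" using U' U(2) by (auto intro: germsI)
  have sp: "in_span_mod (germs Y I x) n b v" if "v \<in> regular Y U" for v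
    using in_span_mod_mono[OF B(2)[OF that] sub] .
  have "independent_mod (germs Y I x) n b"
    unfolding independent_mod_def
  proof (intro allI impI)
    fix c i assume c: "(\<lambda>y. \<Sum>i<n. c i * b i y) \<in> germs Y I x" and i: "i < n"
    have "(\<lambda>y. \<Sum>i<n. c i * b i y) \<in> regular Y U"
      using B(1) Y U' by (intro regular_sum regular_mult regular_const) auto
    then have "(\<lambda>y. \<Sum>i<n. c i * b i y) \<in> I U" using c ideal_iff_germs[OF Y I _ U', of x] s by simp
    from independent_modD[OF B(3) this i] show "c i = 0" .
  qed
  moreover have "in_span_mod (germs Y I x) n b f" if f: "f \<in> germs Y (regular Y) x" for f
  proof -
    obtain g where g: "g \<in> regular Y U" "(\<lambda>y. f y - g y) \<in> germs Y I x"
      using stalk_section_mod_ideal[OF Y I U sp f] by blast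
    obtain c where "(\<lambda>y. g y - (\<Sum>i<n. c i * b i y)) \<in> germs Y I x"
      using sp[OF g(1)] unfolding in_span_mod_def by blast
    from linear_subset_add[OF W g(2) this]
    have "(\<lambda>y. f y - (\<Sum>i<n. c i * b i y)) \<in> germs Y I x" by (simp add: algebra_simps)
    then show ?thesis by (rule in_span_modI)
  qed
  ultimately show ?R using U B(1) by simp
next
  assume R: ?R
  then have U: "affine_open Y U" "x \<in> U" by auto
  note U' = affine_openD(1)[OF U(1)]
  note II = ideal_iff_germs[OF Y I _ U', of x]
  have sub: "I U \<subseteq> germs Y I x" using U' U(2) by (auto intro: germsI)
  have "in_span_mod (I U) n b v" if v: "v \<in> regular Y U" for v
  proof -
    have "in_span_mod (germs Y I x) n b v" using R germsI[OF U' U(2), of v "regular Y"] v by simp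
    then obtain c where c: "(\<lambda>y. v y - (\<Sum>i<n. c i * b i y)) \<in> germs Y I x"
      unfolding in_span_mod_def by blast
    have "(\<lambda>y. v y - (\<Sum>i<n. c i * b i y)) \<in> regular Y U"
      using R Y U' v by (intro linear_subset_diff linear_subset_regular regular_sum regular_mult regular_const) auto
    then have "(\<lambda>y. v y - (\<Sum>i<n. c i * b i y)) \<in> I U" using c II s by simp
    then show ?thesis by (rule in_span_modI)
  qed
  moreover have "independent_mod (I U) n b" using R sub by (blast intro: independent_mod_mono)
  ultimately have "basis_mod (regular Y U) (I U) n b"
    using R by (simp add: basis_mod_iff[OF linear_subset_ideal[OF Y I U'] regular_const[OF Y U']])
  then show ?L using U I s unfolding hilb_chart_def by simp
qed

text \<open>Passes from a chart over \<open>U'\<close> to one over another affine neighbourhood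
  \<open>U\<close> of \<open>x\<close> in which the first \<open>m\<close> basis elements are
  prescribed.\<close>

lemma hilb_chart_extend:
  assumes Y: "space_with_functions Y" and s: "support Y I = {x}"
    and I: "I \<in> hilb_chart Y n U' w"
    and U: "affine_open Y U" "x \<in> U"
    and b: "independent_mod (germs Y I x) m b" "\<And>i. i < m \<Longrightarrow> b i \<in> regular Y U" and "m \<le> n"
  obtains b' where "\<And>i. i < m \<Longrightarrow> b' i = b i" "I \<in> hilb_chart Y n U b'"
proof -
  have cl: "closed_subscheme Y I" using I unfolding hilb_chart_def by simp
  note Uo = affine_openD(1)[OF U(1)]
  note x = openin_points[OF Uo U(2)]
  note W = linear_subset_germs_ideal[OF Y cl x]
  note iff = hilb_chart_iff_stalk[OF Y cl s]
  have w: "affine_open Y U'" "x \<in> U'" "\<And>i. i < n \<Longrightarrow> w i \<in> regular Y U'"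
    "independent_mod (germs Y I x) n w" "\<And>f. f \<in> germs Y (regular Y) x \<Longrightarrow> in_span_mod (germs Y I x) n w f"
    using I unfolding iff by auto
  have st: "g \<in> germs Y (regular Y) x" if "g \<in> regular Y U" for g using germsI[of Y U x g "regular Y"] Uo U that by simp
  \<comment> \<open>The old basis consists of sections over \<open>U'\<close>; each element is
    replaced by a section over \<open>U\<close> congruent to it at \<open>x\<close>.\<close>
  have "\<exists>g\<in>regular Y U. (\<lambda>y. w i y - g y) \<in> germs Y I x" if "i < n" for i
    by (rule stalk_section_mod_ideal[OF Y cl U, of n w])
      (use w st that germsI[OF affine_openD(1)[OF w(1)] w(2), of "w i" "regular Y"] in auto)
  then obtain w' where w': "\<And>i. i < n \<Longrightarrow> w' i \<in> regular Y U"
    "\<And>i. i < n \<Longrightarrow> (\<lambda>y. w i y - w' i y) \<in> germs Y I x" by metis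
  have "independent_mod (germs Y I x) n w'"
    unfolding independent_mod_def
  proof (intro allI impI)
    fix c i assume c: "(\<lambda>y. \<Sum>i<n. c i * w' i y) \<in> germs Y I x" and i: "i < n"
    have "(\<lambda>y. \<Sum>i<n. c i * (w i y - w' i y)) \<in> germs Y I x"
      by (rule linear_subset_sum[OF W]) (use w' in auto)
    from linear_subset_add[OF W this c]
    have "(\<lambda>y. \<Sum>i<n. c i * w i y) \<in> germs Y I x" by (simp add: algebra_simps sum_subtractf)
    from independent_modD[OF w(4) this i] show "c i = 0" .
  qed
  from extend_independent_mod[OF W w'(1) this b \<open>m \<le> n\<close>]
  obtain b' where b': "\<And>i. i < m \<Longrightarrow> b' i = b i" "\<And>i. i < n \<Longrightarrow> b' i \<in> regular Y U"
    "independent_mod (germs Y I x) n b'" by auto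
  have "in_span_mod (germs Y I x) n b' f" if "f \<in> germs Y (regular Y) x" for f
    by (rule independent_mod_spans[OF W b'(3), of w]) (use w(5) b'(2) st that in auto)
  then have "I \<in> hilb_chart Y n U b'" unfolding iff using U b' by auto
  with b'(1) show ?thesis by (rule that)
qed

section \<open>Points of the F-blowups are fat points\<close>

lemma varietyD:
  assumes "variety X"
  shows "space_with_functions X" "x \<in> points X \<Longrightarrow> \<exists>U. affine_open X U \<and> x \<in> U"
proof -
  show "space_with_functions X" using assms unfolding variety_def by (elim conjE)
  show "x \<in> points X \<Longrightarrow> \<exists>U. affine_open X U \<and> x \<in> U"
    using assms unfolding variety_def by blast
qed

lemma section_character_eval: "x \<in> U \<Longrightarrow> section_character X U (\<lambda>f. f x)"
  unfolding section_character_def by auto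

text \<open>Evaluation at \<open>x\<close> is a character, and on an affine open a character comes
  from exactly one point.\<close>

lemma affine_open_separates_points:
  assumes X: "space_with_functions X" and U: "affine_open X U" and xy: "x \<in> U" "y \<in> U" "x \<noteq> y"
  obtains v where "v \<in> regular X U" "v x = 0" "v y \<noteq> 0"
proof -
  obtain v where v: "v \<in> regular X U" "v x \<noteq> v y"
    using affine_openD(3)[OF U section_character_eval[OF xy(1)]] xy by metis
  have "(\<lambda>z. v z - v x) \<in> regular X U"
    using affine_openD(1)[OF U] v X
    by (intro linear_subset_diff linear_subset_regular regular_const)
  then show ?thesis using v by (intro that[of "\<lambda>z. v z - v x"]) auto
qed

lemma point_ideal_inj:
  assumes X: "variety X" and x: "x \<in> points X" "y \<in> points X" and eq: "point_ideal X x = point_ideal X y"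
  shows "x = y"
proof (rule ccontr)
  assume ne: "x \<noteq> y"
  note sw = varietyD(1)[OF X]
  obtain U where U: "affine_open X U" "x \<in> U" using varietyD(2)[OF X x(1)] by blast
  note o = affine_openD(1)[OF U(1)]
  show False
  proof (cases "y \<in> U")
    case False
    then have "(\<lambda>_. 1) \<in> point_ideal X y U" using o regular_const[OF sw o] by (simp add: point_ideal_def)
    then have "(\<lambda>_. 1) \<in> point_ideal X x U" by (simp add: eq)
    then show False using U o by (simp add: point_ideal_def)
  next
    case True
    obtain v where v: "v \<in> regular X U" "v x = 0" "v y \<noteq> 0"
      using affine_open_separates_points[OF sw U True ne] .
    then have "v \<in> point_ideal X x U" using o by (simp add: point_ideal_def)
    then have "v \<in> point_ideal X y U" by (simp add: eq)
    then show False using v True o by (simp add: point_ideal_def)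
  qed
qed

lemma FB_proj_eqI:
  assumes "variety X" "x \<in> points X" "scheme_image X Z = point_ideal X x"
  shows "FB_proj X Z = x"
  unfolding FB_proj_def using assms point_ideal_inj[OF assms(1)] by (intro the_equality) auto

text \<open>A function of \<open>X\<close> vanishing at \<open>x\<close> but not at \<open>y\<close>
  lies in the ideal and is invertible near \<open>y\<close>, which removes \<open>y\<close> from the
  support. At \<open>x\<close>, a function with nonzero value is a unit and would put 1 into the
  ideal, so the ideal meets the stalk of \<open>X\<close> exactly in the maximal ideal.\<close>

lemma fat_point:
  fixes X :: "('a, 'k::alg_closed_field) fspace"
  assumes p: "CHAR('k) > 0" and X: "space_with_functions X"
    and I: "closed_subscheme (frob_root X e) I"
    and U: "affine_open X U" "support (frob_root X e) I \<subseteq> U" "x \<in> U"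
    and van: "\<And>v. v \<in> regular X U \<Longrightarrow> v x = 0 \<Longrightarrow> v \<in> I U" and one: "(\<lambda>_. 1) \<notin> I U"
  shows "support (frob_root X e) I = {x}" "scheme_image X I = point_ideal X x"
proof -
  let ?Y = "frob_root X e"
  note Y = space_with_functions_frob_root[OF p X, of e]
  note o = affine_openD(1)[OF U(1)]
  note x = openin_points[OF o U(3)]
  have XY: "regular X V \<subseteq> regular ?Y V" if "openin (zariski X) V" for V
    using regular_frob_root_mono(1)[OF X that] .
  have s: "support ?Y I \<subseteq> {x}"
  proof
    fix y assume y: "y \<in> support ?Y I"
    show "y \<in> {x}"
    proof (rule ccontr)
      assume ne: "y \<notin> {x}"
      have "y \<in> U" using y U by auto
      then obtain v where v: "v \<in> regular X U" "v x = 0" "v y \<noteq> 0"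
        using affine_open_separates_points[OF X U(1,3)] ne by blast
      define W where "W = {z \<in> U. v z \<noteq> 0}"
      have W: "openin (zariski X) W" unfolding W_def by (rule regular_nonzero_open[OF X o v(1)])
      have "v \<in> I W" using ideal_restrict[OF I van[OF v(1,2)]] W by (auto simp: W_def)
      moreover have "(\<lambda>z. inverse (v z)) \<in> regular ?Y W"
        using XY[OF W] regular_inverse[OF X o v(1)] unfolding W_def by blast
      ultimately have "(\<lambda>z. inverse (v z) * v z) \<in> I W" using closed_subschemeD(5)[OF I] by blast
      then have "(\<lambda>_. 1) \<in> I W" by (rule ideal_cong[OF I]) (simp add: W_def)
      then show False using y W \<open>y \<in> U\<close> v unfolding support_def by (auto simp: W_def)
    qed
  qed
  have iff: "f \<in> I V \<longleftrightarrow> f \<in> regular ?Y V \<and> (x \<in> V \<longrightarrow> f \<in> germs ?Y I x)" if "openin (zariski X) V" for f V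
    using ideal_iff_germs[OF Y I s] that by simp
  have one': "(\<lambda>_. 1) \<notin> germs ?Y I x"
    using one iff[OF o, of "\<lambda>_. 1"] regular_const[OF Y, of U 1] o by auto
  have "x \<in> support ?Y I"
    using x one' unfolding support_def by (auto simp: germs_def)
  then show "support ?Y I = {x}" using s by auto
  have key: "f \<in> germs ?Y I x \<longleftrightarrow> f x = 0" if f: "f \<in> germs X (regular X) x" for f
  proof
    assume f0: "f x = 0"
    obtain g h where gh: "g \<in> regular X U" "h \<in> regular X U" "h x \<noteq> 0" "openin (zariski X) {y \<in> U. h y \<noteq> 0}"
      "\<And>y. y \<in> U \<Longrightarrow> h y \<noteq> 0 \<Longrightarrow> f y = g y / h y"
      using stalk_fraction[OF X U(1,3) f] by blast
    define W where "W = {z \<in> U. h z \<noteq> 0}"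
    have W: "openin (zariski X) W" "x \<in> W" using gh U unfolding W_def by auto
    have "g x = 0" using gh U f0 by auto
    then have "g \<in> I W" using ideal_restrict[OF I van[OF gh(1)]] W by (auto simp: W_def)
    moreover have "(\<lambda>z. inverse (h z)) \<in> regular ?Y W"
      using XY[OF W(1)] regular_inverse[OF X o gh(2)] unfolding W_def by blast
    ultimately have "(\<lambda>z. inverse (h z) * g z) \<in> I W" using closed_subschemeD(5)[OF I] by blast
    then have "f \<in> I W" by (rule ideal_cong[OF I]) (simp add: W_def gh field_simps)
    then show "f \<in> germs ?Y I x" using W by (intro germsI) auto
  next
    assume fI: "f \<in> germs ?Y I x"
    show "f x = 0"
    proof (rule ccontr)
      assume ne: "f x \<noteq> 0"
      obtain V where V: "openin (zariski X) V" "x \<in> V" "f \<in> regular X V" using f by (elim germsE)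
      define W where "W = {z \<in> V. f z \<noteq> 0}"
      have W: "openin (zariski X) W" "x \<in> W" using regular_nonzero_open[OF X V(1,3)] V ne unfolding W_def by auto
      have "(\<lambda>z. inverse (f z)) \<in> regular ?Y W"
        using XY[OF W(1)] regular_inverse[OF X V(1,3)] unfolding W_def by blast
      then have "(\<lambda>z. inverse (f z)) \<in> germs ?Y (regular ?Y) x" using W by (intro germsI[of ?Y W]) auto
      from germs_ideal_mult[OF Y I this fI] have "(\<lambda>_. 1) \<in> germs ?Y I x"
        by (rule germs_ideal_cong[OF I]) (use W in \<open>auto simp: W_def\<close>)
      with one' show False by blast
    qed
  qed
  show "scheme_image X I = point_ideal X x"
  proof (rule ext)
    fix V
    show "scheme_image X I V = point_ideal X x V"
    proof (cases "openin (zariski X) V")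
      case True
      have "f \<in> I V \<longleftrightarrow> (x \<in> V \<longrightarrow> f x = 0)" if f: "f \<in> regular X V" for f
        unfolding iff[OF True] using key[OF germsI[of X V x f "regular X"]] f True XY[OF True] by auto
      then show ?thesis using True by (auto simp: scheme_image_def point_ideal_def)
    qed (simp add: scheme_image_def point_ideal_def)
  qed
qed

lemma frob_fibre_regular:
  fixes X :: "('a, 'k::alg_closed_field) fspace"
  assumes p: "CHAR('k) > 0" and X: "space_with_functions X"
    and V: "openin (zariski X) V" and f: "f \<in> regular X V" "x \<in> V \<Longrightarrow> f x = 0"
  shows "f \<in> frob_fibre X e x V"
proof -
  have "\<exists>W (m::nat) a g. openin (zariski X) W \<and> y \<in> W \<and> W \<subseteq> V \<and>
      (\<forall>i<m. a i \<in> regular (frob_root X e) W \<and> g i \<in> point_ideal X x W) \<and> (\<forall>z\<in>W. f z = (\<Sum>i<m. a i z * g i z))"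
    if "y \<in> V" for y
    using that V f regular_const[OF space_with_functions_frob_root[OF p X, of e], of V 1]
    by (intro exI[of _ V] exI[of _ "1::nat"] exI[of _ "\<lambda>_ _. 1"] exI[of _ "\<lambda>_. f"])
      (auto simp: point_ideal_def)
  then show ?thesis
    using V f regular_frob_root_mono(1)[OF X V, of e] by (auto simp: frob_fibre_def scheme_preimage_def)
qed

lemma frob_fibre_vanish:
  assumes "g \<in> frob_fibre X e x V" "x \<in> V"
  shows "g x = 0"
proof -
  have "openin (zariski X) V"
    using assms by (cases "openin (zariski X) V") (simp_all add: frob_fibre_def scheme_preimage_def)
  then have "\<forall>y\<in>V. \<exists>W (m::nat) a f. openin (zariski X) W \<and> y \<in> W \<and> W \<subseteq> V \<and>
      (\<forall>i<m. a i \<in> regular (frob_root X e) W \<and> f i \<in> point_ideal X x W) \<and> (\<forall>z\<in>W. g z = (\<Sum>i<m. a i z * f i z))"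
    using assms(1) by (simp add: frob_fibre_def scheme_preimage_def)
  from bspec[OF this assms(2)] obtain W m a f where W: "openin (zariski X) W" "x \<in> W"
    "\<forall>i<(m::nat). f i \<in> point_ideal X x W" "\<forall>y\<in>W. g y = (\<Sum>i<m. a i y * f i y)" by metis
  then have "\<forall>i<m. f i x = 0" by (simp add: point_ideal_def)
  then show ?thesis using W by simp
qed

lemma frob_fibre_point_in_support:
  assumes "x \<in> points X"
  shows "x \<in> support (frob_root X e) (frob_fibre X e x)"
  using assms frob_fibre_vanish[of "\<lambda>_. 1" X e x] unfolding support_def by auto

section \<open>Coordinates on charts and density of the smooth fibres\<close>

lemma hilb_coords_coord: "v \<in> regular Y U \<Longrightarrow> i < n \<Longrightarrow> (\<lambda>I. coord_mod (I U) n b v i) \<in> hilb_coords Y n U b"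
  unfolding hilb_coords_def by (rule alg_gen.gen) blast

lemma hilb_coords_closed:
  shows "P \<in> hilb_coords Y n U b \<Longrightarrow> Q \<in> hilb_coords Y n U b \<Longrightarrow> (\<lambda>I. P I * Q I) \<in> hilb_coords Y n U b"
    and "P \<in> hilb_coords Y n U b \<Longrightarrow> Q \<in> hilb_coords Y n U b \<Longrightarrow> (\<lambda>I. P I - Q I) \<in> hilb_coords Y n U b"
proof -
  show "(\<lambda>I. P I * Q I) \<in> hilb_coords Y n U b" if "P \<in> hilb_coords Y n U b" "Q \<in> hilb_coords Y n U b" for P Q
    using that unfolding hilb_coords_def by (rule alg_gen.mult)
  show "(\<lambda>I. P I - Q I) \<in> hilb_coords Y n U b"
    if PQ: "P \<in> hilb_coords Y n U b" "Q \<in> hilb_coords Y n U b"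
  proof -
    have "(\<lambda>I. P I + (\<lambda>_. -1) I * Q I) \<in> hilb_coords Y n U b"
      using PQ unfolding hilb_coords_def by (intro alg_gen.add alg_gen.mult alg_gen.const[of "- 1"])
    then show ?thesis by simp
  qed
qed

lemma hilb_basic_open: "P \<in> hilb_coords Y n U b \<Longrightarrow> openin (hilb_topology Y n) {I \<in> hilb_chart Y n U b. P I \<noteq> 0}"
  unfolding hilb_topology_def by (rule topology_generated_by_Basis) blast

lemma FB_points_dense:
  assumes Z: "Z \<in> FB_points X e" "openin (hilb_topology (frob_root X e) (fibre_length X e)) T" "Z \<in> T"
  obtains x where "smooth_at X x" "frob_fibre X e x \<in> T"
  using Z unfolding FB_points_def in_closure_of by blast

text \<open>If \<open>P\<close> did not vanish at \<open>Z\<close>, its nonvanishing locus in the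
  chart would be an open neighbourhood of \<open>Z\<close> and contain a fibre over a smooth point.
  Thus polynomial identities between coordinates pass from smooth fibres to the closure.\<close>

lemma FB_points_coord_eq:
  assumes Z: "Z \<in> FB_points X e" "Z \<in> hilb_chart (frob_root X e) (fibre_length X e) U b"
    and P: "P \<in> hilb_coords (frob_root X e) (fibre_length X e) U b"
    and van: "\<And>x. smooth_at X x \<Longrightarrow> frob_fibre X e x \<in> hilb_chart (frob_root X e) (fibre_length X e) U b \<Longrightarrow>
      P (frob_fibre X e x) = 0"
  shows "P Z = 0"
proof (rule ccontr)
  assume "P Z \<noteq> 0"
  with Z FB_points_dense[OF Z(1) hilb_basic_open[OF P]] van show False by blast
qed

text \<open>The scalars to which the functions of \<open>X\<close> are congruent modulo
  \<open>Z\<close> form a character of \<open>U\<close>, and such a character is evaluation at a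
  point, to which \<open>fat_point\<close> applies.\<close>

lemma FB_point_fat_point:
  fixes X :: "('a, 'k::alg_closed_field) fspace"
  assumes p: "CHAR('k) > 0" and X: "variety X" and Z: "Z \<in> FB_points X e"
  obtains x where "x \<in> points X" "support (frob_root X e) Z = {x}" "scheme_image X Z = point_ideal X x"
proof -
  let ?Y = "frob_root X e" and ?n = "fibre_length X e"
  note sX = varietyD(1)[OF X]
  note Y = space_with_functions_frob_root[OF p sX, of e]
  have "Z \<in> topspace (hilb_topology ?Y ?n)" using Z unfolding FB_points_def in_closure_of by blast
  then obtain U b where Zc: "Z \<in> hilb_chart ?Y ?n U b" unfolding topspace_hilb by blast
  then have cl: "closed_subscheme ?Y Z" and supp: "support ?Y Z \<subseteq> U" and UY: "affine_open ?Y U"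
    unfolding hilb_chart_def by auto
  then have U: "affine_open X U" using affine_open_frob_root[OF p] by blast
  note o = affine_openD(1)[OF U]
  then have oY: "openin (zariski ?Y) U" by simp
  have XY: "v \<in> regular ?Y U" if "v \<in> regular X U" for v
    using regular_frob_root_mono(1)[OF sX o, of e] that by blast
  have BI: "linear_subset (I U)" "independent_mod (I U) ?n b" "v \<in> regular ?Y U \<Longrightarrow> in_span_mod (I U) ?n b v"
     "i < ?n \<Longrightarrow> b i \<in> regular ?Y U"
    if "I \<in> hilb_chart ?Y ?n U b" for I v i
  proof -
    have "closed_subscheme ?Y I" "basis_mod (regular ?Y U) (I U) ?n b" using that unfolding hilb_chart_def by auto
    then show "linear_subset (I U)" "independent_mod (I U) ?n b" "v \<in> regular ?Y U \<Longrightarrow> in_span_mod (I U) ?n b v"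
      "i < ?n \<Longrightarrow> b i \<in> regular ?Y U"
      using basis_modD[OF linear_subset_ideal[OF Y _ oY] regular_const[OF Y oY]] linear_subset_ideal[OF Y _ oY]
      by blast+
  qed
  have n0: "?n > 0" using p by (simp add: fibre_length_def)
  have one: "(\<lambda>_. 1) \<notin> Z U"
  proof
    assume "(\<lambda>_. 1) \<in> Z U"
    from closed_subschemeD(5)[OF cl BI(4)[OF Zc n0] this] have "b 0 \<in> Z U" by simp
    moreover have "(\<Sum>i<?n. (if i = 0 then 1 else 0) * b i x) = b 0 x" for x
      using n0 by (simp add: if_distrib[of "\<lambda>c. c * _"] cong: if_cong)
    ultimately have "(\<lambda>x. \<Sum>i<?n. (if i = 0 then 1 else 0) * b i x) \<in> Z U" by simp
    from independent_modD[OF BI(2)[OF Zc] this n0] show False by simp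
  qed
  define c where "c = (\<lambda>I v i. coord_mod (I U) ?n b v i)"
  have cI: "(\<lambda>x. v x - (\<Sum>i<?n. c I v i * b i x)) \<in> I U" if "I \<in> hilb_chart ?Y ?n U b" "v \<in> regular ?Y U" for I v
    unfolding c_def by (rule coord_mod_in[OF BI(1)[OF that(1)] BI(2)[OF that(1)] BI(3)[OF that]])
  have o1: "(\<lambda>_. 1) \<in> regular ?Y U" using regular_const[OF Y oY] .
  \<comment> \<open>Proportionality of the coordinate vectors of \<open>v\<close> and of 1 is
    written through 2 by 2 minors to make it polynomial. On a smooth fibre it holds with factor
    \<open>v y\<close>.\<close>
  have proportional: "c Z v i * c Z (\<lambda>_. 1) j = c Z v j * c Z (\<lambda>_. 1) i"
    if v: "v \<in> regular X U" and ij: "i < ?n" "j < ?n" for v i j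
  proof -
    have "c Z v i * c Z (\<lambda>_. 1) j - c Z v j * c Z (\<lambda>_. 1) i = 0"
      unfolding c_def
    proof (rule FB_points_coord_eq[OF Z Zc])
      show "(\<lambda>I. coord_mod (I U) ?n b v i * coord_mod (I U) ?n b (\<lambda>_. 1) j
          - coord_mod (I U) ?n b v j * coord_mod (I U) ?n b (\<lambda>_. 1) i) \<in> hilb_coords ?Y ?n U b"
        using ij XY[OF v] o1 by (intro hilb_coords_closed hilb_coords_coord)
      fix y assume y: "smooth_at X y" and Ic: "frob_fibre X e y \<in> hilb_chart ?Y ?n U b"
      let ?I = "frob_fibre X e y"
      have "y \<in> points X" using y unfolding smooth_at_def by blast
      then have "y \<in> U" using frob_fibre_point_in_support[of y X e] Ic unfolding hilb_chart_def by auto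
      have "(\<lambda>x. v x - v y) \<in> regular X U"
        using v sX o by (intro linear_subset_diff linear_subset_regular regular_const)
      then have "(\<lambda>x. v x - v y) \<in> ?I U" by (rule frob_fibre_regular[OF p sX o]) simp
      from linear_subset_add[OF BI(1)[OF Ic] this linear_subset_scale[OF BI(1)[OF Ic] cI[OF Ic o1], of "v y"]]
      have "(\<lambda>x. v x - (\<Sum>i<?n. (v y * c ?I (\<lambda>_. 1) i) * b i x)) \<in> ?I U"
        by (simp add: algebra_simps sum_distrib_left)
      from coord_mod_eqI[OF BI(1)[OF Ic] BI(2)[OF Ic] this]
      have "coord_mod (?I U) ?n b v i = v y * c ?I (\<lambda>_. 1) i" if "i < ?n" for i using that by blast
      then show "coord_mod (?I U) ?n b v i * coord_mod (?I U) ?n b (\<lambda>_. 1) j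
          - coord_mod (?I U) ?n b v j * coord_mod (?I U) ?n b (\<lambda>_. 1) i = 0"
        using ij by (simp add: c_def)
    qed
    then show ?thesis by simp
  qed
  \<comment> \<open>The coordinate vector of 1 is nonzero because 1 is not in the ideal; a nonzero
    entry serves as the denominator of the scalar \<open>l\<close> below.\<close>
  obtain j where j: "j < ?n" "c Z (\<lambda>_. 1) j \<noteq> 0"
  proof (rule ccontr, goal_cases)
    case 1
    then have "\<forall>j<?n. c Z (\<lambda>_. 1) j = 0" by blast
    then show False using cI[OF Zc o1] one by simp
  qed
  have ex: "\<exists>l. (\<lambda>x. v x - l) \<in> Z U" if v: "v \<in> regular X U" for v
  proof -
    define l where "l = c Z v j / c Z (\<lambda>_. 1) j"
    have "c Z v i = l * c Z (\<lambda>_. 1) i" if "i < ?n" for i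
      using proportional[OF v that j(1)] j(2) by (simp add: l_def field_simps)
    then have "(\<lambda>x. v x - (\<Sum>i<?n. l * c Z (\<lambda>_. 1) i * b i x)) \<in> Z U" using cI[OF Zc XY[OF v]] by simp
    from linear_subset_diff[OF BI(1)[OF Zc] this linear_subset_scale[OF BI(1)[OF Zc] cI[OF Zc o1], of l]]
    have "(\<lambda>x. v x - l) \<in> Z U" by (simp add: algebra_simps sum_distrib_left)
    then show ?thesis ..
  qed
  have uniq: "l = l'" if "(\<lambda>x. v x - l) \<in> Z U" "(\<lambda>x. v x - l') \<in> Z U" for v l l'
  proof (rule ccontr)
    assume ne: "l \<noteq> l'"
    have "(\<lambda>x. inverse (l' - l) * ((v x - l) - (v x - l'))) \<in> Z U"
      using linear_subset_scale[OF BI(1)[OF Zc] linear_subset_diff[OF BI(1)[OF Zc] that]] .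
    then show False using one ne by simp
  qed
  define \<psi> where "\<psi> v = (THE l. (\<lambda>x. v x - l) \<in> Z U)" for v
  have \<psi>_eq: "\<psi> v = l" if "(\<lambda>x. v x - l) \<in> Z U" for v l
    unfolding \<psi>_def using that uniq by (intro the_equality)
  have \<psi>_in: "(\<lambda>x. v x - \<psi> v) \<in> Z U" if "v \<in> regular X U" for v
    using ex[OF that] \<psi>_eq by metis
  have "section_character X U \<psi>"
    unfolding section_character_def
  proof (intro conjI ballI allI impI)
    show "\<psi> (\<lambda>_. l) = l" for l using closed_subschemeD(3)[OF cl oY] by (intro \<psi>_eq) simp
    fix f g assume f: "f \<in> regular X U" and g: "g \<in> regular X U"
    show "\<psi> f = \<psi> g" if "\<forall>x\<in>U. f x = g x"
      by (rule \<psi>_eq, rule ideal_cong[OF cl \<psi>_in[OF g]]) (use that in simp)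
    show "\<psi> (\<lambda>x. f x + g x) = \<psi> f + \<psi> g"
      using linear_subset_add[OF BI(1)[OF Zc] \<psi>_in[OF f] \<psi>_in[OF g]]
      by (intro \<psi>_eq) (simp add: algebra_simps)
    \<comment> \<open>Product rule: \<open>f * g - \<psi> f * \<psi> g = f * (g - \<psi> g) + \<psi>
      g * (f - \<psi> f)\<close>, with both terms in the ideal.\<close>
    have "(\<lambda>x. f x * (g x - \<psi> g) + \<psi> g * (f x - \<psi> f)) \<in> Z U"
      by (intro linear_subset_add[OF BI(1)[OF Zc]] closed_subschemeD(5)[OF cl XY[OF f] \<psi>_in[OF g]]
          linear_subset_scale[OF BI(1)[OF Zc] \<psi>_in[OF f]])
    then show "\<psi> (\<lambda>x. f x * g x) = \<psi> f * \<psi> g" by (intro \<psi>_eq) (simp add: algebra_simps)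
  qed
  then obtain x where x: "x \<in> U" "\<And>f. f \<in> regular X U \<Longrightarrow> \<psi> f = f x" using affine_openD(3)[OF U] by blast
  have "v \<in> Z U" if "v \<in> regular X U" "v x = 0" for v using \<psi>_in[OF that(1)] x(2)[OF that(1)] that(2) by simp
  from fat_point[OF p sX cl U supp x(1) this one] show ?thesis
    using that openin_points[OF o x(1)] by blast
qed

section \<open>Frobenius fibres over smooth points\<close>

inductive_set ideal_gen :: "('a \<Rightarrow> 'k::field) set \<Rightarrow> ('a \<Rightarrow> 'k) set \<Rightarrow> ('a \<Rightarrow> 'k) set" for R S where
  zero: "(\<lambda>_. 0) \<in> ideal_gen R S"
| step: "r \<in> R \<Longrightarrow> s \<in> S \<Longrightarrow> f \<in> ideal_gen R S \<Longrightarrow> (\<lambda>x. r x * s x + f x) \<in> ideal_gen R S"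

text \<open>Representatives of the zero germ. They are put among the generators of the stalk ideals
  below, so that these ideals do not distinguish functions agreeing near \<open>x\<close>.\<close>

definition zero_germs :: "('a, 'k::field) fspace \<Rightarrow> 'a \<Rightarrow> ('a \<Rightarrow> 'k) set" where
  "zero_germs X x = {f. \<exists>V. openin (zariski X) V \<and> x \<in> V \<and> (\<forall>y\<in>V. f y = 0)}"

lemma ideal_gen_add:
  assumes "f \<in> ideal_gen R S" "g \<in> ideal_gen R S" shows "(\<lambda>x. f x + g x) \<in> ideal_gen R S"
  using assms(1)
proof induction
  case (step r s f)
  from ideal_gen.step[OF step(1,2,4)] show ?case by (simp add: add.assoc)
qed (simp add: assms(2))

lemma ideal_gen_base: "(\<lambda>_. 1) \<in> R \<Longrightarrow> s \<in> S \<Longrightarrow> s \<in> ideal_gen R S"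
  using ideal_gen.step[OF _ _ ideal_gen.zero, of "\<lambda>_. 1" R s S] by simp

lemma ideal_gen_mult:
  assumes R: "\<And>f g. f \<in> R \<Longrightarrow> g \<in> R \<Longrightarrow> (\<lambda>x. f x * g x) \<in> R" and r: "r \<in> R" and f: "f \<in> ideal_gen R S"
  shows "(\<lambda>x. r x * f x) \<in> ideal_gen R S"
  using f
proof induction
  case (step t s f)
  from ideal_gen.step[OF R[OF r step(1)] step(2,4)] show ?case by (simp add: algebra_simps)
qed (simp add: ideal_gen.zero)

lemma ideal_gen_mono: "f \<in> ideal_gen R S \<Longrightarrow> S \<subseteq> S' \<Longrightarrow> f \<in> ideal_gen R S'"
  by (induction rule: ideal_gen.induct) (auto intro: ideal_gen.intros)

lemma linear_subset_ideal_gen: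
  assumes "\<And>f g. f \<in> R \<Longrightarrow> g \<in> R \<Longrightarrow> (\<lambda>x. f x * g x) \<in> R" "\<And>c. (\<lambda>_. c) \<in> R"
  shows "linear_subset (ideal_gen R S)"
  unfolding linear_subset_def
  using ideal_gen.zero ideal_gen_add ideal_gen_mult[OF assms(1) assms(2)] by blast

lemma ideal_gen_sum:
  assumes "\<And>i. i \<in> A \<Longrightarrow> f i \<in> ideal_gen R S"
  shows "(\<lambda>x. \<Sum>i\<in>A. f i x) \<in> ideal_gen R S"
  using assms by (induction A rule: infinite_finite_induct) (simp_all add: ideal_gen.zero ideal_gen_add)

lemma ideal_gen_insert:
  assumes R: "linear_subset R" and f: "f \<in> ideal_gen R (insert s S)"
  shows "\<exists>r\<in>R. \<exists>g\<in>ideal_gen R S. f = (\<lambda>x. r x * s x + g x)"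
  using f
proof induction
  case zero
  show ?case by (intro bexI[OF _ linear_subset_zero[OF R]] bexI[OF _ ideal_gen.zero]) simp
next
  case (step r t f)
  then obtain r' g where f: "r' \<in> R" "g \<in> ideal_gen R S" "f = (\<lambda>x. r' x * s x + g x)" by blast
  show ?case
  proof (cases "t = s")
    case True
    show ?thesis
      by (intro bexI[OF _ linear_subset_add[OF R step(1) f(1)]] bexI[OF _ f(2)]) (simp add: True f(3) algebra_simps)
  next
    case False
    then have "(\<lambda>x. r x * t x + g x) \<in> ideal_gen R S" using step f by (intro ideal_gen.step) auto
    then show ?thesis
      by (intro bexI[OF _ f(1)] bexI[of _ "\<lambda>x. r x * t x + g x"]) (simp_all add: f(3) algebra_simps)
  qed
qed

lemma linear_subset_in_span_mod:
  assumes W: "linear_subset W" shows "linear_subset {v. in_span_mod W n b v}"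
  unfolding linear_subset_def
proof (intro conjI ballI allI CollectI)
  show "in_span_mod W n b (\<lambda>_. 0)"
    by (rule in_span_modI[where c = "\<lambda>_. 0"]) (simp add: linear_subset_zero[OF W])
  fix v v' assume "v \<in> {v. in_span_mod W n b v}" "v' \<in> {v. in_span_mod W n b v}"
  then obtain c c' where "(\<lambda>x. v x - (\<Sum>i<n. c i * b i x)) \<in> W" "(\<lambda>x. v' x - (\<Sum>i<n. c' i * b i x)) \<in> W"
    unfolding in_span_mod_def by blast
  from linear_subset_add[OF W this]
  have "(\<lambda>x. (v x + v' x) - (\<Sum>i<n. (c i + c' i) * b i x)) \<in> W"
    by (simp add: algebra_simps sum.distrib)
  then show "in_span_mod W n b (\<lambda>x. v x + v' x)" by (rule in_span_modI)
next
  fix a v assume "v \<in> {v. in_span_mod W n b v}"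
  then obtain c where "(\<lambda>x. v x - (\<Sum>i<n. c i * b i x)) \<in> W" unfolding in_span_mod_def by blast
  from linear_subset_scale[OF W this, of a]
  have "(\<lambda>x. a * v x - (\<Sum>i<n. (a * c i) * b i x)) \<in> W"
    by (simp add: algebra_simps sum_distrib_left)
  then show "in_span_mod W n b (\<lambda>x. a * v x)" by (rule in_span_modI)
qed

lemma in_span_mod_of_mem:
  assumes "v \<in> W" shows "in_span_mod W n b v"
  by (rule in_span_modI[where c = "\<lambda>_. 0"]) (simp add: assms)

section \<open>Generators of the maximal ideal and its bracket powers\<close>

lemma max_ideal_at_iff: "f \<in> max_ideal_at X x \<longleftrightarrow> f \<in> germs X (regular X) x \<and> f x = 0"
  unfolding max_ideal_at_def germs_def by auto

locale space_point =
  fixes X :: "('a, 'k::field) fspace" and x :: 'a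
  assumes space: "space_with_functions X" and point: "x \<in> points X"
begin

abbreviation "\<O> \<equiv> germs X (regular X) x"
abbreviation "\<mm> \<equiv> max_ideal_at X x"
abbreviation "\<zz> \<equiv> zero_germs X x"

lemmas linear_stalk = linear_subset_stalk[OF space point]
lemmas mult_stalk = stalk_mult[OF space]
lemmas const_stalk = stalk_const[OF space point]

lemma zero_germs_mult: "f \<in> \<zz> \<Longrightarrow> (\<lambda>y. g y * f y) \<in> \<zz>"
  unfolding zero_germs_def by auto

lemma germ_eqI:
  assumes g: "g \<in> ideal_gen \<O> S" and S: "\<zz> \<subseteq> S"
    and V: "openin (zariski X) V" "x \<in> V" "\<And>y. y \<in> V \<Longrightarrow> f y = g y"
  shows "f \<in> ideal_gen \<O> S"
proof -
  have "(\<lambda>y. f y - g y) \<in> \<zz>" using V unfolding zero_germs_def by auto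
  then have "(\<lambda>y. f y - g y) \<in> S" using S by blast
  from ideal_gen_add[OF ideal_gen_base[OF const_stalk this] g] show ?thesis by simp
qed

lemma stalk_minus_value: "f \<in> \<O> \<Longrightarrow> (\<lambda>y. f y - f x) \<in> \<mm>"
  by (simp add: max_ideal_at_iff linear_subset_diff[OF linear_stalk _ const_stalk])

text \<open>If \<open>G\<close> generates the algebra of sections over \<open>U\<close>, the
  differences \<open>g - g x\<close> generate the maximal ideal: the product rule carries this from
  \<open>G\<close> to all polynomials in \<open>G\<close>, and germs are fractions of such
  polynomials.\<close>

lemma max_ideal_finitely_generated:
  assumes U: "affine_open X U" "x \<in> U"
  obtains S where "finite S" "S \<subseteq> \<mm>" "\<mm> \<subseteq> ideal_gen \<O> (\<zz> \<union> S)"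
proof -
  note o = affine_openD(1)[OF U(1)]
  obtain G where G: "finite G" "G \<subseteq> regular X U" "\<And>f. f \<in> regular X U \<Longrightarrow> \<exists>g\<in>alg_gen G. \<forall>x\<in>U. f x = g x"
    using affine_openD(2)[OF U(1)] by blast
  define S where "S = (\<lambda>g y. g y - g x) ` G"
  have st: "f \<in> \<O>" if "f \<in> regular X U" for f using germsI[of X U x f "regular X"] o U that by simp
  have poly: "(\<lambda>y. P y - P x) \<in> ideal_gen \<O> (\<zz> \<union> S) \<and> P \<in> \<O>" if "P \<in> alg_gen G" for P
    using that
  proof induction
    case (const c)
    then show ?case using const_stalk[of c] ideal_gen.zero by simp
  next
    case (gen g)
    then have "(\<lambda>y. g y - g x) \<in> \<zz> \<union> S" by (simp add: S_def)
    then show ?case using ideal_gen_base[OF const_stalk] st G gen by blast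
  next
    case (add f g)
    then have f: "(\<lambda>y. f y - f x) \<in> ideal_gen \<O> (\<zz> \<union> S)" "f \<in> \<O>"
      and g: "(\<lambda>y. g y - g x) \<in> ideal_gen \<O> (\<zz> \<union> S)" "g \<in> \<O>" by auto
    from ideal_gen_add[OF f(1) g(1)] linear_subset_add[OF linear_stalk f(2) g(2)] show ?case
      by (simp add: algebra_simps)
  next
    case (mult f g)
    then have f: "(\<lambda>y. f y - f x) \<in> ideal_gen \<O> (\<zz> \<union> S)" "f \<in> \<O>"
      and g: "(\<lambda>y. g y - g x) \<in> ideal_gen \<O> (\<zz> \<union> S)" "g \<in> \<O>" by auto
    have "(\<lambda>y. f y * (g y - g x) + g x * (f y - f x)) \<in> ideal_gen \<O> (\<zz> \<union> S)"
      by (rule ideal_gen_add[OF ideal_gen_mult[OF mult_stalk f(2) g(1)]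
        ideal_gen_mult[OF mult_stalk const_stalk[of "g x"] f(1)]])
    also have "(\<lambda>y. f y * (g y - g x) + g x * (f y - f x)) = (\<lambda>y. f y * g y - f x * g x)"
      by (simp add: fun_eq_iff algebra_simps)
    finally show ?case using mult_stalk[OF f(2) g(2)] by blast
  qed
  have "f \<in> ideal_gen \<O> (\<zz> \<union> S)" if f: "f \<in> \<mm>" for f
  proof -
    have f': "f \<in> \<O>" "f x = 0" using f by (auto simp: max_ideal_at_iff)
    obtain g h where gh: "g \<in> regular X U" "h \<in> regular X U" "h x \<noteq> 0" "openin (zariski X) {y \<in> U. h y \<noteq> 0}"
      "\<And>y. y \<in> U \<Longrightarrow> h y \<noteq> 0 \<Longrightarrow> f y = g y / h y"
      using stalk_fraction[OF space U f'(1)] by blast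
    obtain P where P: "P \<in> alg_gen G" "\<And>y. y \<in> U \<Longrightarrow> g y = P y" using G(3)[OF gh(1)] by blast
    have "P x = 0" using gh(3,5) f' U P(2) by (metis divide_eq_0_iff)
    have "(\<lambda>y. inverse (h y) * (P y - P x)) \<in> ideal_gen \<O> (\<zz> \<union> S)"
      using poly[OF P(1)] gh by (intro ideal_gen_mult mult_stalk stalk_inverse[OF space st]) auto
    then show ?thesis
      by (rule germ_eqI[OF _ _ gh(4)]) (use U gh P \<open>P x = 0\<close> in \<open>auto simp: divide_inverse mult.commute\<close>)
  qed
  moreover have "S \<subseteq> \<mm>" using G st stalk_minus_value by (auto simp: S_def)
  ultimately show ?thesis using G that[of S] by (auto simp: S_def)
qed

text \<open>Nakayama's lemma for the maximal ideal, by eliminating the superfluous generators one by one.\<close>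

lemma max_ideal_generated_by_cotangent_basis:
  assumes S: "finite S" "\<mm> \<subseteq> ideal_gen \<O> (B \<union> S)"
    and B: "\<zz> \<subseteq> B" and SM: "S \<subseteq> \<mm>"
    and cot: "\<And>v. v \<in> \<mm> \<Longrightarrow> \<exists>u\<in>ideal_gen \<O> B. (\<lambda>y. v y - u y) \<in> max_ideal_sq_at X x"
  shows "\<mm> \<subseteq> ideal_gen \<O> B"
  using S SM
proof (induction S rule: finite_induct)
  case empty
  then show ?case by simp
next
  case (insert s S)
  let ?J = "ideal_gen \<O> (B \<union> S)"
  have J: "\<exists>r\<in>\<O>. \<exists>g\<in>?J. f = (\<lambda>y. r y * s y + g y)" if "f \<in> \<mm>" for f
    by (rule ideal_gen_insert[OF linear_stalk]) (use insert.prems that in auto)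
  have "s \<in> \<mm>" using insert by auto
  from cot[OF this] obtain u where u: "u \<in> ideal_gen \<O> B" "(\<lambda>y. s y - u y) \<in> max_ideal_sq_at X x" by blast
  then obtain V m a b where V: "openin (zariski X) V" "x \<in> V"
    and ab: "\<And>i. i < (m::nat) \<Longrightarrow> a i \<in> \<mm>" "\<And>i. i < m \<Longrightarrow> b i \<in> \<mm>"
    and eq: "\<And>y. y \<in> V \<Longrightarrow> s y - u y = (\<Sum>i<m. a i y * b i y)"
    unfolding max_ideal_sq_at_def by blast
  have "\<forall>i\<in>{..<m}. \<exists>rg. fst rg \<in> \<O> \<and> snd rg \<in> ?J \<and> b i = (\<lambda>y. fst rg y * s y + snd rg y)"
  proof
    fix i assume "i \<in> {..<m}"
    then obtain r g where "r \<in> \<O>" "g \<in> ?J" "b i = (\<lambda>y. r y * s y + g y)" using J[OF ab(2)] by blast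
    then show "\<exists>rg. fst rg \<in> \<O> \<and> snd rg \<in> ?J \<and> b i = (\<lambda>y. fst rg y * s y + snd rg y)"
      by (intro exI[of _ "(r, g)"]) simp
  qed
  from bchoice[OF this] obtain rg where rg': "\<forall>i\<in>{..<m}. fst (rg i) \<in> \<O> \<and> snd (rg i) \<in> ?J \<and>
      b i = (\<lambda>y. fst (rg i) y * s y + snd (rg i) y)" ..
  define r g where "r i = fst (rg i)" and "g i = snd (rg i)" for i
  have rg: "\<And>i. i < m \<Longrightarrow> r i \<in> \<O>" "\<And>i. i < m \<Longrightarrow> g i \<in> ?J"
    "\<And>i. i < m \<Longrightarrow> b i = (\<lambda>y. r i y * s y + g i y)" using rg' by (simp_all add: r_def g_def)
  \<comment> \<open>Substituting \<open>b i = r i * s + g i\<close> into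
    \<open>s = u + (\<Sum>i<m. a i * b i)\<close> gives \<open>(1 - t) * s = h\<close> near
    \<open>x\<close>. As \<open>t\<close> vanishes at \<open>x\<close>, the factor is a unit, so
    \<open>s\<close> already lies in the ideal of the other generators.\<close>
  define t where "t = (\<lambda>y. \<Sum>i<m. 1 * (a i y * r i y))"
  define h where "h = (\<lambda>y. u y + (\<Sum>i<m. a i y * g i y))"
  have aO: "a i \<in> \<O>" "a i x = 0" if "i < m" for i using ab(1)[OF that] by (auto simp: max_ideal_at_iff)
  have tO: "t \<in> \<O>" unfolding t_def
    using linear_subset_sum[OF linear_stalk, of "{..<m}" "\<lambda>i y. a i y * r i y" "\<lambda>_. 1"] aO rg
    by (auto intro: mult_stalk)
  have "t x = 0" using aO by (simp add: t_def)
  have "(\<lambda>y. 1 - t y) \<in> \<O>" using linear_subset_diff[OF linear_stalk const_stalk tO] .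
  then obtain V' where V': "openin (zariski X) V'" "x \<in> V'" "(\<lambda>y. 1 - t y) \<in> regular X V'" by (elim germsE)
  define D where "D = {y \<in> V'. 1 - t y \<noteq> 0}"
  have D: "openin (zariski X) (V \<inter> D)" "x \<in> V \<inter> D"
    using regular_nonzero_open[OF space V'(1,3)] V V' \<open>t x = 0\<close> by (auto simp: D_def)
  have "h \<in> ?J" unfolding h_def
    using u(1) aO rg by (intro ideal_gen_add ideal_gen_sum ideal_gen_mult mult_stalk) (auto intro: ideal_gen_mono)
  then have "(\<lambda>y. inverse (1 - t y) * h y) \<in> ?J"
    using \<open>(\<lambda>y. 1 - t y) \<in> \<O>\<close> \<open>t x = 0\<close> by (intro ideal_gen_mult mult_stalk stalk_inverse[OF space]) auto
  then have sJ: "s \<in> ?J"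
  proof (rule germ_eqI[OF _ _ D])
    fix y assume y: "y \<in> V \<inter> D"
    have "s y = u y + (\<Sum>i<m. a i y * (r i y * s y + g i y))" using eq[of y] y rg(3) by (simp add: algebra_simps)
    also have "\<dots> = t y * s y + h y"
      by (simp add: t_def h_def algebra_simps sum.distrib sum_distrib_left)
    finally have "(1 - t y) * s y = h y" by (simp add: algebra_simps)
    then show "s y = inverse (1 - t y) * h y" using y by (auto simp: D_def field_simps)
  qed (use B in auto)
  have "\<mm> \<subseteq> ?J"
  proof
    fix f assume "f \<in> \<mm>"
    from J[OF this] obtain r g where "r \<in> \<O>" "g \<in> ?J" "f = (\<lambda>y. r y * s y + g y)" by blast
    then show "f \<in> ?J" using ideal_gen_add[OF ideal_gen_mult[OF mult_stalk _ sJ]] by blast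
  qed
  then show ?case using insert by simp
qed

text \<open>The bracket power of the maximal ideal, generated by \<open>q\<close>-th powers of
  single elements rather than by products of \<open>q\<close> elements. For \<open>q = p^e\<close>,
  taking \<open>q\<close>-th roots turns it into the ideal of the Frobenius fibre.\<close>

definition frobenius_power :: "nat \<Rightarrow> ('a \<Rightarrow> 'k) set" where
  "frobenius_power q = ideal_gen \<O> (\<zz> \<union> (\<lambda>t y. t y ^ q) ` \<mm>)"

text \<open>The spanning elements are the monomials in the \<open>b i\<close> with all exponents
  below \<open>q\<close>. Writing a coefficient \<open>r\<close> as \<open>r x\<close> plus a
  combination of the \<open>b i\<close> trades it for a constant and monomials of higher degree. A
  monomial with an exponent at least \<open>q\<close> lies in the bracket power, so the process
  stops.\<close>

lemma stalk_spanned_mod_frobenius_power: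
  assumes b: "\<And>i. i < d \<Longrightarrow> b i \<in> \<mm>" and gen: "\<mm> \<subseteq> ideal_gen \<O> (\<zz> \<union> b ` {..<d})" and q: "q > 0"
  obtains w where "\<And>r. r \<in> \<O> \<Longrightarrow> in_span_mod (frobenius_power q) (q ^ d) w r"
proof -
  let ?W = "frobenius_power q"
  have W: "linear_subset ?W" unfolding frobenius_power_def
    by (rule linear_subset_ideal_gen) (auto intro: mult_stalk const_stalk)
  define mon where "mon a = (\<lambda>y. \<Prod>i<d. b i y ^ a i)" for a
  \<comment> \<open>Exponent vectors with entries below \<open>q\<close>; there are
    \<open>q ^ d\<close> of them, numbered by \<open>en\<close>.\<close>
  define A where "A = PiE {..<d} (\<lambda>_. {..<q})"
  have A: "finite A" "card A = q ^ d" by (simp_all add: A_def card_PiE finite_PiE)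
  obtain en where en: "bij_betw en {..<q ^ d} A" using ex_bij_betw_nat_finite[OF A(1)] A(2)
    by (metis atLeast0LessThan)
  define w where "w j = mon (en j)" for j
  let ?sp = "in_span_mod ?W (q ^ d) w"
  note lin = linear_subset_in_span_mod[OF W, of "q ^ d" w]
  have bO: "b i \<in> \<O>" if "i < d" for i using b[OF that] by (auto simp: max_ideal_at_iff)
  have mon: "mon a \<in> \<O>" for a
  proof -
    have "(\<lambda>y. \<Prod>i\<in>I. b i y ^ a i) \<in> \<O>" if "I \<subseteq> {..<d}" for I
      using that by (induction I rule: infinite_finite_induct)
        (auto intro: const_stalk mult_stalk stalk_power[OF space bO])
    then show ?thesis unfolding mon_def by blast
  qed
  have mon_upd: "mon (a(i := k)) y = b i y ^ k * (\<Prod>j\<in>{..<d} - {i}. b j y ^ a j)" if "i < d" for a i k y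
    unfolding mon_def using that by (subst prod.remove[of _ i]) (auto intro!: prod.cong)
  have big: "(\<lambda>y. r y * mon a y) \<in> ?W" if "r \<in> \<O>" "i < d" "q \<le> a i" for r a i
  proof -
    have "mon (a(i := a i)) y = mon (a(i := a i - q)) y * b i y ^ q" for y
      unfolding mon_upd[OF that(2)] using that(3) by (simp add: power_add[symmetric] mult_ac)
    then have "(\<lambda>y. r y * mon a y) = (\<lambda>y. (r y * mon (a(i := a i - q)) y) * b i y ^ q)" by (simp add: mult.assoc)
    moreover have bq: "(\<lambda>y. b i y ^ q) \<in> ?W" unfolding frobenius_power_def
      using b that by (intro ideal_gen_base const_stalk) auto
    have "(\<lambda>y. (r y * mon (a(i := a i - q)) y) * b i y ^ q) \<in> ?W"
      using ideal_gen_mult[OF mult_stalk mult_stalk[OF that(1) mon[of "a(i := a i - q)"]]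
          bq[unfolded frobenius_power_def]]
      unfolding frobenius_power_def .
    ultimately show ?thesis by (simp only:)
  qed
  have spmon: "?sp (mon a)" for a
  proof (cases "\<exists>i<d. q \<le> a i")
    case True
    then show ?thesis using big[OF const_stalk[of 1], of _ a] by (auto intro: in_span_mod_of_mem)
  next
    case False
    then have "restrict a {..<d} \<in> A" by (auto simp: A_def)
    then obtain j where j: "j < q ^ d" "en j = restrict a {..<d}"
      using en unfolding bij_betw_def by (metis imageE lessThan_iff)
    have "mon a = w j" unfolding w_def j mon_def by (intro ext prod.cong) auto
    have "(\<Sum>i<q ^ d. (if i = j then 1 else 0) * w i y) = w j y" for y
      using j by (simp add: if_distrib[of "\<lambda>c. c * _"] cong: if_cong)
    then show ?thesis unfolding \<open>mon a = w j\<close>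
      by (intro in_span_modI[where c = "\<lambda>i. if i = j then 1 else 0"]) (simp add: linear_subset_zero[OF W])
  qed
  have expand: "\<exists>r'. (\<forall>i<d. r' i \<in> \<O>) \<and> (\<lambda>y. f y - (\<Sum>i<d. r' i y * b i y)) \<in> \<zz>"
    if "f \<in> ideal_gen \<O> (\<zz> \<union> b ` {..<d})" for f
    using that
  proof induction
    case zero
    show ?case using point const_stalk[of 0]
      by (intro exI[of _ "\<lambda>_ _. 0"]) (auto simp: zero_germs_def intro: exI[of _ "points X"])
  next
    case (step r s f)
    then obtain r' V where r': "\<And>i. i < d \<Longrightarrow> r' i \<in> \<O>"
      and V: "openin (zariski X) V" "x \<in> V" "\<And>y. y \<in> V \<Longrightarrow> f y - (\<Sum>i<d. r' i y * b i y) = 0"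
      unfolding zero_germs_def by blast
    show ?case
    proof (cases "s \<in> \<zz>")
      case True
      then obtain V' where "openin (zariski X) V'" "x \<in> V'" "\<And>y. y \<in> V' \<Longrightarrow> s y = 0" unfolding zero_germs_def by blast
      then have "(\<lambda>y. (r y * s y + f y) - (\<Sum>i<d. r' i y * b i y)) \<in> \<zz>"
        using V unfolding zero_germs_def by (auto intro!: exI[of _ "V \<inter> V'"])
      then show ?thesis using r' by blast
    next
      case False
      \<comment> \<open>Several indices may give the same generator; the new coefficient is charged
        to one of them.\<close>
      then obtain j where j: "j < d" "s = b j" using step by auto
      have "(\<Sum>i<d. (if i = j then r y + r' i y else r' i y) * b i y) = r y * b j y + (\<Sum>i<d. r' i y * b i y)" for y
      proof -
        have "(\<Sum>i<d. (if i = j then r y + r' i y else r' i y) * b i y)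
            = (\<Sum>i<d. (if i = j then r y * b i y else 0) + r' i y * b i y)"
          by (intro sum.cong) (auto simp: algebra_simps)
        then show ?thesis using j by (simp add: sum.distrib)
      qed
      then have "(\<lambda>y. (r y * s y + f y) - (\<Sum>i<d. (if i = j then r y + r' i y else r' i y) * b i y)) \<in> \<zz>"
        using V j unfolding zero_germs_def by auto
      moreover have "(\<lambda>y. if i = j then r y + r' i y else r' i y) \<in> \<O>" if "i < d" for i
        using r'[OF that] linear_subset_add[OF linear_stalk step(1) r'[OF that]] by (cases "i = j") simp_all
      ultimately show ?thesis
        by (intro exI[of _ "\<lambda>i y. if i = j then r y + r' i y else r' i y"] conjI allI impI)
    qed
  qed
  \<comment> \<open>\<open>k\<close> bounds how far the degree of \<open>a\<close> may still be
    below \<open>d * q + 1\<close>. At that degree some exponent reaches \<open>q\<close>, and each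
    expansion of \<open>r\<close> raises the degree by 1. The claim for \<open>r\<close> itself is
    read off at \<open>a = 0\<close> with \<open>k = d * q + 1\<close>.\<close>
  have "\<forall>a. d * q + 1 \<le> (\<Sum>i<d. a i) + k \<longrightarrow> (\<forall>r\<in>\<O>. ?sp (\<lambda>y. r y * mon a y))" for k
  proof (induction k)
    case 0
    show ?case
    proof (intro allI impI ballI)
      fix a r assume a: "d * q + 1 \<le> (\<Sum>i<d. a i) + 0" and r: "r \<in> \<O>"
      have "\<exists>i<d. q \<le> a i"
      proof (rule ccontr)
        assume "\<not> ?thesis"
        then have "(\<Sum>i<d. a i) \<le> (\<Sum>i<d. q)" by (intro sum_mono) (auto simp: not_le)
        then show False using a by simp
      qed
      then show "?sp (\<lambda>y. r y * mon a y)" using big[OF r] by (auto intro: in_span_mod_of_mem)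
    qed
  next
    case (Suc k)
    show ?case
    proof (intro allI impI ballI)
      fix a r assume a: "d * q + 1 \<le> (\<Sum>i<d. a i) + Suc k" and r: "r \<in> \<O>"
      obtain r' where r': "\<And>i. i < d \<Longrightarrow> r' i \<in> \<O>" "(\<lambda>y. (r y - r x) - (\<Sum>i<d. r' i y * b i y)) \<in> \<zz>"
        using expand[of "\<lambda>y. r y - r x"] stalk_minus_value[OF r] gen by blast
      have "?sp (\<lambda>y. r' i y * mon (a(i := Suc (a i))) y)" if "i < d" for i
      proof -
        have "(\<Sum>j<d. (a(i := Suc (a i))) j) = Suc (\<Sum>j<d. a j)"
          using that by (simp add: sum.remove[of "{..<d}" i])
        then show ?thesis using Suc.IH a r'(1)[OF that] by simp
      qed
      then have 1: "?sp (\<lambda>y. \<Sum>i<d. 1 * (r' i y * mon (a(i := Suc (a i))) y))"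
        using linear_subset_sum[OF lin, of "{..<d}" "\<lambda>i y. r' i y * mon (a(i := Suc (a i))) y" "\<lambda>_. 1"] by simp
      have "(\<lambda>y. mon a y * ((r y - r x) - (\<Sum>i<d. r' i y * b i y))) \<in> \<zz>" using r'(2) by (rule zero_germs_mult)
      then have "(\<lambda>y. mon a y * ((r y - r x) - (\<Sum>i<d. r' i y * b i y))) \<in> ?W"
        unfolding frobenius_power_def by (intro ideal_gen_base const_stalk) auto
      then have 2: "?sp (\<lambda>y. mon a y * ((r y - r x) - (\<Sum>i<d. r' i y * b i y)))" by (rule in_span_mod_of_mem)
      have 3: "?sp (\<lambda>y. r x * mon a y)" using linear_subset_scale[OF lin, of "mon a"] spmon by simp
      have "mon (a(i := Suc (a i))) y = b i y * mon a y" if "i < d" for i y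
        using mon_upd[OF that, of a "Suc (a i)"] mon_upd[OF that, of a "a i"] by simp
      then have "(\<lambda>y. r y * mon a y) = (\<lambda>y. ((\<Sum>i<d. 1 * (r' i y * mon (a(i := Suc (a i))) y))
          + mon a y * ((r y - r x) - (\<Sum>i<d. r' i y * b i y))) + r x * mon a y)"
        by (auto simp: fun_eq_iff algebra_simps sum_distrib_left)
      then show "?sp (\<lambda>y. r y * mon a y)"
        using linear_subset_add[OF lin linear_subset_add[OF lin]] 1 2 3 by simp
    qed
  qed
  from spec[OF this, of "\<lambda>_. 0" "d * q + 1"] have "?sp r" if "r \<in> \<O>" for r
    using that by (simp add: mon_def)
  then show ?thesis by (rule that)
qed

end

text \<open>Extension of the maximal ideal at \<open>x\<close> to the stalk of
  \<open>frob_root X e\<close>. It stands in for the stalk of the Frobenius fibre and is given by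
  generators, so that roots can be taken term by term.\<close>

definition fibre_ideal :: "('a, 'k::field) fspace \<Rightarrow> nat \<Rightarrow> 'a \<Rightarrow> ('a \<Rightarrow> 'k) set" where
  "fibre_ideal X e x = ideal_gen (germs (frob_root X e) (regular (frob_root X e)) x)
     (zero_germs X x \<union> max_ideal_at X x)"

text \<open>An automorphism respects sums and products, so it acts on a generated element term by
  term: a generator \<open>t ^ q\<close> becomes \<open>t\<close>, and coefficients land in
  \<open>R\<close>.\<close>

lemma (in space_point) root_frobenius_power:
  assumes \<rho>: "field_automorphism \<rho>" and root: "\<And>c. \<rho> (c ^ q) = c"
    and R: "\<And>f. f \<in> \<O> \<Longrightarrow> (\<lambda>y. \<rho> (f y)) \<in> R"
    and f: "f \<in> frobenius_power q"
  shows "(\<lambda>y. \<rho> (f y)) \<in> ideal_gen R (\<zz> \<union> \<mm>)"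
  using f unfolding frobenius_power_def
proof induction
  case zero
  show ?case using ideal_gen.zero by (simp add: field_automorphismD[OF \<rho>])
next
  case (step r s f)
  have "(\<lambda>y. \<rho> (s y)) \<in> \<zz> \<union> \<mm>"
  proof (cases "s \<in> \<zz>")
    case True
    then have "(\<lambda>y. \<rho> (s y)) \<in> \<zz>" by (simp add: zero_germs_def field_automorphismD[OF \<rho>])
    then show ?thesis by blast
  next
    case False
    then obtain t where "t \<in> \<mm>" "s = (\<lambda>y. t y ^ q)" using step(2) by blast
    then show ?thesis by (simp add: root)
  qed
  from ideal_gen.step[OF R[OF step(1)] this step(4)] show ?case by (simp add: field_automorphismD[OF \<rho>])
qed

text \<open>Smoothness supplies \<open>dimension X\<close> cotangent vectors, and Nakayama makes
  them generators of the maximal ideal. For a germ \<open>g\<close> of \<open>frob_root X e\<close>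
  the power \<open>g ^ q\<close> is a germ on \<open>X\<close>; expanding it modulo the bracket
  power and taking \<open>q\<close>-th roots expands \<open>g\<close> modulo the fibre
  ideal.\<close>

lemma smooth_fibre_spanned:
  fixes X :: "('a, 'k::alg_closed_field) fspace"
  assumes p: "CHAR('k) > 0" and X: "variety X" and x: "smooth_at X x"
  obtains w where "\<And>g. g \<in> germs (frob_root X e) (regular (frob_root X e)) x \<Longrightarrow>
      in_span_mod (fibre_ideal X e x) (fibre_length X e) w g"
proof -
  note sX = varietyD(1)[OF X]
  have xp: "x \<in> points X" using x unfolding smooth_at_def by blast
  interpret space_point X x by unfold_locales (use sX xp in auto)
  define d where "d = dimension X"
  define q where "q = CHAR('k) ^ e"
  have q: "q > 0" using p by (simp add: q_def)
  obtain b where b: "basis_mod \<mm> (max_ideal_sq_at X x) d b" using x unfolding smooth_at_def d_def by blast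
  then have bm: "b i \<in> \<mm>" if "i < d" for i using that unfolding basis_mod_def by blast
  obtain U where U: "affine_open X U" "x \<in> U" using varietyD(2)[OF X xp] by blast
  obtain S where S: "finite S" "S \<subseteq> \<mm>" "\<mm> \<subseteq> ideal_gen \<O> (\<zz> \<union> S)"
    using max_ideal_finitely_generated[OF U] by blast
  let ?B = "\<zz> \<union> b ` {..<d}"
  have gen: "\<mm> \<subseteq> ideal_gen \<O> ?B"
  proof (rule max_ideal_generated_by_cotangent_basis[OF S(1) _ _ S(2)])
    show "\<mm> \<subseteq> ideal_gen \<O> (?B \<union> S)" using S(3) ideal_gen_mono[of _ \<O> "\<zz> \<union> S" "?B \<union> S"] by blast
    fix v assume v: "v \<in> \<mm>"
    have "\<forall>v\<in>\<mm>. \<exists>!c. (\<forall>i\<ge>d. c i = 0) \<and> (\<lambda>y. v y - (\<Sum>i<d. c i * b i y)) \<in> max_ideal_sq_at X x"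
      using b unfolding basis_mod_def by (elim conjE)
    from ex1_implies_ex[OF bspec[OF this v]] obtain c where
      c: "(\<lambda>y. v y - (\<Sum>i<d. c i * b i y)) \<in> max_ideal_sq_at X x" by blast
    have "(\<lambda>y. \<Sum>i<d. c i * b i y) \<in> ideal_gen \<O> ?B"
      by (intro ideal_gen_sum ideal_gen_mult mult_stalk const_stalk ideal_gen_base) auto
    then show "\<exists>u\<in>ideal_gen \<O> ?B. (\<lambda>y. v y - u y) \<in> max_ideal_sq_at X x"
      using c by (intro bexI[of _ "\<lambda>y. \<Sum>i<d. c i * b i y"])
  qed auto
  obtain w where w: "\<And>r. r \<in> \<O> \<Longrightarrow> in_span_mod (frobenius_power q) (q ^ d) w r"
    using stalk_spanned_mod_frobenius_power[OF bm gen q] by blast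
  define \<rho> where "\<rho> = inv (\<lambda>c::'k. c ^ q)"
  have \<phi>: "field_automorphism (\<lambda>c::'k. c ^ q)" unfolding q_def by (rule field_automorphism_frobenius[OF p])
  have \<rho>: "field_automorphism \<rho>" unfolding \<rho>_def by (rule field_automorphism_inv[OF \<phi>])
  have root: "\<rho> (c ^ q) = c" "\<rho> c ^ q = c" for c
    using field_automorphismD(1)[OF \<phi>] unfolding \<rho>_def
    by (simp_all add: bij_is_inj inv_f_f bij_is_surj surj_f_inv_f[where f = "\<lambda>c. c ^ q"])
      (metis bij_inv_eq_iff)
  let ?Y = "frob_root X e"
  have R: "(\<lambda>y. \<rho> (f y)) \<in> germs ?Y (regular ?Y) x" if "f \<in> \<O>" for f
    using that unfolding germs_def by (auto simp: regular_frob_root root q_def[symmetric])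
  have "in_span_mod (fibre_ideal X e x) (fibre_length X e) (\<lambda>i y. \<rho> (w i y)) g"
    if g: "g \<in> germs ?Y (regular ?Y) x" for g
  proof -
    have "(\<lambda>y. g y ^ q) \<in> \<O>"
      using g unfolding germs_def by (auto simp: regular_frob_root q_def)
    from w[OF this] obtain c where "(\<lambda>y. g y ^ q - (\<Sum>i<q ^ d. c i * w i y)) \<in> frobenius_power q"
      unfolding in_span_mod_def by blast
    from root_frobenius_power[OF \<rho> root(1) R this]
    have "(\<lambda>y. g y - (\<Sum>i<q ^ d. \<rho> (c i) * \<rho> (w i y))) \<in> fibre_ideal X e x"
      unfolding fibre_ideal_def by (simp only: field_automorphismD[OF \<rho>] root)
    then have "in_span_mod (fibre_ideal X e x) (q ^ d) (\<lambda>i y. \<rho> (w i y)) g" by (rule in_span_modI)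
    then show ?thesis by (simp add: fibre_length_def q_def d_def power_mult)
  qed
  then show ?thesis by (rule that)
qed

text \<open>Converts an element given by generators into a finite sum over one common neighbourhood,
  the form in which \<open>scheme_preimage\<close> is defined.\<close>

lemma fibre_ideal_repr:
  fixes X :: "('a, 'k::alg_closed_field) fspace"
  assumes p: "CHAR('k) > 0" and X: "space_with_functions X" and x: "x \<in> points X"
    and f: "f \<in> fibre_ideal X e x"
  shows "\<exists>V (m::nat) a t. openin (zariski X) V \<and> x \<in> V \<and>
     (\<forall>i<m. a i \<in> regular (frob_root X e) V \<and> t i \<in> point_ideal X x V) \<and> (\<forall>y\<in>V. f y = (\<Sum>i<m. a i y * t i y))"
  using f unfolding fibre_ideal_def
proof induction
  case zero
  show ?case using x by (intro exI[of _ "points X"] exI[of _ 0]) simp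
next
  case (step r s f)
  let ?Y = "frob_root X e"
  note Y = space_with_functions_frob_root[OF p X, of e]
  from step(4) obtain V m a t where V: "openin (zariski X) V" "x \<in> V"
    "\<And>i. i < (m::nat) \<Longrightarrow> a i \<in> regular ?Y V" "\<And>i. i < m \<Longrightarrow> t i \<in> point_ideal X x V"
    "\<And>y. y \<in> V \<Longrightarrow> f y = (\<Sum>i<m. a i y * t i y)" by blast
  obtain V' where V': "openin (zariski X) V'" "x \<in> V'" "r \<in> regular ?Y V'" using step(1) by (auto elim: germsE)
  obtain V2 u where V2: "openin (zariski X) V2" "x \<in> V2" "u \<in> point_ideal X x V2" "\<And>y. y \<in> V2 \<Longrightarrow> s y = u y"
  proof (cases "s \<in> zero_germs X x")
    case True
    then obtain W where "openin (zariski X) W" "x \<in> W" "\<And>y. y \<in> W \<Longrightarrow> s y = 0" unfolding zero_germs_def by blast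
    then show ?thesis using that[of W "\<lambda>_. 0"] regular_const[OF X] by (simp add: point_ideal_def)
  next
    case False
    then have "s \<in> max_ideal_at X x" using step by blast
    then obtain W where "openin (zariski X) W" "x \<in> W" "s \<in> regular X W" "s x = 0" unfolding max_ideal_at_def by blast
    then show ?thesis using that[of W s] by (simp add: point_ideal_def)
  qed
  define D where "D = V \<inter> V' \<inter> V2"
  have D: "openin (zariski X) D" "x \<in> D" "D \<subseteq> V" "D \<subseteq> V'" "D \<subseteq> V2" using V V' V2 by (auto simp: D_def)
  have pr: "g \<in> point_ideal X x D" if "g \<in> point_ideal X x W" "openin (zariski X) W" "D \<subseteq> W" for g W
    using that D regular_restrict[OF X that(2) D(1) that(3)] by (auto simp: point_ideal_def)
  have yr: "g \<in> regular ?Y D" if "g \<in> regular ?Y W" "openin (zariski X) W" "D \<subseteq> W" for g W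
    using that D regular_restrict[OF Y, of W D g] by simp
  show ?case
  proof (rule exI[of _ D], rule exI[of _ "Suc m"], rule exI[of _ "a(m := r)"], rule exI[of _ "t(m := u)"],
      intro conjI D(1,2) allI impI ballI)
    fix i assume "i < Suc m"
    then show "(a(m := r)) i \<in> regular ?Y D" "(t(m := u)) i \<in> point_ideal X x D"
      using yr[OF V(3) V(1) D(3)] yr[OF V'(3,1) D(4)] pr[OF V(4) V(1) D(3)] pr[OF V2(3,1) D(5)]
      by (auto simp: less_Suc_eq)
  next
    fix y assume "y \<in> D"
    then show "r y * s y + f y = (\<Sum>i<Suc m. (a(m := r)) i y * (t(m := u)) i y)"
      using V(5)[of y] V2(4)[of y] by (auto simp: D_def intro!: sum.cong)
  qed
qed

lemma fibre_ideal_subset: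
  assumes Y: "space_with_functions (frob_root X e)" and J: "closed_subscheme (frob_root X e) J"
    and M: "max_ideal_at X x \<subseteq> germs (frob_root X e) J x" and x: "x \<in> points X"
  shows "fibre_ideal X e x \<subseteq> germs (frob_root X e) J x"
proof
  let ?Y = "frob_root X e"
  have W: "linear_subset (germs ?Y J x)" by (rule linear_subset_germs_ideal[OF Y J]) (use x in simp)
  fix f assume "f \<in> fibre_ideal X e x"
  then show "f \<in> germs ?Y J x" unfolding fibre_ideal_def
  proof induction
    case zero then show ?case by (rule linear_subset_zero[OF W])
  next
    case (step r s f)
    have "s \<in> germs ?Y J x"
    proof (cases "s \<in> zero_germs X x")
      case True
      then obtain V where "openin (zariski X) V" "x \<in> V" "\<And>y. y \<in> V \<Longrightarrow> s y = 0" unfolding zero_germs_def by blast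
      then show ?thesis using closed_subschemeD(3)[OF J] by (intro germsI[of ?Y V]) auto
    qed (use step M in blast)
    from linear_subset_add[OF W germs_ideal_mult[OF Y J step(1) this] step(4)] show ?case .
  qed
qed

lemma max_ideal_subset_germs:
  assumes "scheme_image X J = point_ideal X x"
  shows "max_ideal_at X x \<subseteq> germs (frob_root X e) J x"
proof
  fix t assume "t \<in> max_ideal_at X x"
  then obtain V where V: "openin (zariski X) V" "x \<in> V" "t \<in> regular X V" "t x = 0" unfolding max_ideal_at_def by blast
  then have "t \<in> point_ideal X x V" by (simp add: point_ideal_def)
  then have "t \<in> scheme_image X J V" by (simp add: assms)
  then show "t \<in> germs (frob_root X e) J x" using V by (intro germsI) (simp_all add: scheme_image_def)
qed

lemma linear_subset_fibre_ideal:
  fixes X :: "('a, 'k::alg_closed_field) fspace"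
  assumes "CHAR('k) > 0" "space_with_functions X" "x \<in> points X"
  shows "linear_subset (fibre_ideal X e x)"
  unfolding fibre_ideal_def using space_with_functions_frob_root[OF assms(1,2), of e] assms(3)
  by (intro linear_subset_ideal_gen stalk_mult stalk_const) auto

text \<open>The ideal of \<open>J\<close> contains the fibre ideal because the image is the reduced
  point. The chart gives as many sections independent modulo \<open>J\<close> as there are elements
  spanning modulo the fibre ideal, so the two ideals have the same germs at
  \<open>x\<close>.\<close>

lemma fat_point_over_smooth_point:
  fixes X :: "('a, 'k::alg_closed_field) fspace"
  assumes p: "CHAR('k) > 0" and X: "variety X" and x: "smooth_at X x"
    and J: "J \<in> hilb_chart (frob_root X e) (fibre_length X e) U b"
    and s: "support (frob_root X e) J = {x}" and im: "scheme_image X J = point_ideal X x"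
  shows "J = frob_fibre X e x"
proof -
  let ?Y = "frob_root X e" and ?n = "fibre_length X e" and ?F = "fibre_ideal X e x"
  note sX = varietyD(1)[OF X]
  note Y = space_with_functions_frob_root[OF p sX, of e]
  have xp: "x \<in> points X" using x unfolding smooth_at_def by blast
  have cl: "closed_subscheme ?Y J" using J unfolding hilb_chart_def by simp
  note FJ = fibre_ideal_subset[OF Y cl max_ideal_subset_germs[OF im] xp]
  note W = linear_subset_fibre_ideal[OF p sX xp, of e]
  have b: "x \<in> U" "openin (zariski X) U" "\<And>i. i < ?n \<Longrightarrow> b i \<in> regular ?Y U" "independent_mod (germs ?Y J x) ?n b"
    using J affine_openD(1) unfolding hilb_chart_iff_stalk[OF Y cl s] by fastforce+
  obtain w where w: "\<And>g. g \<in> germs ?Y (regular ?Y) x \<Longrightarrow> in_span_mod ?F ?n w g"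
    using smooth_fibre_spanned[OF p X x] by blast
  have bst: "b i \<in> germs ?Y (regular ?Y) x" if "i < ?n" for i
    using b that by (intro germsI[of ?Y U]) auto
  have JF: "germs ?Y J x \<subseteq> ?F"
  proof
    fix f assume f: "f \<in> germs ?Y J x"
    then have "f \<in> germs ?Y (regular ?Y) x"
      using closed_subschemeD(2)[OF cl] by (auto elim!: germsE intro: germsI)
    \<comment> \<open>The \<open>b i\<close> are independent modulo the smaller ideal too and
      therefore span modulo it; the coordinates of \<open>f\<close> then form a relation modulo
      \<open>J\<close> and vanish.\<close>
    then have "in_span_mod ?F ?n b f"
      using independent_mod_spans[OF W independent_mod_mono[OF b(4) FJ], of w f] w bst by blast
    then obtain c where c: "(\<lambda>y. f y - (\<Sum>i<?n. c i * b i y)) \<in> ?F" unfolding in_span_mod_def by blast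
    have WJ: "linear_subset (germs ?Y J x)" by (rule linear_subset_germs_ideal[OF Y cl]) (use xp in simp)
    have "(\<lambda>y. f y - (f y - (\<Sum>i<?n. c i * b i y))) \<in> germs ?Y J x"
      using linear_subset_diff[OF WJ f] c FJ by blast
    then have "(\<lambda>y. \<Sum>i<?n. c i * b i y) \<in> germs ?Y J x" by simp
    then have "c i = 0" if "i < ?n" for i using independent_modD[OF b(4) _ that] by blast
    then show "f \<in> ?F" using c by simp
  qed
  show ?thesis
  proof (rule ext)
    fix V
    show "J V = frob_fibre X e x V"
    proof (cases "openin (zariski X) V")
      case True
      have "f \<in> frob_fibre X e x V" if f: "f \<in> J V" for f
      proof -
        have fr: "f \<in> regular ?Y V" using closed_subschemeD(2)[OF cl f] .
        have "\<exists>W (m::nat) a t. openin (zariski X) W \<and> y \<in> W \<and> W \<subseteq> V \<and>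
          (\<forall>i<m. a i \<in> regular ?Y W \<and> t i \<in> point_ideal X x W) \<and> (\<forall>z\<in>W. f z = (\<Sum>i<m. a i z * t i z))"
          if y: "y \<in> V" for y
        proof (cases "y = x")
          case True
          then have "f \<in> ?F" using JF germsI[of ?Y V x f J] f y \<open>openin (zariski X) V\<close> by auto
          from fibre_ideal_repr[OF p sX xp this] obtain W m a t where W: "openin (zariski X) W" "x \<in> W"
            "\<And>i. i < (m::nat) \<Longrightarrow> a i \<in> regular ?Y W" "\<And>i. i < m \<Longrightarrow> t i \<in> point_ideal X x W"
            "\<And>y. y \<in> W \<Longrightarrow> f y = (\<Sum>i<m. a i y * t i y)" by blast
          have WV: "openin (zariski X) (W \<inter> V)" using W \<open>openin (zariski X) V\<close> by blast
          show ?thesis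
          proof (rule exI[of _ "W \<inter> V"], rule exI[of _ m], rule exI[of _ a], rule exI[of _ t],
              intro conjI allI impI ballI WV)
            show "y \<in> W \<inter> V" using W y True by simp
            fix i assume i: "i < m"
            show "a i \<in> regular ?Y (W \<inter> V)" using regular_restrict[OF Y _ _ _ W(3)[OF i]] W(1) WV by simp
            show "t i \<in> point_ideal X x (W \<inter> V)"
              using regular_restrict[OF sX W(1) WV _ ] W(1) W(4)[OF i] WV by (auto simp: point_ideal_def)
          qed (use W in auto)
        next
          case False
          \<comment> \<open>Away from \<open>x\<close> both ideals are the unit ideal: on a
            neighbourhood avoiding \<open>x\<close> the constant 1 belongs to the point ideal, and
            \<open>f = f * 1\<close> is the required expression.\<close>
          then have "y \<notin> support ?Y J" using s by simp
          then obtain W where W: "openin (zariski X) W" "y \<in> W" "(\<lambda>_. 1) \<in> J W"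
            using openin_points[OF True y] unfolding support_def by auto
          have "x \<notin> W" using s W unfolding support_def by auto
          have WV: "openin (zariski X) (W \<inter> V)" using W True by blast
          then have "(\<lambda>_. 1) \<in> point_ideal X x (W \<inter> V)"
            using \<open>x \<notin> W\<close> regular_const[OF sX] by (simp add: point_ideal_def)
          moreover have "f \<in> regular ?Y (W \<inter> V)" using regular_restrict[OF Y _ _ _ fr] WV True by simp
          ultimately show ?thesis using W y WV
            by (intro exI[of _ "W \<inter> V"] exI[of _ "1::nat"] exI[of _ "\<lambda>_. f"] exI[of _ "\<lambda>_ _. 1"]) auto
        qed
        then show ?thesis using fr True by (auto simp: frob_fibre_def scheme_preimage_def)
      qed
      moreover have "f \<in> J V" if f: "f \<in> frob_fibre X e x V" for f
      proof (rule ideal_local[OF cl])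
        show "openin (zariski ?Y) V" using True by simp
        fix y assume "y \<in> V"
        have "\<forall>y\<in>V. \<exists>W (m::nat) a t. openin (zariski X) W \<and> y \<in> W \<and> W \<subseteq> V \<and>
          (\<forall>i<m. a i \<in> regular ?Y W \<and> t i \<in> point_ideal X x W) \<and> (\<forall>z\<in>W. f z = (\<Sum>i<m. a i z * t i z))"
          using f True by (simp add: frob_fibre_def scheme_preimage_def)
        from bspec[OF this \<open>y \<in> V\<close>] obtain W m a t where W: "openin (zariski X) W" "y \<in> W"
            "\<And>i. i < (m::nat) \<Longrightarrow> a i \<in> regular ?Y W" "\<And>i. i < m \<Longrightarrow> t i \<in> point_ideal X x W"
            "\<And>y. y \<in> W \<Longrightarrow> f y = (\<Sum>i<m. a i y * t i y)" by blast
        have "(\<lambda>y. a i y * t i y) \<in> J W" if "i < m" for i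
          using W(4)[OF that] W(1) unfolding im[symmetric]
          by (intro closed_subschemeD(5)[OF cl W(3)[OF that]]) (simp add: scheme_image_def)
        then have "(\<lambda>y. \<Sum>i<m. 1 * (a i y * t i y)) \<in> J W"
          using linear_subset_sum[OF linear_subset_ideal[OF Y cl], of W "{..<m}" "\<lambda>i y. a i y * t i y" "\<lambda>_. 1"] W(1)
          by simp
        then have "f \<in> J W" by (rule ideal_cong[OF cl]) (simp add: W(5))
        then show "\<exists>V. y \<in> V \<and> f \<in> J V" using W by blast
      qed
      ultimately show ?thesis by blast
    next
      case False
      then have "J V = {}" using closed_subschemeD(1)[OF cl] by fastforce
      then show ?thesis using False by (simp add: frob_fibre_def scheme_preimage_def)
    qed
  qed
qed

section \<open>Scheme-theoretic images of fat points\<close>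

text \<open>The support asks where 1 lies in the ideal, and 1 is a section at every level.\<close>

lemma support_scheme_image:
  fixes X :: "('a, 'k::alg_closed_field) fspace"
  assumes p: "CHAR('k) > 0" and X: "space_with_functions X"
  shows "support (frob_root X e) (scheme_image (frob_root X e) Z) = support (frob_root X e') Z"
  using regular_const[OF space_with_functions_frob_root[OF p X, of e], of _ 1]
  unfolding support_def scheme_image_def by auto

lemma scheme_image_scheme_image:
  fixes X :: "('a, 'k::alg_closed_field) fspace"
  assumes X: "space_with_functions X"
  shows "scheme_image X (scheme_image (frob_root X e) Z) = scheme_image X Z"
  using regular_frob_root_mono(1)[OF X, of _ e] by (auto simp: scheme_image_def fun_eq_iff)

lemma germs_scheme_image:
  assumes zar: "zariski Y = zariski Y'" and Y: "space_with_functions Y" and Z: "closed_subscheme Y' Z"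
  shows "germs Y (scheme_image Y Z) x = germs Y' Z x \<inter> germs Y (regular Y) x"
proof (intro set_eqI iffI)
  fix f assume "f \<in> germs Y (scheme_image Y Z) x"
  then show "f \<in> germs Y' Z x \<inter> germs Y (regular Y) x"
    unfolding germs_def scheme_image_def using zar by auto
next
  fix f assume f: "f \<in> germs Y' Z x \<inter> germs Y (regular Y) x"
  then obtain V where V: "openin (zariski Y) V" "x \<in> V" "f \<in> Z V" unfolding germs_def using zar by auto
  obtain V' where V': "openin (zariski Y) V'" "x \<in> V'" "f \<in> regular Y V'" using f unfolding germs_def by auto
  have "openin (zariski Y) (V \<inter> V')" using V V' by blast
  moreover have "f \<in> Z (V \<inter> V')" by (rule ideal_restrict[OF Z V(3)]) (use calculation zar in auto)
  moreover have "f \<in> regular Y (V \<inter> V')" by (rule regular_restrict[OF Y V'(1) _ _ V'(3)]) (use calculation in auto)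
  ultimately show "f \<in> germs Y (scheme_image Y Z) x"
    using V V' by (intro germsI[of Y "V \<inter> V'"]) (auto simp: scheme_image_def)
qed

text \<open>The extension clause of \<open>closed_subscheme\<close>, stated for the structure sheaf.
  The image of a closed subscheme borrows it from \<open>Y\<close> in order to satisfy that clause
  itself.\<close>

definition sections_extend :: "('a, 'k::field) fspace \<Rightarrow> bool" where
  "sections_extend Y \<longleftrightarrow> (\<forall>U h f. affine_open Y U \<longrightarrow> h \<in> regular Y U \<longrightarrow> f \<in> regular Y {x \<in> U. h x \<noteq> 0} \<longrightarrow>
     (\<exists>g\<in>regular Y U. \<exists>N::nat. \<forall>x\<in>U. h x \<noteq> 0 \<longrightarrow> g x = h x ^ N * f x))"

text \<open>In general this amounts to Hilbert's Nullstellensatz. A fat point \<open>J\<close> on \<open>Y\<close> gives a shortcut: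
  modulo \<open>J\<close>, which satisfies the claim by quasi-coherence, every section on \<open>D(h)\<close> comes from \<open>U\<close>.\<close>

lemma sections_extend_if_fat_point:
  assumes Y: "space_with_functions Y" and J: "J \<in> hilb_chart Y n U0 b" and s: "support Y J = {x}"
  shows "sections_extend Y"
  unfolding sections_extend_def
proof (intro allI impI)
  fix U h f assume U: "affine_open Y U" and h: "h \<in> regular Y U" and f: "f \<in> regular Y {x \<in> U. h x \<noteq> 0}"
  define D where "D = {x \<in> U. h x \<noteq> 0}"
  note o = affine_openD(1)[OF U]
  have D: "openin (zariski Y) D" "D \<subseteq> U" using regular_nonzero_open[OF Y o h] by (auto simp: D_def)
  have cl: "closed_subscheme Y J" using J unfolding hilb_chart_def by simp
  have iff: "f \<in> J V \<longleftrightarrow> f \<in> regular Y V \<and> (x \<in> V \<longrightarrow> f \<in> germs Y J x)" if "openin (zariski Y) V" for f V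
    using ideal_iff_germs[OF Y cl _ that] s by blast
  show "\<exists>g\<in>regular Y U. \<exists>N::nat. \<forall>x\<in>U. h x \<noteq> 0 \<longrightarrow> g x = h x ^ N * f x"
  proof (cases "x \<in> D")
    case False
    \<comment> \<open>If \<open>D\<close> misses the support, the ideal contains all sections over
      \<open>D\<close>, so its own extension clause applies to \<open>f\<close> directly.\<close>
    then have "f \<in> J {x \<in> U. h x \<noteq> 0}" using f iff[OF D(1)] unfolding D_def by blast
    from closed_subschemeD(7)[OF cl U h this] show ?thesis using closed_subschemeD(2)[OF cl] by blast
  next
    case True
    then have xU: "x \<in> U" using D by blast
    have st: "v \<in> germs Y (regular Y) x" if "v \<in> regular Y V" "openin (zariski Y) V" "x \<in> V" for v V
      using that by (intro germsI)
    have "\<exists>g\<in>regular Y U. (\<lambda>y. f y - g y) \<in> germs Y J x"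
    proof (rule stalk_section_mod_ideal[OF Y cl U xU])
      show "in_span_mod (germs Y J x) n b v" if "v \<in> regular Y U" for v
        using J st[OF that o xU] unfolding hilb_chart_iff_stalk[OF Y cl s] by blast
      show "f \<in> germs Y (regular Y) x" using st[of f D] f D True unfolding D_def by blast
    qed
    then obtain g where g: "g \<in> regular Y U" "(\<lambda>y. f y - g y) \<in> germs Y J x" by blast
    have "(\<lambda>y. f y - g y) \<in> regular Y D"
      using linear_subset_diff[OF linear_subset_regular[OF Y D(1)]] f regular_restrict[OF Y o D g(1)]
      unfolding D_def by blast
    then have "(\<lambda>y. f y - g y) \<in> J {x \<in> U. h x \<noteq> 0}" using iff[OF D(1)] g(2) unfolding D_def by blast
    from closed_subschemeD(7)[OF cl U h this] obtain j N where
      j: "j \<in> J U" "\<And>x. x \<in> U \<Longrightarrow> h x \<noteq> 0 \<Longrightarrow> j x = h x ^ N * (f x - g x)" by blast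
    have "(\<lambda>y. h y ^ N * g y + j y) \<in> regular Y U"
      using regular_add[OF Y o regular_mult[OF Y o regular_power[OF Y o h] g(1)] closed_subschemeD(2)[OF cl j(1)]] .
    then show ?thesis
      by (rule bexI[rotated]) (intro exI[of _ N], simp add: j algebra_simps)
  qed
qed

text \<open>The delicate clause is extension from \<open>D(h)\<close>: quasi-coherence of
  \<open>Z\<close> yields an extension \<open>g1\<close> in the ideal but regular merely on
  \<open>Y'\<close>, while \<open>ext\<close> yields \<open>g2\<close> regular on \<open>Y\<close>
  but perhaps outside the ideal. Suitable powers of \<open>h\<close> make them agree.\<close>

lemma closed_subscheme_scheme_image:
  assumes zar: "zariski Y = zariski Y'" and Y: "space_with_functions Y"
    and sub: "\<And>U. openin (zariski Y) U \<Longrightarrow> regular Y U \<subseteq> regular Y' U"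
    and aff: "\<And>U. affine_open Y U \<Longrightarrow> affine_open Y' U"
    and Z: "closed_subscheme Y' Z" and ext: "sections_extend Y"
  shows "closed_subscheme Y (scheme_image Y Z)"
proof -
  note ZD = closed_subschemeD[OF Z, folded zar]
  show ?thesis
    unfolding closed_subscheme_def
  proof (intro conjI allI impI)
    show "\<not> openin (zariski Y) U \<Longrightarrow> scheme_image Y Z U = {}"
      and "openin (zariski Y) U \<Longrightarrow> scheme_image Y Z U \<subseteq> regular Y U" for U
      by (auto simp: scheme_image_def)
    show "f \<in> scheme_image Y Z U" if "openin (zariski Y) U" "\<forall>x\<in>U. f x = 0" for U f
      using that ZD(3) swf_cong[OF Y that(1) regular_const[OF Y that(1), of 0], of f]
      by (simp add: scheme_image_def)
    show "(\<lambda>x. f x + g x) \<in> scheme_image Y Z U"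
      if "openin (zariski Y) U" "f \<in> scheme_image Y Z U" "g \<in> scheme_image Y Z U" for U f g
      using that ZD(4) regular_add[OF Y] by (simp add: scheme_image_def)
    show "(\<lambda>x. f x * g x) \<in> scheme_image Y Z U"
      if "openin (zariski Y) U" "f \<in> regular Y U" "g \<in> scheme_image Y Z U" for U f g
      using that ZD(5)[of f U g] regular_mult[OF Y that(1,2)] sub[OF that(1)] by (auto simp: scheme_image_def)
    show "f \<in> scheme_image Y Z (\<Union>\<U>) \<longleftrightarrow> (\<forall>U\<in>\<U>. f \<in> scheme_image Y Z U)"
      if "\<forall>U\<in>\<U>. openin (zariski Y) U" for \<U> f
    proof -
      have o: "openin (zariski Y) (\<Union>\<U>)" using that by blast
      have "f \<in> regular Y (\<Union>\<U>) \<longleftrightarrow> (\<forall>U\<in>\<U>. f \<in> regular Y U)"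
        using regular_restrict[OF Y o, of _ f] regular_local[OF Y o, of f] that by blast
      then show ?thesis using ZD(6)[of \<U> f] that o by (auto simp: scheme_image_def)
    qed
  next
    fix U h f assume U: "affine_open Y U" and h: "h \<in> regular Y U"
      and f: "f \<in> scheme_image Y Z {x \<in> U. h x \<noteq> 0}"
    note o = affine_openD(1)[OF U]
    have D: "openin (zariski Y) {x \<in> U. h x \<noteq> 0}" by (rule regular_nonzero_open[OF Y o h])
    have h': "h \<in> regular Y' U" using sub[OF o] h by blast
    have fD: "f \<in> Z {x \<in> U. h x \<noteq> 0}" "f \<in> regular Y {x \<in> U. h x \<noteq> 0}"
      using f D by (simp_all add: scheme_image_def)
    obtain g1 N where g1: "g1 \<in> Z U" "\<And>x. x \<in> U \<Longrightarrow> h x \<noteq> 0 \<Longrightarrow> g1 x = h x ^ N * f x"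
      using ZD(7)[OF aff[OF U] h' fD(1)] by blast
    obtain g2 M where g2: "g2 \<in> regular Y U" "\<And>x. x \<in> U \<Longrightarrow> h x \<noteq> 0 \<Longrightarrow> g2 x = h x ^ M * f x"
      using ext[unfolded sections_extend_def, rule_format, OF U h fD(2)] by blast
    \<comment> \<open>The exponents \<open>Suc M\<close> and \<open>Suc N\<close> are positive so
      that both products vanish where \<open>h\<close> does; elsewhere on \<open>U\<close> both
      equal \<open>h ^ (N + M + 1) * f\<close>.\<close>
    have "(\<lambda>x. h x ^ Suc M * g1 x) \<in> Z U"
      by (rule ZD(5)[OF _ g1(1)]) (use regular_power[OF Y o h, of "Suc M"] sub[OF o] in blast)
    then have "(\<lambda>x. h x ^ Suc N * g2 x) \<in> Z U"
    proof (rule ideal_cong[OF Z])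
      fix x assume "x \<in> U"
      then show "h x ^ Suc N * g2 x = h x ^ Suc M * g1 x"
        using g1(2) g2(2) by (cases "h x = 0") (auto simp: algebra_simps)
    qed
    moreover have "(\<lambda>x. h x ^ Suc N * g2 x) \<in> regular Y U"
      using regular_mult[OF Y o regular_power[OF Y o h] g2(1)] .
    ultimately have "(\<lambda>x. h x ^ Suc N * g2 x) \<in> scheme_image Y Z U" using o by (simp add: scheme_image_def)
    then show "\<exists>g\<in>scheme_image Y Z U. \<exists>N. \<forall>x\<in>U. h x \<noteq> 0 \<longrightarrow> g x = h x ^ N * f x"
      by (rule bexI[rotated]) (intro exI[of _ "Suc N + M"], simp add: g2 power_add algebra_simps)
  qed
qed

section \<open>The rational map\<close>

lemma regular_FB:
  "h \<in> regular (FB X e) W \<longleftrightarrow> (\<forall>I\<in>W. \<exists>V U b.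
     \<exists>P\<in>hilb_coords (frob_root X e) (fibre_length X e) U b.
     \<exists>Q\<in>hilb_coords (frob_root X e) (fibre_length X e) U b.
       openin (zariski (FB X e)) V \<and> I \<in> V \<and> V \<subseteq> W \<inter> hilb_chart (frob_root X e) (fibre_length X e) U b \<and>
       (\<forall>J\<in>V. Q J \<noteq> 0 \<and> h J = P J / Q J))"
  by (simp add: FB_def hilb_subvariety_def)

lemma zariski_FB: "zariski (FB X e) =
    subtopology (hilb_topology (frob_root X e) (fibre_length X e)) (FB_points X e)"
  by (simp add: FB_def hilb_subvariety_def)

lemma open_subspace_simps [simp]:
  "zariski (open_subspace X U) = subtopology (zariski X) U" "regular (open_subspace X U) = regular X"
  by (simp_all add: open_subspace_def)

lemma FB_points_subset: "FB_points X e \<subseteq> topspace (hilb_topology (frob_root X e) (fibre_length X e))"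
  unfolding FB_points_def by (rule closure_of_subset_topspace)

lemma points_FB: "points (FB X e) = FB_points X e"
  using FB_points_subset[of X e] by (auto simp: zariski_FB)

lemma FB_points_memI:
  assumes "smooth_at X x" "frob_fibre X e x \<in> hilb_chart (frob_root X e) (fibre_length X e) U b"
  shows "frob_fibre X e x \<in> FB_points X e"
  using assms unfolding FB_points_def in_closure_of topspace_hilb by blast

locale FB_step =
  fixes X :: "('a, 'k::alg_closed_field) fspace" and e :: nat
  assumes char: "CHAR('k) > 0" and X: "variety X" and ext: "sections_extend (frob_root X e)"
begin

abbreviation "Y \<equiv> frob_root X e"
abbreviation "Y' \<equiv> frob_root X (Suc e)"
abbreviation "n \<equiv> fibre_length X e"
abbreviation "n' \<equiv> fibre_length X (Suc e)"
abbreviation "img \<equiv> scheme_image Y"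

lemmas sX = varietyD(1)[OF X]
lemmas sY = space_with_functions_frob_root[OF char sX, of e]
lemmas sY' = space_with_functions_frob_root[OF char sX, of "Suc e"]

lemma n_le: "n \<le> n'"
  using char by (simp add: fibre_length_def power_increasing)

lemma affine_iff: "affine_open Y' U \<longleftrightarrow> affine_open Y U"
  using affine_open_frob_root[OF char] by blast

lemma regular_sub: "openin (zariski X) U \<Longrightarrow> regular Y U \<subseteq> regular Y' U"
  by (rule regular_frob_root_mono(2)[OF sX])

lemma img_closed: "closed_subscheme Y' I \<Longrightarrow> closed_subscheme Y (img I)"
  by (rule closed_subscheme_scheme_image[OF _ sY _ _ _ ext]) (use regular_sub affine_iff in auto)

text \<open>The ideal of the fibre at level \<open>Suc e\<close> contains the fibre ideal of level
  \<open>e\<close>, modulo which sections of \<open>Y\<close> are spanned by \<open>n\<close>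
  elements. The \<open>b i\<close> are \<open>n\<close> independent ones, so they span.\<close>

lemma spanned_on_frob_fibre:
  assumes y: "smooth_at X y" and I: "frob_fibre X (Suc e) y \<in> hilb_chart Y' n' U b'"
    and b: "\<And>i. i < n \<Longrightarrow> b' i = b i" "\<And>i. i < n \<Longrightarrow> b i \<in> regular Y U" and v: "v \<in> regular Y U"
  shows "in_span_mod (frob_fibre X (Suc e) y U) n b v"
proof -
  let ?I = "frob_fibre X (Suc e) y"
  have yp: "y \<in> points X" using y unfolding smooth_at_def by blast
  have cl: "closed_subscheme Y' ?I" using I unfolding hilb_chart_def by simp
  obtain x where x: "support Y' ?I = {x}" "scheme_image X ?I = point_ideal X x"
    using FB_point_fat_point[OF char X FB_points_memI[OF y I]] by blast
  then have xy: "x = y" using frob_fibre_point_in_support[OF yp, of "Suc e"] by auto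
  note chart = I[unfolded hilb_chart_iff_stalk[OF sY' cl x(1)], unfolded xy]
  have U: "openin (zariski X) U" "y \<in> U" using chart affine_openD(1)[of Y' U] by auto
  note img = img_closed[OF cl]
  have W: "linear_subset (germs Y' ?I y)" by (rule linear_subset_germs_ideal[OF sY' cl]) (use yp in simp)
  have sub: "fibre_ideal X e y \<subseteq> germs Y' ?I y"
    using fibre_ideal_subset[OF sY img max_ideal_subset_germs yp] x(2) xy
      scheme_image_scheme_image[OF sX, of e ?I] germs_scheme_image[OF _ sY cl, of y]
    by simp
  obtain w where w: "\<And>g. g \<in> germs Y (regular Y) y \<Longrightarrow> in_span_mod (fibre_ideal X e y) n w g"
    using smooth_fibre_spanned[OF char X y] by blast
  have sp: "in_span_mod (germs Y' ?I y) n w g" if "g \<in> regular Y U" for g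
    by (rule in_span_mod_mono[OF w sub]) (use that U in \<open>auto intro: germsI[of Y U]\<close>)
  have "independent_mod (germs Y' ?I y) n b'" using chart independent_mod_le[OF _ n_le] by blast
  then have "independent_mod (germs Y' ?I y) n b" using independent_mod_cong[of n b' b] b(1) by blast
  from independent_mod_spans[OF W this sp sp[OF v]] b(2)
  obtain c where c: "(\<lambda>y. v y - (\<Sum>i<n. c i * b i y)) \<in> germs Y' ?I y" unfolding in_span_mod_def by blast
  have "(\<lambda>y. v y - (\<Sum>i<n. c i * b i y)) \<in> regular Y U"
    using v b(2) sY U(1)
    by (intro linear_subset_diff linear_subset_regular regular_sum regular_mult regular_const) simp_all
  then have "(\<lambda>y. v y - (\<Sum>i<n. c i * b i y)) \<in> ?I U"
    using ideal_iff_germs[OF sY' cl, of y U] x(1) xy U(1) regular_sub[OF U(1)] c by auto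
  then show ?thesis by (rule in_span_modI)
qed

text \<open>Both parts rest on one expansion: modulo \<open>I\<close> a section of \<open>Y\<close>
  involves only the first \<open>n\<close> basis elements, and the remainder is again a section of
  \<open>Y\<close>, hence lies in the image ideal.\<close>

lemma image_in_chart:
  assumes b: "\<And>i. i < n \<Longrightarrow> b' i = b i" "\<And>i. i < n \<Longrightarrow> b i \<in> regular Y U"
    and I: "I \<in> FB_points X (Suc e)" "I \<in> hilb_chart Y' n' U b'"
  shows "img I \<in> hilb_chart Y n U b"
    and "v \<in> regular Y U \<Longrightarrow> i < n \<Longrightarrow> coord_mod (img I U) n b v i = coord_mod (I U) n' b' v i"
proof -
  have cl: "closed_subscheme Y' I" and s: "support Y' I \<subseteq> U" and aff: "affine_open Y' U"
    and B: "basis_mod (regular Y' U) (I U) n' b'" using I unfolding hilb_chart_def by auto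
  have o: "openin (zariski X) U" "openin (zariski Y) U" "openin (zariski Y') U" using affine_openD(1)[OF aff] by auto
  note W' = linear_subset_ideal[OF sY' cl o(3)]
  note B = basis_modD[OF W' regular_const[OF sY' o(3)] B]
  note img = img_closed[OF cl]
  note W = linear_subset_ideal[OF sY img o(2)]
  have imgU: "img I U = I U \<inter> regular Y U" using o by (simp add: scheme_image_def)
  have "independent_mod (I U) n b" using independent_mod_le[OF B(3) n_le] independent_mod_cong[of n b' b] b(1) by blast
  then have ind: "independent_mod (img I U) n b" by (rule independent_mod_mono) (simp add: imgU)
  have coords: "(\<lambda>y. v y - (\<Sum>i<n. coord_mod (I U) n' b' v i * b i y)) \<in> img I U" if v: "v \<in> regular Y U" for v
  proof -
    have v': "v \<in> regular Y' U" using regular_sub[OF o(1)] v by blast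
    \<comment> \<open>On smooth fibres these coordinates vanish by
      \<open>spanned_on_frob_fibre\<close> and uniqueness of coordinates; density carries this to
      \<open>I\<close>.\<close>
    have van: "coord_mod (I U) n' b' v i = 0" if i: "n \<le> i" "i < n'" for i
    proof (rule FB_points_coord_eq[OF I hilb_coords_coord[OF v' i(2)]])
      fix y assume y: "smooth_at X y" and I0: "frob_fibre X (Suc e) y \<in> hilb_chart Y' n' U b'"
      let ?I = "frob_fibre X (Suc e) y"
      obtain c where c: "(\<lambda>x. v x - (\<Sum>i<n. c i * b i x)) \<in> ?I U"
        using spanned_on_frob_fibre[OF y I0 b v] unfolding in_span_mod_def by blast
      have "(\<Sum>i<n'. (if i < n then c i else 0) * b' i x) = (\<Sum>i<n. c i * b i x)" for x
        using n_le b(1) by (intro sum.mono_neutral_cong_right) auto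
      then have c': "(\<lambda>x. v x - (\<Sum>i<n'. (if i < n then c i else 0) * b' i x)) \<in> ?I U" using c by simp
      have cl0: "closed_subscheme Y' ?I" "basis_mod (regular Y' U) (?I U) n' b'"
        using I0 unfolding hilb_chart_def by auto
      note W0 = linear_subset_ideal[OF sY' cl0(1) o(3)]
      from coord_mod_eqI[OF W0 basis_modD(3)[OF W0 regular_const[OF sY' o(3)] cl0(2)] c' i(2)]
      show "coord_mod (?I U) n' b' v i = 0" using i by simp
    qed
    have "(\<Sum>i<n'. coord_mod (I U) n' b' v i * b' i x) = (\<Sum>i<n. coord_mod (I U) n' b' v i * b i x)" for x
      using n_le b(1) van by (intro sum.mono_neutral_cong_right) auto
    then have "(\<lambda>y. v y - (\<Sum>i<n. coord_mod (I U) n' b' v i * b i y)) \<in> I U"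
      using coord_mod_in[OF W' B(3) B(2)[OF v']] by simp
    moreover have "(\<lambda>y. v y - (\<Sum>i<n. coord_mod (I U) n' b' v i * b i y)) \<in> regular Y U"
      using v b(2) sY o(2)
      by (intro linear_subset_diff linear_subset_regular regular_sum regular_mult regular_const) simp_all
    ultimately show ?thesis by (simp add: imgU)
  qed
  have "basis_mod (regular Y U) (img I U) n b"
    using b(2) ind in_span_modI[OF coords] by (simp add: basis_mod_iff[OF W regular_const[OF sY o(2)]])
  then show "img I \<in> hilb_chart Y n U b"
    using aff img s support_scheme_image[OF char sX, of e I "Suc e"]
    unfolding hilb_chart_def by (simp add: affine_iff)
  show "coord_mod (img I U) n b v i = coord_mod (I U) n' b' v i" if "v \<in> regular Y U" "i < n"
    by (rule coord_mod_eqI[OF W ind coords[OF that(1)] that(2)])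
qed

text \<open>A combination of the \<open>b i\<close> lying in \<open>Z\<close> is itself a section of
  \<open>Y\<close>, hence lies in the image, modulo which the \<open>b i\<close> are independent.
  They can therefore begin a basis modulo \<open>Z\<close>.\<close>

lemma lift_chart:
  assumes Z: "Z \<in> FB_points X (Suc e)" and c: "img Z \<in> hilb_chart Y n U b"
  obtains b' where "\<And>i. i < n \<Longrightarrow> b' i = b i" "Z \<in> hilb_chart Y' n' U b'"
proof -
  obtain x where x: "x \<in> points X" "support Y' Z = {x}" using FB_point_fat_point[OF char X Z] by blast
  have "Z \<in> topspace (hilb_topology Y' n')" using Z unfolding FB_points_def in_closure_of by blast
  then obtain U' w where Zc: "Z \<in> hilb_chart Y' n' U' w" unfolding topspace_hilb by blast
  then have cl: "closed_subscheme Y' Z" unfolding hilb_chart_def by simp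
  note s = support_scheme_image[OF char sX, of e Z "Suc e", unfolded x(2)]
  note chart = c[unfolded hilb_chart_iff_stalk[OF sY img_closed[OF cl] s]]
  then have U: "affine_open Y U" "x \<in> U" "openin (zariski Y) U" using affine_openD(1)[of Y U] by auto
  have b: "b i \<in> regular Y U" if "i < n" for i using chart that by blast
  have "independent_mod (germs Y' Z x) n b"
    unfolding independent_mod_def
  proof (intro allI impI)
    fix c i assume c: "(\<lambda>y. \<Sum>i<n. c i * b i y) \<in> germs Y' Z x" and i: "i < n"
    have "(\<lambda>y. \<Sum>i<n. c i * b i y) \<in> regular Y U"
      using b sY U(3) by (intro regular_sum regular_mult regular_const) simp_all
    then have "(\<lambda>y. \<Sum>i<n. c i * b i y) \<in> germs Y (regular Y) x" using U by (intro germsI)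
    then have "(\<lambda>y. \<Sum>i<n. c i * b i y) \<in> germs Y (img Z) x"
      using c germs_scheme_image[OF _ sY cl, of x] by simp
    then show "c i = 0" using independent_modD[of _ n b c i] chart i by blast
  qed
  moreover have "b i \<in> regular Y' U" if "i < n" for i using regular_sub[of U] U(3) b[OF that] by auto
  ultimately show ?thesis
    using hilb_chart_extend[OF sY' x(2) Zc, of U n b] U affine_iff n_le that by metis
qed

text \<open>A polynomial in the coordinates at level \<open>e\<close> becomes the same polynomial in
  coordinates with index below \<open>n\<close> at level \<open>Suc e\<close>. Equality is claimed
  on the F-blowup because it comes from \<open>image_in_chart\<close>.\<close>

lemma pullback_coords:
  assumes b: "\<And>i. i < n \<Longrightarrow> b' i = b i" "\<And>i. i < n \<Longrightarrow> b i \<in> regular Y U" and o: "openin (zariski X) U"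
    and P: "P \<in> hilb_coords Y n U b"
  shows "\<exists>P'\<in>hilb_coords Y' n' U b'. \<forall>I\<in>FB_points X (Suc e) \<inter> hilb_chart Y' n' U b'. P' I = P (img I)"
  using P unfolding hilb_coords_def
proof induction
  case (const c)
  show ?case by (intro bexI[OF _ alg_gen.const[of c]]) simp
next
  case (gen P)
  then obtain v i where vi: "P = (\<lambda>I. coord_mod (I U) n b v i)" "v \<in> regular Y U" "i < n" by blast
  show ?case
  proof (rule bexI)
    show "\<forall>I\<in>FB_points X (Suc e) \<inter> hilb_chart Y' n' U b'. coord_mod (I U) n' b' v i = P (img I)"
      using image_in_chart(2)[OF b _ _ vi(2,3)] by (simp add: vi(1))
    have "v \<in> regular Y' U" "i < n'" using regular_sub[OF o] vi n_le by auto
    then show "(\<lambda>I. coord_mod (I U) n' b' v i) \<in> alg_gen {\<lambda>I. coord_mod (I U) n' b' v i |v i. v \<in> regular Y' U \<and> i < n'}"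
      by (intro alg_gen.gen) blast
  qed
next
  case (add P Q)
  then obtain P' Q' where "P' \<in> alg_gen {\<lambda>I. coord_mod (I U) n' b' v i |v i. v \<in> regular Y' U \<and> i < n'}"
    "Q' \<in> alg_gen {\<lambda>I. coord_mod (I U) n' b' v i |v i. v \<in> regular Y' U \<and> i < n'}"
    "\<forall>I\<in>FB_points X (Suc e) \<inter> hilb_chart Y' n' U b'. P' I = P (img I)"
    "\<forall>I\<in>FB_points X (Suc e) \<inter> hilb_chart Y' n' U b'. Q' I = Q (img I)" by blast
  then show ?case by (intro bexI[OF _ alg_gen.add[of P' _ Q']]) simp_all
next
  case (mult P Q)
  then obtain P' Q' where "P' \<in> alg_gen {\<lambda>I. coord_mod (I U) n' b' v i |v i. v \<in> regular Y' U \<and> i < n'}"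
    "Q' \<in> alg_gen {\<lambda>I. coord_mod (I U) n' b' v i |v i. v \<in> regular Y' U \<and> i < n'}"
    "\<forall>I\<in>FB_points X (Suc e) \<inter> hilb_chart Y' n' U b'. P' I = P (img I)"
    "\<forall>I\<in>FB_points X (Suc e) \<inter> hilb_chart Y' n' U b'. Q' I = Q (img I)" by blast
  then show ?case by (intro bexI[OF _ alg_gen.mult[of P' _ Q']]) simp_all
qed

lemma lift_chart_coords:
  assumes Z: "Z \<in> FB_points X (Suc e)" and c: "img Z \<in> hilb_chart Y n U b"
  obtains b' where "Z \<in> hilb_chart Y' n' U b'"
    "\<And>I. I \<in> FB_points X (Suc e) \<Longrightarrow> I \<in> hilb_chart Y' n' U b' \<Longrightarrow> img I \<in> hilb_chart Y n U b"
    "\<And>P. P \<in> hilb_coords Y n U b \<Longrightarrow>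
      \<exists>P'\<in>hilb_coords Y' n' U b'. \<forall>I\<in>FB_points X (Suc e) \<inter> hilb_chart Y' n' U b'. P' I = P (img I)"
proof -
  obtain b' where b': "\<And>i. i < n \<Longrightarrow> b' i = b i" "Z \<in> hilb_chart Y' n' U b'" using lift_chart[OF assms] by blast
  have b: "b i \<in> regular Y U" if "i < n" for i using c that unfolding hilb_chart_def basis_mod_def by blast
  have o: "openin (zariski X) U" using c affine_openD(1)[of Y U] unfolding hilb_chart_def by simp
  show ?thesis
  proof (rule that[OF b'(2)])
    show "img I \<in> hilb_chart Y n U b" if "I \<in> FB_points X (Suc e)" "I \<in> hilb_chart Y' n' U b'" for I
      by (rule image_in_chart(1)[OF b'(1) b that])
    show "\<exists>P'\<in>hilb_coords Y' n' U b'. \<forall>I\<in>FB_points X (Suc e) \<inter> hilb_chart Y' n' U b'. P' I = P (img I)"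
      if "P \<in> hilb_coords Y n U b" for P
      by (rule pullback_coords[OF b'(1) b o that])
  qed
qed

text \<open>Lying in the space of the Hilbert scheme encodes that the image has length
  \<open>n\<close>. That it even lies in the F-blowup is derived in
  \<open>img_in_FB\<close>.\<close>

definition domain :: "('a, 'k) ideal_sheaf set" where
  "domain = {Z \<in> FB_points X (Suc e). img Z \<in> topspace (hilb_topology Y n)}"

text \<open>The common source of the openness of \<open>domain\<close>, with \<open>P\<close> the
  constant 1, and of the continuity of the image map, with \<open>P\<close> arbitrary.\<close>

lemma chart_nbhd:
  assumes Z: "Z \<in> FB_points X (Suc e)" and c: "img Z \<in> hilb_chart Y n U b"
    and P: "P \<in> hilb_coords Y n U b" "P (img Z) \<noteq> 0"
  obtains T where "openin (hilb_topology Y' n') T" "Z \<in> T"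
    "\<And>I. I \<in> T \<Longrightarrow> I \<in> FB_points X (Suc e) \<Longrightarrow> img I \<in> hilb_chart Y n U b \<and> P (img I) \<noteq> 0"
proof -
  obtain b' where b': "Z \<in> hilb_chart Y' n' U b'"
    "\<And>I. I \<in> FB_points X (Suc e) \<Longrightarrow> I \<in> hilb_chart Y' n' U b' \<Longrightarrow> img I \<in> hilb_chart Y n U b"
    "\<And>P. P \<in> hilb_coords Y n U b \<Longrightarrow>
      \<exists>P'\<in>hilb_coords Y' n' U b'. \<forall>I\<in>FB_points X (Suc e) \<inter> hilb_chart Y' n' U b'. P' I = P (img I)"
    using lift_chart_coords[OF Z c] by blast
  obtain P' where P': "P' \<in> hilb_coords Y' n' U b'"
    "\<And>I. I \<in> FB_points X (Suc e) \<Longrightarrow> I \<in> hilb_chart Y' n' U b' \<Longrightarrow> P' I = P (img I)" using b'(3)[OF P(1)] by blast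
  show ?thesis
    by (rule that[OF hilb_basic_open[OF P'(1)]]) (use P' b' Z P in auto)
qed

lemma domain_open: "openin (subtopology (hilb_topology Y' n') (FB_points X (Suc e))) domain"
proof (subst openin_subopen, intro ballI)
  fix Z assume "Z \<in> domain"
  then obtain U b where Z: "Z \<in> FB_points X (Suc e)" "img Z \<in> hilb_chart Y n U b"
    unfolding domain_def topspace_hilb by blast
  have "(\<lambda>_. 1) \<in> hilb_coords Y n U b" unfolding hilb_coords_def by (rule alg_gen.const)
  from chart_nbhd[OF Z this] obtain T where T: "openin (hilb_topology Y' n') T" "Z \<in> T"
    "\<And>I. I \<in> T \<Longrightarrow> I \<in> FB_points X (Suc e) \<Longrightarrow> img I \<in> hilb_chart Y n U b" by auto
  then show "\<exists>T. openin (subtopology (hilb_topology Y' n') (FB_points X (Suc e))) T \<and> Z \<in> T \<and> T \<subseteq> domain"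
    using Z by (intro exI[of _ "T \<inter> FB_points X (Suc e)"])
      (auto simp: domain_def topspace_hilb openin_subtopology)
qed

lemma img_continuous: "continuous_map (subtopology (hilb_topology Y' n') domain) (hilb_topology Y n) img"
  unfolding hilb_topology_def[of Y n]
proof (rule continuous_on_generated_topo)
  show "img ` topspace (subtopology (hilb_topology Y' n') domain)
      \<subseteq> \<Union> {{I \<in> hilb_chart Y n U b. P I \<noteq> 0} |U b P. P \<in> hilb_coords Y n U b}"
    unfolding domain_def hilb_topology_def[of Y n] topology_generated_by_topspace by auto
  fix S assume "S \<in> {{I \<in> hilb_chart Y n U b. P I \<noteq> 0} |U b P. P \<in> hilb_coords Y n U b}"
  then obtain U b P where S: "S = {I \<in> hilb_chart Y n U b. P I \<noteq> 0}" and P: "P \<in> hilb_coords Y n U b" by blast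
  show "openin (subtopology (hilb_topology Y' n') domain)
      (img -` S \<inter> topspace (subtopology (hilb_topology Y' n') domain))"
  proof (subst openin_subopen, intro ballI)
    fix Z assume Z: "Z \<in> img -` S \<inter> topspace (subtopology (hilb_topology Y' n') domain)"
    then obtain T where T: "openin (hilb_topology Y' n') T" "Z \<in> T"
      "\<And>I. I \<in> T \<Longrightarrow> I \<in> FB_points X (Suc e) \<Longrightarrow> img I \<in> hilb_chart Y n U b \<and> P (img I) \<noteq> 0"
      using chart_nbhd[OF _ _ P, of Z] S by (auto simp: domain_def)
    then show "\<exists>T. openin (subtopology (hilb_topology Y' n') domain) T \<and> Z \<in> T \<and>
        T \<subseteq> img -` S \<inter> topspace (subtopology (hilb_topology Y' n') domain)"
      using Z openin_subset[OF T(1)]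
      by (intro exI[of _ "T \<inter> domain"]) (auto simp: S openin_subtopology domain_def)
  qed
qed

section \<open>Comparison with the birational map over the smooth locus\<close>

lemma frob_fibre_fat_point:
  assumes "smooth_at X y" "frob_fibre X e' y \<in> FB_points X e'"
  shows "support (frob_root X e') (frob_fibre X e' y) = {y}" "scheme_image X (frob_fibre X e' y) = point_ideal X y"
proof -
  obtain x where x: "support (frob_root X e') (frob_fibre X e' y) = {x}"
    "scheme_image X (frob_fibre X e' y) = point_ideal X x"
    using FB_point_fat_point[OF char X assms(2)] by blast
  have "x = y" using frob_fibre_point_in_support[of y X e'] assms(1) x(1) unfolding smooth_at_def by auto
  with x show "support (frob_root X e') (frob_fibre X e' y) = {y}"
    "scheme_image X (frob_fibre X e' y) = point_ideal X y" by auto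
qed

text \<open>On \<open>domain\<close> the image has the full length \<open>n\<close> and lies over
  the smooth point \<open>y\<close>, so \<open>fat_point_over_smooth_point\<close> leaves only the
  Frobenius fibre.\<close>

lemma img_frob_fibre:
  assumes y: "smooth_at X y" and I: "frob_fibre X (Suc e) y \<in> domain"
  shows "img (frob_fibre X (Suc e) y) = frob_fibre X e y"
proof -
  let ?I = "frob_fibre X (Suc e) y"
  have F: "?I \<in> FB_points X (Suc e)" using I unfolding domain_def by blast
  obtain U b where c: "img ?I \<in> hilb_chart Y n U b" using I unfolding domain_def topspace_hilb by blast
  show ?thesis
    by (rule fat_point_over_smooth_point[OF char X y c])
      (simp_all add: support_scheme_image[OF char sX, of _ _ "Suc e"] scheme_image_scheme_image[OF sX] frob_fibre_fat_point[OF y F])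
qed

text \<open>A continuous map sends limits of smooth fibres to limits of their images, which are the
  smooth fibres one level lower. Openness of \<open>domain\<close> guarantees that the fibres
  approximating \<open>Z\<close> can be taken inside it.\<close>

lemma img_in_FB:
  assumes Z: "Z \<in> domain" shows "img Z \<in> FB_points X e"
  unfolding FB_points_def in_closure_of
proof (intro conjI allI impI)
  show "img Z \<in> topspace (hilb_topology Y n)" using Z unfolding domain_def by blast
  fix T assume T: "img Z \<in> T \<and> openin (hilb_topology Y n) T"
  define D where "D = subtopology (hilb_topology Y' n') domain"
  have dom: "domain \<subseteq> topspace (hilb_topology Y' n')"
    using FB_points_subset[of X "Suc e"] unfolding domain_def by blast
  have "openin D {I \<in> topspace D. img I \<in> T}"
    using openin_continuous_map_preimage[OF img_continuous conjunct2[OF T]] unfolding D_def .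
  moreover have "topspace D = domain" using dom by (auto simp: D_def)
  ultimately obtain T' where T': "openin (hilb_topology Y' n') T'" "{I \<in> domain. img I \<in> T} = T' \<inter> domain"
    unfolding D_def openin_subtopology by auto
  obtain T0 where T0: "openin (hilb_topology Y' n') T0" "domain = T0 \<inter> FB_points X (Suc e)"
    using domain_open unfolding openin_subtopology by blast
  have "Z \<in> T' \<inter> T0" using Z T T' T0 by blast
  moreover have "Z \<in> FB_points X (Suc e)" using Z unfolding domain_def by blast
  ultimately obtain y where y: "smooth_at X y" "frob_fibre X (Suc e) y \<in> T' \<inter> T0"
    using FB_points_dense[of Z X "Suc e" "T' \<inter> T0"] T' T0 by blast
  then obtain U b where "frob_fibre X (Suc e) y \<in> hilb_chart Y' n' U b"
    using openin_subset[OF T0(1)] unfolding topspace_hilb by blast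
  from FB_points_memI[OF y(1) this] have d: "frob_fibre X (Suc e) y \<in> domain" using y T0 by blast
  then have "img (frob_fibre X (Suc e) y) \<in> T" using y T' by blast
  then have "frob_fibre X e y \<in> T" by (simp add: img_frob_fibre[OF y(1) d])
  then show "\<exists>I. I \<in> {frob_fibre X e x |x. smooth_at X x} \<and> I \<in> T"
    using y(1) by (intro exI[of _ "frob_fibre X e y"]) auto
qed

text \<open>Over the smooth locus a point is recovered from its projection; this is the injectivity
  with which \<open>the_inv_into\<close> in \<open>FB_rho\<close> is evaluated.\<close>

lemma FB_smooth_part_eq:
  assumes "Z \<in> FB_smooth_part X e'"
  shows "Z = frob_fibre X e' (FB_proj X Z)" "smooth_at X (FB_proj X Z)"
proof -
  show sm: "smooth_at X (FB_proj X Z)" using assms unfolding FB_smooth_part_def by blast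
  have Z: "Z \<in> FB_points X e'" using assms unfolding FB_smooth_part_def points_FB by blast
  then obtain x where x: "x \<in> points X" "support (frob_root X e') Z = {x}" "scheme_image X Z = point_ideal X x"
    using FB_point_fat_point[OF char X] by blast
  have pr: "FB_proj X Z = x" by (rule FB_proj_eqI[OF X x(1,3)])
  obtain U b where "Z \<in> hilb_chart (frob_root X e') (fibre_length X e') U b"
    using Z unfolding FB_points_def in_closure_of topspace_hilb by blast
  from fat_point_over_smooth_point[OF char X _ this x(2,3)] sm pr show "Z = frob_fibre X e' (FB_proj X Z)" by simp
qed

text \<open>\<open>Z\<close> and \<open>img Z\<close> have the same image in \<open>X\<close>, so
  \<open>img Z\<close> is a preimage of \<open>FB_proj X Z\<close> in the smooth part, where
  preimages are unique.\<close>

lemma img_eq_rho: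
  assumes Z: "Z \<in> domain" "Z \<in> FB_smooth_part X (Suc e)"
  shows "img Z = FB_rho X e Z"
proof -
  have F: "Z \<in> FB_points X (Suc e)" using Z(1) unfolding domain_def by blast
  obtain x where x: "x \<in> points X" "scheme_image X Z = point_ideal X x"
    using FB_point_fat_point[OF char X F] by blast
  have pr: "FB_proj X Z = x" by (rule FB_proj_eqI[OF X x])
  have pr': "FB_proj X (img Z) = x" by (rule FB_proj_eqI[OF X x(1)]) (simp add: scheme_image_scheme_image[OF sX] x(2))
  have "img Z \<in> FB_smooth_part X e"
    using img_in_FB[OF Z(1)] FB_smooth_part_eq(2)[OF Z(2)] pr pr' unfolding FB_smooth_part_def points_FB by simp
  moreover have "inj_on (FB_proj X) (FB_smooth_part X e)"
    by (rule inj_onI) (metis FB_smooth_part_eq(1))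
  ultimately show ?thesis
    unfolding FB_rho_def pr pr'[symmetric] by (simp add: the_inv_into_f_f)
qed

text \<open>A local fraction \<open>P / Q\<close> in coordinates pulls back to a fraction
  \<open>P' / Q'\<close>, valid on an open set that lies in the chart of \<open>b'\<close> and maps
  into the set where \<open>P / Q\<close> was given.\<close>

lemma img_morphism: "is_morphism (open_subspace (FB X (Suc e)) domain) (FB X e) img"
proof -
  let ?S = "subtopology (hilb_topology Y' n') (FB_points X (Suc e))"
  have domFB: "domain \<subseteq> FB_points X (Suc e)" unfolding domain_def by blast
  then have zar: "zariski (open_subspace (FB X (Suc e)) domain) = subtopology (hilb_topology Y' n') domain"
    by (simp add: zariski_FB subtopology_subtopology Int_absorb1)
  have dom: "domain \<subseteq> topspace (hilb_topology Y' n')"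
    using FB_points_subset[of X "Suc e"] unfolding domain_def by blast
  then have pts: "points (open_subspace (FB X (Suc e)) domain) = domain" unfolding zar by auto
  have cont: "continuous_map (subtopology (hilb_topology Y' n') domain) (subtopology (hilb_topology Y n) (FB_points X e)) img"
    using img_continuous img_in_FB by (auto simp: continuous_map_in_subtopology)
  show ?thesis
    unfolding is_morphism_def
  proof (intro conjI allI impI)
    show "continuous_map (zariski (open_subspace (FB X (Suc e)) domain)) (zariski (FB X e)) img"
      unfolding zar zariski_FB by (rule cont)
    fix V h assume V: "openin (zariski (FB X e)) V" and h: "h \<in> regular (FB X e) V"
    show "(\<lambda>Z. h (img Z)) \<in> regular (open_subspace (FB X (Suc e)) domain)
        {Z \<in> points (open_subspace (FB X (Suc e)) domain). img Z \<in> V}"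
      unfolding pts unfolding open_subspace_simps regular_FB zariski_FB
    proof
      fix Z assume Z: "Z \<in> {Z \<in> domain. img Z \<in> V}"
      then have "img Z \<in> V" by simp
      from bspec[OF h[unfolded regular_FB zariski_FB] this] obtain V1 U b P Q where
        PQ: "P \<in> hilb_coords Y n U b" "Q \<in> hilb_coords Y n U b"
        and V1: "openin (subtopology (hilb_topology Y n) (FB_points X e)) V1" "img Z \<in> V1" "V1 \<subseteq> V \<inter> hilb_chart Y n U b"
          "\<And>J. J \<in> V1 \<Longrightarrow> Q J \<noteq> 0 \<and> h J = P J / Q J" by blast
      have ZF: "Z \<in> FB_points X (Suc e)" using Z domFB by blast
      have c: "img Z \<in> hilb_chart Y n U b" using V1 by blast
      obtain b' where b': "Z \<in> hilb_chart Y' n' U b'"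
        "\<And>I. I \<in> FB_points X (Suc e) \<Longrightarrow> I \<in> hilb_chart Y' n' U b' \<Longrightarrow> img I \<in> hilb_chart Y n U b"
        "\<And>P. P \<in> hilb_coords Y n U b \<Longrightarrow>
          \<exists>P'\<in>hilb_coords Y' n' U b'. \<forall>I\<in>FB_points X (Suc e) \<inter> hilb_chart Y' n' U b'. P' I = P (img I)"
        using lift_chart_coords[OF ZF c] by blast
      obtain P' Q' where P': "P' \<in> hilb_coords Y' n' U b'"
          "\<And>I. I \<in> FB_points X (Suc e) \<Longrightarrow> I \<in> hilb_chart Y' n' U b' \<Longrightarrow> P' I = P (img I)"
        and Q': "Q' \<in> hilb_coords Y' n' U b'"
          "\<And>I. I \<in> FB_points X (Suc e) \<Longrightarrow> I \<in> hilb_chart Y' n' U b' \<Longrightarrow> Q' I = Q (img I)"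
        using b'(3)[OF PQ(1)] b'(3)[OF PQ(2)] by blast
      \<comment> \<open>The whole chart as a basic open set, cut out by the constant polynomial
        1.\<close>
      define C where "C = {I \<in> hilb_chart Y' n' U b'. (\<lambda>_. 1) I \<noteq> (0::'k)}"
      have C: "openin (hilb_topology Y' n') C" unfolding C_def
        by (rule hilb_basic_open) (simp add: hilb_coords_def alg_gen.const)
      define A where "A = {I \<in> domain. img I \<in> V1}"
      have "openin (subtopology (hilb_topology Y' n') domain) A"
        using openin_continuous_map_preimage[OF cont V1(1)] dom by (simp add: A_def Int_absorb1)
      \<comment> \<open>\<open>A\<close> is open in \<open>domain\<close>, which is open in the
        F-blowup.\<close>
      then have "openin ?S A"
        using openin_trans_full[of ?S domain A] domain_open domFB by (simp add: subtopology_subtopology Int_absorb1)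
      then have o: "openin ?S (A \<inter> C)" using C by (auto simp: openin_subtopology)
      show "\<exists>T U b. \<exists>P\<in>hilb_coords Y' n' U b. \<exists>Q\<in>hilb_coords Y' n' U b.
        openin ?S T \<and> Z \<in> T \<and> T \<subseteq> {Z \<in> domain. img Z \<in> V} \<inter> hilb_chart Y' n' U b \<and>
          (\<forall>J\<in>T. Q J \<noteq> 0 \<and> h (img J) = P J / Q J)"
      proof (rule exI[of _ "A \<inter> C"], rule exI[of _ U], rule exI[of _ b'],
          rule bexI[OF _ P'(1)], rule bexI[OF _ Q'(1)], intro conjI ballI o)
        show "Z \<in> A \<inter> C" using Z V1 b' by (simp add: A_def C_def)
        show "A \<inter> C \<subseteq> {Z \<in> domain. img Z \<in> V} \<inter> hilb_chart Y' n' U b'"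
          using V1(3) by (auto simp: A_def C_def)
        fix J assume "J \<in> A \<inter> C"
        then have "J \<in> FB_points X (Suc e)" "J \<in> hilb_chart Y' n' U b'" "img J \<in> V1"
          using domFB by (auto simp: A_def C_def)
        then show "Q' J \<noteq> 0" "h (img J) = P' J / Q' J" using P'(2) Q'(2) V1(4) by auto
      qed
    qed
  qed
qed

end

theorem theorem1p3:
  fixes X :: "('a, 'k::alg_closed_field) fspace" and p e :: nat and Z :: "('a, 'k) ideal_sheaf"
  assumes "CHAR('k) = p" and "p > 0"
    and "variety X"
    and "Z \<in> points (FB X (Suc e))"
    and "scheme_image (frob_root X e) Z \<in> points (FB X e)"
  shows "rational_map_defined_with_value (FB X (Suc e)) (FB X e)
           (FB_smooth_part X (Suc e)) (FB_rho X e) Z (scheme_image (frob_root X e) Z)"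
proof -
  have char: "CHAR('k) > 0" using assms(1,2) by simp
  have im: "scheme_image (frob_root X e) Z \<in> FB_points X e" using assms(5) by (simp add: points_FB)
  obtain x where s: "support (frob_root X e) (scheme_image (frob_root X e) Z) = {x}"
    using FB_point_fat_point[OF char assms(3) im] by blast
  have top: "scheme_image (frob_root X e) Z \<in> topspace (hilb_topology (frob_root X e) (fibre_length X e))"
    using im unfolding FB_points_def in_closure_of by blast
  then obtain U b where c: "scheme_image (frob_root X e) Z \<in> hilb_chart (frob_root X e) (fibre_length X e) U b"
    unfolding topspace_hilb by blast
  \<comment> \<open>The fat point that yields the locale assumption \<open>ext\<close> is the image
    of \<open>Z\<close>.\<close>
  interpret FB_step X e
    using char assms(3) sections_extend_if_fat_point[OF space_with_functions_frob_root[OF char varietyD(1)[OF assms(3)]] c s]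
    by unfold_locales
  have Z: "Z \<in> domain" using assms(4) top by (simp add: domain_def points_FB)
  have "openin (zariski (FB X (Suc e))) domain"
    using domain_open by (simp add: zariski_FB)
  then show ?thesis
    unfolding rational_map_defined_with_value_def
    using Z img_morphism img_eq_rho by (intro exI[of _ domain] exI[of _ img]) auto
qed

end
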